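(* Let $\omega\in\mathbb{R}$ be a real root of $X^4-3X^3+3X^2-3X+1$, and let $R\subset\mathbb{R}^3$ be the following set of $35$ vectors: $(1,0,0)$, $(0,1,0)$, $(0,0,1)$, $(1,1,1)$, $(1,0,\omega)$, $(1,\omega^3-2\omega^2+\omega-1,0)$, $(0,1,-\omega+1)$, $(1,1,-\omega+1)$, $(1,-\omega+1,-\omega+1)$, $(1,\omega^2-\omega+1,\omega)$, $(1,-\omega+1,0)$, $(1,-\omega+1,\omega^2-2\omega+1)$, $(1,-\omega^3+3\omega^2-3\omega+2,-\omega^3+3\omega^2-2\omega+1)$, $(1,1,-\omega^2+2\omega)$, $(1,-\omega^3+2\omega^2-2\omega+2,1)$, $(1,-\omega^3+2\omega^2-2\omega+2,-\omega^3+2\omega^2-\omega+1)$, $(1,\omega^2-\omega+1,-\omega^3+2\omega^2-\omega+1)$, $(1,\omega^2-\omega+1,-\omega^3+3\omega^2-2\omega+1)$, $(3,-\omega^3+2\omega^2-2\omega+3,-\omega^2+2\omega+1)$, $(1,-\omega^3+2\omega^2-\omega+1,-\omega^2+2\omega)$, $(0,1,\omega^3-2\omega^2)$, $(1,-\omega^3+3\omega^2-2\omega+1,-\omega^3+\omega^2+3\omega-1)$, $(1,0,-\omega^2+2\omega-1)$, $(1,-\omega^3+2\omega^2-2\omega+2,\omega)$, $(1,-\omega^3+\omega^2-\omega+1,\omega)$, $(1,-\omega^3+2\omega^2-2\omega+2,0)$, $(1,-\omega^3+2\omega^2-\omega+1,-\omega^2+3\omega-1)$, $(1,0,-\omega^2+3\omega-1)$,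 $(0,1,\omega^3-2\omega^2-\omega+1)$, $(1,-\omega+1,-\omega^3+3\omega^2-2\omega+1)$, $(1,-\omega^3+2\omega^2-3\omega+2,-\omega^3+3\omega^2-2\omega+1)$, $(1,\omega^2+1,-\omega^2+2\omega)$, $(1,-\omega^3+3\omega^2-3\omega+2,-2\omega^3+5\omega^2-2\omega+1)$, $(1,-\omega^3+2\omega^2-\omega+1,-\omega^3+\omega^2+3\omega-1)$, $(1,-\omega^3+\omega^2-\omega+1,-\omega^2+2\omega)$. Viewing each vector $(a,b,c)\in R$ as the linear form $(x,y,z)\mapsto ax+by+cz$ on $\mathbb{R}^3$, let $\mathcal{A}$ be the set of the kernels of these linear forms. Then $\mathcal{A}$ is an arrangement with $35$ hyperplanes in $\mathbb{R}^3$ which is simplicial. The two possible real values of $\omega$ give arrangements with isomorphic oriented matroids. The automorphism group of the intersection lattice $L(\mathcal{A})$ is the dihedral group with $20$ elements. The characteristic polynomial of $L(\mathcal{A})$ is $(t-1)(t^2-34t+305)$; hence $\mathcal{A}$ is not free.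
   Context: An arrangement of hyperplanes $\mathcal{A}$ in $\mathbb{R}^3$ (here consisting of linear hyperplanes) is called simplicial if every connected component (chamber) of $\mathbb{R}^3\setminus\bigcup_{H\in\mathcal{A}}H$ is an open simplicial cone, i.e. of the form $\{a_1v_1+a_2v_2+a_3v_3\mid a_1,a_2,a_3>0\}$ for some basis $v_1,v_2,v_3$ of $\mathbb{R}^3$. The intersection lattice $L(\mathcal{A})$ is the poset of all intersections of elements of $\mathcal{A}$ (including $\mathbb{R}^3$ as the empty intersection), ranked by codimension. Its automorphism group is the group of poset automorphisms. The characteristic polynomial is $\chi(t)=\sum_{X\in L(\mathcal{A})}\mu(X)t^{\dim X}$ with $\mu$ the Möbius function of $L(\mathcal{A})$ ordered by reverse inclusion. "Free" is meant in the usual sense of hyperplane arrangements: the module of logarithmic derivations of $\mathcal{A}$ is a free module over the polynomial ring. *)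

theory Defs
  imports
    "HOL-Analysis.Analysis"
    "HOL-Algebra.Bij"
    "HOL-Computational_Algebra.Polynomial"
    "HOL-Library.Function_Algebras"
begin

section \<open>Central hyperplane arrangements\<close>

definition hyperplane_arrangement :: "'a::euclidean_space set set \<Rightarrow> bool" where
  "hyperplane_arrangement A \<longleftrightarrow> finite A \<and> (\<forall>H\<in>A. subspace H \<and> dim H = DIM('a) - 1)"

definition form_kernel :: "'a::euclidean_space \<Rightarrow> 'a set" where
  "form_kernel v = {x. v \<bullet> x = 0}"

definition open_simplicial_cone :: "(real^3) set \<Rightarrow> bool" where
  "open_simplicial_cone C \<longleftrightarrow>
     (\<exists>v1 v2 v3. distinct [v1, v2, v3] \<and> independent {v1, v2, v3} \<and> span {v1, v2, v3} = UNIV \<and>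
        C = {a1 *\<^sub>R v1 + a2 *\<^sub>R v2 + a3 *\<^sub>R v3 | a1 a2 a3. a1 > 0 \<and> a2 > 0 \<and> a3 > 0})"

definition chambers :: "'a::euclidean_space set set \<Rightarrow> 'a set set" where
  "chambers A = components (UNIV - \<Union>A)"

definition simplicial_arrangement :: "(real^3) set set \<Rightarrow> bool" where
  "simplicial_arrangement A \<longleftrightarrow> (\<forall>C\<in>chambers A. open_simplicial_cone C)"


section \<open>Oriented matroids of arrangements\<close>

text \<open>A choice \<open>n\<close> of one normal vector per hyperplane orients the arrangement. The oriented matroid
  has ground set \<open>A\<close>, and is given by its covectors: the sign vectors of the points of the space.\<close>

definition normals :: "'a::euclidean_space set set \<Rightarrow> ('a set \<Rightarrow> 'a) \<Rightarrow> bool" where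
  "normals A n \<longleftrightarrow> (\<forall>H\<in>A. n H \<noteq> 0 \<and> form_kernel (n H) = H)"

definition covectors :: "'a::euclidean_space set set \<Rightarrow> ('a set \<Rightarrow> 'a) \<Rightarrow> ('a set \<Rightarrow> real) set" where
  "covectors A n = {\<lambda>H\<in>A. sgn (n H \<bullet> x) | x. True}"

text \<open>Since the hyperplanes carry no preferred side, the oriented matroid of an arrangement is defined
  up to reorientation: two arrangements have isomorphic oriented matroids if, for suitable choices of
  normals, some bijection of the ground sets identifies the sets of covectors.\<close>

definition isomorphic_oriented_matroids ::
  "'a::euclidean_space set set \<Rightarrow> 'b::euclidean_space set set \<Rightarrow> bool" where
  "isomorphic_oriented_matroids A B \<longleftrightarrow>
     (\<exists>n m \<phi>. normals A n \<and> normals B m \<and> bij_betw \<phi> A B \<and>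
        (\<lambda>X. \<lambda>H\<in>A. X (\<phi> H)) ` covectors B m = covectors A n)"


section \<open>The intersection lattice\<close>

definition intersection_lattice :: "'a::euclidean_space set set \<Rightarrow> 'a set set" where
  "intersection_lattice A = {\<Inter>B | B. B \<subseteq> A}"

text \<open>Poset automorphisms for inclusion and for reverse inclusion coincide.\<close>

definition poset_automorphism_group :: "'a set set \<Rightarrow> ('a set \<Rightarrow> 'a set) monoid" where
  "poset_automorphism_group L =
     BijGroup L \<lparr>carrier := {f \<in> Bij L. \<forall>X\<in>L. \<forall>Y\<in>L. f X \<subseteq> f Y \<longleftrightarrow> X \<subseteq> Y}\<rparr>"

text \<open>The dihedral group with \<open>2n\<close> elements, as the semidirect product of \<open>\<int>/n\<close> by the group
  with two elements acting by negation: \<open>(a, False)\<close> is a rotation, \<open>(a, True)\<close> a reflection.\<close>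

definition dihedral_group :: "nat \<Rightarrow> (int \<times> bool) monoid" where
  "dihedral_group n =
     \<lparr>carrier = {0..<int n} \<times> UNIV,
      mult = (\<lambda>(a, s) (b, t). ((if s then a - b else a + b) mod int n, s \<noteq> t)),
      one = (0, False)\<rparr>"

lemma dihedral_group_is_group:
  assumes "n > 0"
  shows "group (dihedral_group n)"
proof (rule groupI)
  fix x y z
  show "x \<otimes>\<^bsub>dihedral_group n\<^esub> y \<otimes>\<^bsub>dihedral_group n\<^esub> z =
      x \<otimes>\<^bsub>dihedral_group n\<^esub> (y \<otimes>\<^bsub>dihedral_group n\<^esub> z)"
    by (cases x; cases y; cases z) (auto simp: dihedral_group_def mod_simps algebra_simps)
next
  fix x assume x: "x \<in> carrier (dihedral_group n)"
  obtain a s where [simp]: "x = (a, s)" by (cases x)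
  show "\<exists>y\<in>carrier (dihedral_group n). y \<otimes>\<^bsub>dihedral_group n\<^esub> x = \<one>\<^bsub>dihedral_group n\<^esub>"
    using x assms
    by (intro bexI[of _ "(if s then a else (- a) mod int n, s)"])
       (auto simp: dihedral_group_def mod_simps)
qed (use assms in \<open>auto simp: dihedral_group_def split: if_splits\<close>)

lemma card_dihedral_group: "card (carrier (dihedral_group n)) = 2 * n"
  by (simp add: dihedral_group_def card_cartesian_product)

text \<open>The Moebius function \<open>\<mu>(X, Y)\<close> of a finite family of sets ordered by reverse inclusion: \<open>X\<close> lies
  below \<open>Y\<close> iff \<open>Y \<subseteq> X\<close>. For an infinite family the value is meaningless.\<close>

function moebius :: "'a set set \<Rightarrow> 'a set \<Rightarrow> 'a set \<Rightarrow> int" where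
  "moebius L X Y =
     (if X = Y then 1
      else if finite L \<and> Y \<subset> X then - (\<Sum>Z\<in>{Z\<in>L. Y \<subset> Z \<and> Z \<subseteq> X}. moebius L X Z)
      else 0)"
  by pat_completeness auto
termination
proof (relation "Wellfounded.measure (\<lambda>(L, X, Y). card {Z\<in>L. Y \<subset> Z})")
  fix L :: "'a set set" and X Y Z
  assume "finite L \<and> Y \<subset> X" and Z: "Z \<in> {Z\<in>L. Y \<subset> Z \<and> Z \<subseteq> X}"
  then have "finite {Z\<in>L. Y \<subset> Z}" "{W\<in>L. Z \<subset> W} \<subset> {W\<in>L. Y \<subset> W}" by auto
  then show "((L, X, Z), (L, X, Y)) \<in> Wellfounded.measure (\<lambda>(L, X, Y). card {Z\<in>L. Y \<subset> Z})"
    by (simp add: psubset_card_mono)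
qed simp

declare moebius.simps [simp del]

definition characteristic_polynomial :: "'a::euclidean_space set set \<Rightarrow> int poly" where
  "characteristic_polynomial A =
     (\<Sum>X\<in>intersection_lattice A. monom (moebius (intersection_lattice A) UNIV X) (dim X))"


section \<open>Freeness\<close>

text \<open>The polynomial ring in three variables is represented as \<open>\<real>[x][y][z]\<close>.\<close>

type_synonym poly3 = "real poly poly poly"

definition Const :: "real \<Rightarrow> poly3" where "Const c = [:[:[:c:]:]:]"
definition Xvar :: poly3 where "Xvar = [:[:[:0, 1:]:]:]"
definition Yvar :: poly3 where "Yvar = [:[:0, 1:]:]"
definition Zvar :: poly3 where "Zvar = [:0, 1:]"

definition linear_form :: "real^3 \<Rightarrow> poly3" where
  "linear_form v = Const (v $ 1) * Xvar + Const (v $ 2) * Yvar + Const (v $ 3) * Zvar"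

definition derivations :: "(poly3 \<Rightarrow> poly3) set" where
  "derivations = {\<theta>. (\<forall>f g. \<theta> (f + g) = \<theta> f + \<theta> g) \<and> (\<forall>c f. \<theta> (Const c * f) = Const c * \<theta> f) \<and>
     (\<forall>f g. \<theta> (f * g) = f * \<theta> g + g * \<theta> f)}"

text \<open>A defining form of a hyperplane is unique up to a nonzero scalar, so it is harmless to
  quantify over all of them.\<close>

definition log_derivations :: "(real^3) set set \<Rightarrow> (poly3 \<Rightarrow> poly3) set" where
  "log_derivations A = {\<theta>\<in>derivations. \<forall>v. v \<noteq> 0 \<and> form_kernel v \<in> A \<longrightarrow> linear_form v dvd \<theta> (linear_form v)}"

definition der_scale :: "poly3 \<Rightarrow> (poly3 \<Rightarrow> poly3) \<Rightarrow> (poly3 \<Rightarrow> poly3)" where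
  "der_scale f \<theta> = (\<lambda>g. f * \<theta> g)"

lemma module_der_scale: "Modules.module der_scale"
  by unfold_locales (auto simp: der_scale_def fun_eq_iff algebra_simps)

lemma log_derivations_submodule: "module.subspace der_scale (log_derivations A)"
  unfolding module.subspace_def[OF module_der_scale]
  by (auto simp: log_derivations_def derivations_def der_scale_def algebra_simps)

definition free_submodule :: "('r::comm_ring_1 \<Rightarrow> 'm::ab_group_add \<Rightarrow> 'm) \<Rightarrow> 'm set \<Rightarrow> bool" where
  "free_submodule sc M \<longleftrightarrow>
     (\<exists>B. B \<subseteq> M \<and> \<not> module.dependent sc B \<and> module.span sc B = M)"

definition free_arrangement :: "(real^3) set set \<Rightarrow> bool" where
  "free_arrangement A \<longleftrightarrow> free_submodule der_scale (log_derivations A)"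


section \<open>The arrangement with 35 hyperplanes\<close>

definition is_parameter :: "real \<Rightarrow> bool" where
  "is_parameter \<omega> \<longleftrightarrow> \<omega>^4 - 3*\<omega>^3 + 3*\<omega>^2 - 3*\<omega> + 1 = 0"

definition R35 :: "real \<Rightarrow> (real^3) set" where
  "R35 \<omega> =
  {vector [1, 0, 0],
   vector [0, 1, 0],
   vector [0, 0, 1],
   vector [1, 1, 1],
   vector [1, 0, \<omega>],
   vector [1, \<omega>^3 - 2*\<omega>^2 + \<omega> - 1, 0],
   vector [0, 1, -\<omega> + 1],
   vector [1, 1, -\<omega> + 1],
   vector [1, -\<omega> + 1, -\<omega> + 1],
   vector [1, \<omega>^2 - \<omega> + 1, \<omega>],
   vector [1, -\<omega> + 1, 0],
   vector [1, -\<omega> + 1, \<omega>^2 - 2*\<omega> + 1],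
   vector [1, -(\<omega>^3) + 3*\<omega>^2 - 3*\<omega> + 2, -(\<omega>^3) + 3*\<omega>^2 - 2*\<omega> + 1],
   vector [1, 1, -(\<omega>^2) + 2*\<omega>],
   vector [1, -(\<omega>^3) + 2*\<omega>^2 - 2*\<omega> + 2, 1],
   vector [1, -(\<omega>^3) + 2*\<omega>^2 - 2*\<omega> + 2, -(\<omega>^3) + 2*\<omega>^2 - \<omega> + 1],
   vector [1, \<omega>^2 - \<omega> + 1, -(\<omega>^3) + 2*\<omega>^2 - \<omega> + 1],
   vector [1, \<omega>^2 - \<omega> + 1, -(\<omega>^3) + 3*\<omega>^2 - 2*\<omega> + 1],
   vector [3, -(\<omega>^3) + 2*\<omega>^2 - 2*\<omega> + 3, -(\<omega>^2) + 2*\<omega> + 1],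
   vector [1, -(\<omega>^3) + 2*\<omega>^2 - \<omega> + 1, -(\<omega>^2) + 2*\<omega>],
   vector [0, 1, \<omega>^3 - 2*\<omega>^2],
   vector [1, -(\<omega>^3) + 3*\<omega>^2 - 2*\<omega> + 1, -(\<omega>^3) + \<omega>^2 + 3*\<omega> - 1],
   vector [1, 0, -(\<omega>^2) + 2*\<omega> - 1],
   vector [1, -(\<omega>^3) + 2*\<omega>^2 - 2*\<omega> + 2, \<omega>],
   vector [1, -(\<omega>^3) + \<omega>^2 - \<omega> + 1, \<omega>],
   vector [1, -(\<omega>^3) + 2*\<omega>^2 - 2*\<omega> + 2, 0],
   vector [1, -(\<omega>^3) + 2*\<omega>^2 - \<omega> + 1, -(\<omega>^2) + 3*\<omega> - 1],
   vector [1, 0, -(\<omega>^2) + 3*\<omega> - 1],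
   vector [0, 1, \<omega>^3 - 2*\<omega>^2 - \<omega> + 1],
   vector [1, -\<omega> + 1, -(\<omega>^3) + 3*\<omega>^2 - 2*\<omega> + 1],
   vector [1, -(\<omega>^3) + 2*\<omega>^2 - 3*\<omega> + 2, -(\<omega>^3) + 3*\<omega>^2 - 2*\<omega> + 1],
   vector [1, \<omega>^2 + 1, -(\<omega>^2) + 2*\<omega>],
   vector [1, -(\<omega>^3) + 3*\<omega>^2 - 3*\<omega> + 2, -2*\<omega>^3 + 5*\<omega>^2 - 2*\<omega> + 1],
   vector [1, -(\<omega>^3) + 2*\<omega>^2 - \<omega> + 1, -(\<omega>^3) + \<omega>^2 + 3*\<omega> - 1],
   vector [1, -(\<omega>^3) + \<omega>^2 - \<omega> + 1, -(\<omega>^2) + 2*\<omega>]}"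

definition A35 :: "real \<Rightarrow> (real^3) set set" where
  "A35 \<omega> = form_kernel ` R35 \<omega>"

end

theory Submission
  imports Defs "HOL-Library.Code_Binary_Nat"
begin

text \<open>
  Let \<open>\<omega>\<close> be one of the parameters and \<open>n = 35\<close>. Everything is reduced to incidences between the planes
  and their lines of intersection. These are certified by exact integer arithmetic: the normals and
  a direction vector for each of the 171 lines have coordinates in \<open>\<int>[\<omega>]\<close>, and a sum
  \<open>a + b \<omega> + c \<omega>\<^sup>2 + d \<omega>\<^sup>3\<close> with integer coefficients vanishes only trivially (\<open>ev_eq_iff\<close>). A list of 171
  blocks of planes, each with a common line, is complete because the blocks cover all \<open>35 \<cdot> 34\<close>
  ordered pairs of planes (\<open>block_exists\<close>). From now on only the combinatorics of the blocks matters. The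
  sum of \<open>\<bar>B\<bar> - 1\<close> over the blocks \<open>B\<close> is 339 and the sum of \<open>\<bar>B\<bar>\<close> is 510.

  Characteristic polynomial: the Moebius function is \<open>-1\<close> on planes and \<open>\<bar>B\<bar> - 1\<close> on lines, so the
  polynomial is \<open>t\<^sup>3 - n t\<^sup>2 + 339 t - 305\<close>, with the factor \<open>t - 1\<close>.

  Simpliciality (\<open>simplicial_if_count\<close>): deletion and restriction give \<open>2 (1 + 339)\<close> chambers. A chamber
  has at least three walls, since the arrangement is essential. The number of pairs of a chamber and a wall is
  \<open>4 \<cdot> 510 = 3 \<cdot> 680\<close>: each plane is cut into twice as many regions as it contains lines, and each region is a
  wall of two chambers. Hence every chamber has exactly three walls, and a cone in \<open>\<real>\<^sup>3\<close> cut out by three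
  independent inequalities is simplicial.

  Non-freeness (\<open>free_imp_discriminant\<close>): a free arrangement would have exponents \<open>1, p, q\<close> with
  \<open>p + q = n - 1\<close> and \<open>p q = 305\<close>, by Terao's factorization theorem, but \<open>t\<^sup>2 - 34 t + 305\<close> has negative
  discriminant. What is needed here of that theorem is an inequality, for which the Hilbert function
  \<open>d(k)\<close> of the module of tangent polynomial vector fields suffices. Freeness makes the
  coordinates \<open>x, y, z\<close> a regular sequence on the module, so that the third differences of \<open>d\<close>
  are nonnegative (\<open>third_difference_nonneg\<close>). Imposing the planes one at a time bounds \<open>d(k)\<close> from below and
  above for large \<open>k\<close> (\<open>dim_tangent_deg_lower\<close>, \<open>dim_tangent_deg_upper\<close>). So the third differences behave like the
  numbers of generators of each degree: they sum to 3, with first moment \<open>n\<close> and a bounded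
  second moment (\<open>hilbert_bound\<close>), and the Euler field contributes to degree 1.

  Automorphisms: an automorphism of the lattice is a permutation of the planes that maps flats to flats
  (\<open>automorphism_induced\<close>). It preserves the colouring of pairs of planes by the size of their block. This
  colouring shows that an automorphism is determined by the images of the planes 0 and 27 (\<open>perm_rigid\<close>), and that
  these images are one of 20 pairs, on which an explicit dihedral group of symmetries acts simply
  transitively.

  Oriented matroids: the two parameters are \<open>\<omega>\<close> and \<open>1/\<omega>\<close>. An explicit linear map sends the
  normals of one arrangement to multiples of normals of the other (\<open>twisted_arrangement\<close>), and linear
  isomorphisms preserve the covectors.
\<close>

section \<open>Dimensions of finitely spanned subspaces\<close>

locale real_space = vector_space scale
  for scale :: "real \<Rightarrow> 'b::ab_group_add \<Rightarrow> 'b"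
begin

text \<open>Vector fields with polynomial coefficients form an infinite-dimensional space, on which dimension formulas
  from \<open>finite_dimensional_vector_space\<close> do not apply; hence the dimension theory of finitely spanned
  subspaces of an arbitrary vector space.\<close>

definition finite_dim :: "'b set \<Rightarrow> bool" where
  "finite_dim V \<longleftrightarrow> subspace V \<and> (\<exists>S. finite S \<and> V \<subseteq> span S)"

lemma fin_subspace: "finite_dim V \<Longrightarrow> subspace V" by (simp add: finite_dim_def)

lemma fin_subset: "finite_dim W \<Longrightarrow> subspace V \<Longrightarrow> V \<subseteq> W \<Longrightarrow> finite_dim V"
  unfolding finite_dim_def by blast

lemma fin_basis:
  assumes "finite_dim V"
  obtains B where "B \<subseteq> V" "independent B" "span B = V" "finite B" "card B = dim V"
proof -
  obtain S where S: "finite S" "V \<subseteq> span S" and V: "subspace V" using assms by (auto simp: finite_dim_def)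
  obtain B where B: "B \<subseteq> V" "independent B" "V \<subseteq> span B" "card B = dim V" using basis_exists by blast
  have "finite B" using independent_span_bound[OF S(1) B(2)] B(1) S(2) by auto
  moreover have "span B = V" using B V span_minimal by blast
  ultimately show ?thesis using that B by blast
qed

lemma fin_span: "finite B \<Longrightarrow> finite_dim (span B)"
  by (auto simp: finite_dim_def)

lemma independent_card_le:
  assumes "finite_dim V" "B \<subseteq> V" "independent B"
  shows "finite B" "card B \<le> dim V"
proof -
  obtain C where "C \<subseteq> V" "independent C" and C: "span C = V" "finite C" "card C = dim V"
    using fin_basis[OF assms(1)] .
  then have "B \<subseteq> span C" using assms(2) by simp
  from independent_span_bound[OF C(2) assms(3) this] show "finite B" "card B \<le> dim V"
    using C(3) by simp_all
qed

lemma fin_dim_mono: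
  assumes "finite_dim W" "subspace V" "V \<subseteq> W" shows "dim V \<le> dim W"
proof -
  obtain B where "B \<subseteq> V" "independent B" "span B = V" "finite B" "card B = dim V"
    using fin_basis[OF fin_subset[OF assms]] .
  then show ?thesis using independent_card_le(2)[OF assms(1), of B] assms(3) by auto
qed

lemma span_insert_elim:
  assumes "x \<in> span (B \<union> C)" obtains v y where "v \<in> span B" "y \<in> span C" "x = v + y"
  using assms unfolding span_Un by auto

text \<open>Vectors of \<open>W\<close> independent modulo \<open>V\<close> bound the codimension of \<open>V\<close> in \<open>W\<close> from below, without any need
  to form the quotient space.\<close>

lemma independent_modulo:
  assumes V: "finite_dim V" and W: "finite_dim W" "V \<subseteq> W" and I: "finite I" and w: "\<And>i. i \<in> I \<Longrightarrow> w i \<in> W"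
    and indep: "\<And>c. (\<Sum>i\<in>I. scale (c i) (w i)) \<in> V \<Longrightarrow> \<forall>i\<in>I. c i = 0"
  shows "dim V + card I \<le> dim W"
proof -
  obtain B where B: "B \<subseteq> V" "independent B" "span B = V" "finite B" "card B = dim V" using fin_basis[OF V] .
  have "independent (B \<union> w ` J) \<and> card (B \<union> w ` J) = card B + card J" if "finite J" "J \<subseteq> I" for J
    using that
  proof (induction J)
    case empty
    then show ?case using B by simp
  next
    case (insert j J)
    have notin: "w j \<notin> span (B \<union> w ` J)"
    proof
      assume "w j \<in> span (B \<union> w ` J)"
      then obtain v y where vy: "v \<in> span B" "y \<in> span (w ` J)" "w j = v + y" by (rule span_insert_elim)
      have "\<exists>c. y = (\<Sum>i\<in>J. scale (c i) (w i))"
        using vy(2)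
      proof (induction rule: span_induct_alt)
        case base
        show ?case by (intro exI[of _ "\<lambda>_. 0"]) simp
      next
        case (step d x y)
        then obtain i c where ic: "i \<in> J" "x = w i" "y = (\<Sum>i\<in>J. scale (c i) (w i))" by auto
        have "scale d x + y = (\<Sum>k\<in>J. scale (c k + (if k = i then d else 0)) (w k))"
          using ic insert.hyps(1) by (simp add: scale_left_distrib sum.distrib if_distrib[of "\<lambda>c. scale c _"] sum.delta cong: if_cong)
        then show ?case by (intro exI[of _ "\<lambda>k. c k + (if k = i then d else 0)"])
      qed
      then obtain c where c: "y = (\<Sum>i\<in>J. scale (c i) (w i))" by blast
      define e where "e k = (if k = j then - 1 else if k \<in> J then c k else 0)" for k
      have "(\<Sum>i\<in>I. scale (e i) (w i)) = (\<Sum>i\<in>insert j J. scale (e i) (w i))"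
        using insert I by (intro sum.mono_neutral_right) (auto simp: e_def)
      also have "\<dots> = - w j + (\<Sum>i\<in>J. scale (c i) (w i))"
        using insert.hyps by (auto simp: e_def intro!: sum.cong)
      also have "\<dots> = - v" using vy c by simp
      also have "\<dots> \<in> V" using vy(1) B(3) V fin_subspace subspace_neg by blast
      finally have "\<forall>i\<in>I. e i = 0" using indep by blast
      then show False using insert.prems by (auto simp: e_def)
    qed
    have "w j \<notin> B \<union> w ` J" using notin span_base[of "w j" "B \<union> w ` J"] by argo
    then have "card (insert (w j) (B \<union> w ` J)) = Suc (card (B \<union> w ` J))"
      using B(4) insert.hyps(1) by simp
    then show ?case using insert independent_insertI[OF notin] by simp
  qed
  then have "independent (B \<union> w ` I)" "card (B \<union> w ` I) = dim V + card I" using I B by auto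
  moreover have "B \<union> w ` I \<subseteq> W" using B W w by auto
  ultimately show ?thesis using independent_card_le(2)[OF W(1)] by metis
qed

lemma dim_family:
  assumes V: "subspace V" and I: "finite I" and w: "\<And>i. i \<in> I \<Longrightarrow> w i \<in> V"
    and indep: "\<And>c. (\<Sum>i\<in>I. scale (c i) (w i)) = 0 \<Longrightarrow> \<forall>i\<in>I. c i = 0"
    and span: "\<And>x. x \<in> V \<Longrightarrow> \<exists>c. x = (\<Sum>i\<in>I. scale (c i) (w i))"
  shows "finite_dim V" "dim V = card I"
proof -
  have sub: "V \<subseteq> span (w ` I)"
  proof
    fix x assume "x \<in> V"
    then obtain c where "x = (\<Sum>i\<in>I. scale (c i) (w i))" using span by blast
    moreover have "(\<Sum>i\<in>I. scale (c i) (w i)) \<in> span (w ` I)"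
      by (intro span_sum span_scale span_base) auto
    ultimately show "x \<in> span (w ` I)" by simp
  qed
  then show f: "finite_dim V" using V I unfolding finite_dim_def by blast
  have f0: "finite_dim {0}" unfolding finite_dim_def by (auto intro!: exI[of _ "{}"])
  have "dim {0} + card I \<le> dim V"
    by (rule independent_modulo[OF f0 f _ I w]) (use indep V in \<open>auto simp: subspace_0\<close>)
  moreover have "dim V \<le> card (w ` I)" using dim_le_card[OF sub] I by simp
  moreover have "card (w ` I) \<le> card I" using I by (rule card_image_le)
  ultimately show "dim V = card I" by linarith
qed

text \<open>One linear condition lowers the dimension by at most 1; this gives lower bounds for solution spaces.\<close>

lemma dim_kernel_functional:
  assumes V: "finite_dim V" and add: "\<And>x y. \<phi> (x + y) = \<phi> x + \<phi> y" and scale: "\<And>c x. \<phi> (scale c x) = c * \<phi> x"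
  shows "subspace {x \<in> V. \<phi> x = 0}" "dim V \<le> dim {x \<in> V. \<phi> x = 0} + 1"
proof -
  let ?K = "{x \<in> V. \<phi> x = 0}"
  have sV: "subspace V" using V by (rule fin_subspace)
  have "\<phi> 0 = 0" using scale[of 0 0] by simp
  then show sK: "subspace ?K" using sV add scale by (auto simp: subspace_def)
  show "dim V \<le> dim ?K + 1"
  proof (cases "V \<subseteq> ?K")
    case True
    then have "?K = V" by blast
    then show ?thesis by simp
  next
    case False
    then obtain u where u: "u \<in> V" "\<phi> u \<noteq> 0" by blast
    have fK: "finite_dim ?K" using fin_subset[OF V sK] by blast
    obtain B where "B \<subseteq> ?K" "independent B" and B: "span B = ?K" "finite B" "card B = dim ?K"
      using fin_basis[OF fK] .
    have "V \<subseteq> span (insert u B)"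
    proof
      fix x assume x: "x \<in> V"
      define k where "k = \<phi> x / \<phi> u"
      have "\<phi> (x - scale k u) = 0"
        using add[of "x - scale k u" "scale k u"] scale[of k u] u(2) by (simp add: k_def)
      then have "x - scale k u \<in> span B" using sV x u(1) by (simp add: B(1) subspace_diff subspace_scale)
      then show "x \<in> span (insert u B)" unfolding span_insert by blast
    qed
    then have "dim V \<le> card (insert u B)" using B(2) by (intro dim_le_card) auto
    also have "\<dots> \<le> card B + 1" using B(2) by (simp add: card_insert_if)
    finally show ?thesis using B(3) by simp
  qed
qed

lemma dim_sum_Int:
  assumes V: "finite_dim V" and W: "finite_dim W"
  shows "finite_dim {x + y |x y. x \<in> V \<and> y \<in> W}" (is "finite_dim ?S")
    and "dim {x + y |x y. x \<in> V \<and> y \<in> W} + dim (V \<inter> W) = dim V + dim W"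
proof -
  have sV: "subspace V" and sW: "subspace W" using V W fin_subspace by auto
  have sub: "subspace (V \<inter> W)" using sV sW by (rule subspace_inter)
  obtain A where A: "A \<subseteq> V \<inter> W" "independent A" "span A = V \<inter> W" "finite A" "card A = dim (V \<inter> W)"
    using fin_basis[OF fin_subset[OF V sub]] by blast
  obtain B where B: "B \<subseteq> V" "independent B" "span B = V" "finite B" "card B = dim V" using fin_basis[OF V] .
  have "A \<subseteq> W" using A(1) by blast
  then obtain C where C: "A \<subseteq> C" "C \<subseteq> W" "independent C" "W \<subseteq> span C"
    using maximal_independent_subset_extend[OF _ A(2)] by blast
  have fC: "finite C" using independent_card_le(1)[OF W C(2,3)] .
  have spC: "span C = W" "card C = dim W"
    using span_minimal[OF C(2) sW] C(4) basis_card_eq_dim[OF C(2,4,3)] by auto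
  have key: "independent (B \<union> D) \<and> card (B \<union> D) = card B + card D" if "finite D" "D \<subseteq> C - A" for D
    using that
  proof (induction D)
    case empty
    then show ?case using B by simp
  next
    case (insert d D)
    have notin: "d \<notin> span (B \<union> D)"
    proof
      assume "d \<in> span (B \<union> D)"
      then obtain v y where vy: "v \<in> span B" "y \<in> span D" "d = v + y" by (rule span_insert_elim)
      have "y \<in> W" using vy(2) insert.prems C(2) span_minimal[OF _ sW, of D] by blast
      moreover have "d \<in> W" using insert.prems C(2) by blast
      ultimately have "v \<in> W" using vy(3) sW subspace_diff[of W d y] by simp
      then have "v \<in> span A" using vy(1) A(3) B(3) by blast
      then have "d \<in> span (A \<union> D)" using vy(2,3) unfolding span_Un by blast
      moreover have "A \<union> D \<subseteq> C - {d}" using insert C(1) by blast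
      ultimately have "d \<in> span (C - {d})" using span_mono by blast
      then show False using C(3) insert.prems unfolding dependent_def by blast
    qed
    have "d \<notin> B \<union> D" using notin span_base[of d "B \<union> D"] by argo
    then have "card (insert d (B \<union> D)) = Suc (card (B \<union> D))"
      using B(4) insert.hyps(1) by simp
    then show ?case using insert independent_insertI[OF notin] by simp
  qed
  have k: "independent (B \<union> (C - A))" "card (B \<union> (C - A)) = card B + card (C - A)"
    using key[of "C - A"] fC by auto
  have S: "?S = span (B \<union> (C - A))"
  proof
    have "x \<in> span (B \<union> C)" if "x \<in> ?S" for x
      using that B(3) spC unfolding span_Un by blast
    moreover have "B \<union> C \<subseteq> span (B \<union> (C - A))"
    proof -
      have "A \<subseteq> span B" using A(1) B(3) by blast
      also have "\<dots> \<subseteq> span (B \<union> (C - A))" by (rule span_mono) blast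
      finally show ?thesis using span_superset[of "B \<union> (C - A)"] by blast
    qed
    then have "span (B \<union> C) \<subseteq> span (B \<union> (C - A))" by (rule span_minimal) (rule subspace_span)
    ultimately show "?S \<subseteq> span (B \<union> (C - A))" by blast
  next
    have "span (C - A) \<subseteq> W" using C(2) sW by (intro span_minimal) auto
    then show "span (B \<union> (C - A)) \<subseteq> ?S" unfolding span_Un B(3) by blast
  qed
  show "finite_dim ?S" unfolding S using B(4) fC by (intro fin_span) auto
  have "dim ?S = card B + card (C - A)" unfolding S using k by (simp add: dim_eq_card_independent)
  then show "dim ?S + dim (V \<inter> W) = dim V + dim W"
    using A(4,5) B(5) spC(2) C(1) card_mono[OF fC C(1)] by (simp add: card_Diff_subset)
qed

lemma dim_injective_image:
  assumes V: "finite_dim V" and add: "\<And>x y. f (x + y) = f x + f y" and sc: "\<And>c x. f (scale c x) = scale c (f x)"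
    and inj: "\<And>x. x \<in> V \<Longrightarrow> f x = 0 \<Longrightarrow> x = 0"
  shows "finite_dim (f ` V)" "dim (f ` V) = dim V"
proof -
  interpret f: Vector_Spaces.linear scale scale f
    by unfold_locales (auto simp: add sc)
  have injV: "inj_on f V"
  proof (rule inj_onI)
    fix x y assume xy: "x \<in> V" "y \<in> V" and "f x = f y"
    then have "f (x - y) = 0" by (simp add: f.diff)
    moreover have "x - y \<in> V" using xy V fin_subspace subspace_diff by blast
    ultimately show "x = y" using inj[of "x - y"] by simp
  qed
  obtain B where B: "B \<subseteq> V" "independent B" "span B = V" "finite B" "card B = dim V" using fin_basis[OF V] .
  have im: "span (f ` B) = f ` V" using f.span_image[of B] B(3) by simp
  then show "finite_dim (f ` V)" using B(4) fin_span[of "f ` B"] by simp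
  have "independent (f ` B)"
    by (rule f.independent_injective_image[OF B(2)]) (simp add: B(3) injV)
  then have "dim (f ` V) = card (f ` B)" using im by (metis dim_span_eq_card_independent)
  then show "dim (f ` V) = dim V" using B(5) inj_on_subset[OF injV B(1)] by (simp add: card_image)
qed

end

section \<open>Polynomial functions on \<open>\<real>\<^sup>3\<close>\<close>

definition peval :: "poly3 \<Rightarrow> real^3 \<Rightarrow> real" where
  "peval f v = poly (poly (poly f [:[:v $ 3:]:]) [:v $ 2:]) (v $ 1)"

lemma peval_simps [simp]:
  "peval 0 v = 0" "peval 1 v = 1" "peval (f + g) v = peval f v + peval g v"
  "peval (f - g) v = peval f v - peval g v" "peval (f * g) v = peval f v * peval g v"
  "peval (- f) v = - peval f v"
  "peval (Const c) v = c" "peval Xvar v = v $ 1" "peval Yvar v = v $ 2" "peval Zvar v = v $ 3"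
  by (simp_all add: peval_def Const_def Xvar_def Yvar_def Zvar_def)

lemma peval_linear_form [simp]: "peval (linear_form a) v = a \<bullet> v"
  by (simp add: linear_form_def inner_vec_def sum_3)

lemma infinite_const_polys: "infinite (range (\<lambda>y::'a::{idom,ring_char_0}. [:y:]))"
  using infinite_UNIV_char_0 finite_imageD[of "\<lambda>y::'a. [:y:]" UNIV] by (auto simp: inj_def)

lemma poly_eq_0_if_const_roots:
  fixes p :: "'a::{idom,ring_char_0} poly poly"
  assumes "\<And>y. poly p [:y:] = 0" shows "p = 0"
proof (rule ccontr)
  assume "p \<noteq> 0"
  then have "finite {c. poly p c = 0}" by (rule poly_roots_finite)
  then show False using assms infinite_const_polys finite_subset[of "range (\<lambda>y::'a. [:y:])" "{c. poly p c = 0}"] by auto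
qed

lemma poly2_eq_0:
  fixes p :: "real poly poly"
  assumes "\<And>x y. poly (poly p [:y:]) x = 0" shows "p = 0"
  using assms poly_all_0_iff_0 by (intro poly_eq_0_if_const_roots) blast

lemma peval_eq_0:
  assumes "\<And>v. peval f v = 0" shows "f = 0"
proof -
  have *: "poly f [:[:z:]:] = 0" for z
  proof (rule poly2_eq_0)
    fix x y
    show "poly (poly (poly f [:[:z:]:]) [:y:]) x = 0"
      using assms[of "vector [x, y, z]"] by (simp add: peval_def)
  qed
  show ?thesis
  proof (rule ccontr)
    assume "f \<noteq> 0"
    then have "finite {c. poly f c = 0}" by (rule poly_roots_finite)
    moreover have "range (\<lambda>z. [:[:z:]:]) \<subseteq> {c. poly f c = 0}" using * by auto
    moreover have "infinite (range (\<lambda>z::real. [:[:z:]:]))"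
      using infinite_UNIV_char_0 finite_imageD[of "\<lambda>y::real. [:[:y:]:]" UNIV] by (auto simp: inj_def)
    ultimately show False using finite_subset by blast
  qed
qed

lemma peval_inj: "peval f = peval g \<Longrightarrow> f = g"
  using peval_eq_0[of "f - g"] by simp

lemma hom_poly_eval:
  fixes f :: "'a::comm_ring_1 poly" and h :: "'a \<Rightarrow> 'b::comm_ring_1"
  assumes "\<And>a b. h (a + b) = h a + h b" "\<And>a b. h (a * b) = h a * h b" "h r = h r'"
  shows "h (poly f r) = h (poly f r')"
  using assms by (induction f) auto

text \<open>Divisibility of \<open>\<theta>(\<alpha>)\<close> by \<open>\<alpha>\<close>, which defines logarithmic derivations, thus means tangency to a plane.
  The form is solved for one of the variables with a nonzero coefficient: if that is the outermost variable
  \<open>z\<close>, substituting the solution is evaluation at a root; otherwise the coefficients of powers of \<open>z\<close> are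
  treated in the same way with one variable less.\<close>

lemma linear_form_dvd:
  assumes a: "a \<noteq> 0" and van: "\<And>v. a \<bullet> v = 0 \<Longrightarrow> peval f v = 0"
  shows "linear_form a dvd f"
proof -
  define b where "b = ([:[:0, a $ 1:], [:a $ 2:]:] :: real poly poly)"
  have lf: "linear_form a = [:b, [:[:a $ 3:]:]:]"
    by (simp add: linear_form_def Const_def Xvar_def Yvar_def Zvar_def b_def)
  have in3: "a \<bullet> vector [x, y, z] = a $ 1 * x + a $ 2 * y + a $ 3 * z" for x y z
    by (simp add: inner_vec_def sum_3)
  have pv: "peval f (vector [x, y, z]) = poly (poly (poly f [:[:z:]:]) [:y:]) x" for x y z
    by (simp add: peval_def)
  show ?thesis
  proof (cases "a $ 3 = 0")
    case False
    define r where "r = ([:[:0, - (a $ 1 / a $ 3):], [:- (a $ 2 / a $ 3):]:] :: real poly poly)"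
    have "poly f r = 0"
    proof (rule poly2_eq_0)
      fix x y :: real
      let ?h = "\<lambda>q :: real poly poly. poly (poly q [:y:]) x"
      define z where "z = - (a $ 1 / a $ 3) * x - (a $ 2 / a $ 3) * y"
      have "?h (poly f r) = ?h (poly f [:[:z:]:])"
        by (rule hom_poly_eval) (auto simp: r_def z_def algebra_simps)
      also have "\<dots> = 0" unfolding pv[symmetric]
        by (rule van) (use False in \<open>simp add: in3 z_def field_simps\<close>)
      finally show "?h (poly f r) = 0" .
    qed
    then obtain q where q: "f = [:- r, 1:] * q" by (auto simp: poly_eq_0_iff_dvd elim: dvdE)
    have "[:- r, 1:] = linear_form a * Const (1 / a $ 3)"
      using False by (simp add: lf b_def r_def Const_def one_pCons)
    then show ?thesis unfolding q by (simp add: mult.assoc)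
  next
    case a3: True
    have co: "poly (poly (coeff f n) [:y:]) x = 0" if "a $ 1 * x + a $ 2 * y = 0" for n x y
    proof -
      let ?h = "\<lambda>q :: real poly poly. poly (poly q [:y:]) x"
      have "poly (map_poly ?h f) z = 0" for z
      proof -
        have "poly (map_poly ?h f) z = ?h (poly f [:[:z:]:])"
          by (induction f) (auto simp: map_poly_pCons)
        also have "\<dots> = 0" unfolding pv[symmetric] using that by (intro van) (simp add: in3 a3)
        finally show ?thesis .
      qed
      then have "map_poly ?h f = 0" using poly_all_0_iff_0 by blast
      then have "coeff (map_poly ?h f) n = 0" by simp
      then show ?thesis by (simp add: coeff_map_poly)
    qed
    have "b dvd coeff f n" for n
    proof (cases "a $ 2 = 0")
      case False
      define r where "r = [:0, - (a $ 1 / a $ 2):]"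
      have "poly (coeff f n) r = 0"
      proof -
        have "poly (poly (coeff f n) r) x = 0" for x
        proof -
          have "poly (poly (coeff f n) r) x = poly (poly (coeff f n) [:poly r x:]) x"
            by (rule hom_poly_eval) auto
          also have "\<dots> = 0" by (rule co) (use False in \<open>simp add: r_def field_simps\<close>)
          finally show ?thesis .
        qed
        then show ?thesis using poly_all_0_iff_0 by blast
      qed
      then obtain q where q: "coeff f n = [:- r, 1:] * q" by (auto simp: poly_eq_0_iff_dvd elim: dvdE)
      have "[:- r, 1:] = b * [:[:1 / a $ 2:]:]"
        using False by (simp add: b_def r_def one_pCons)
      then have "coeff f n = b * ([:[:1 / a $ 2:]:] * q)" unfolding q by (simp only: mult.assoc)
      then show ?thesis by (rule dvdI)
    next
      case a2: True
      have a1: "a $ 1 \<noteq> 0" using a a2 a3 by (auto simp: vec_eq_iff forall_3)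
      have "[:0, a $ 1:] dvd coeff (coeff f n) m" for m
      proof -
        have "poly (map_poly (\<lambda>q. poly q 0) (coeff f n)) y = 0" for y
        proof -
          have "poly (map_poly (\<lambda>q. poly q 0) g) y = poly (poly g [:y:]) 0" for g :: "real poly poly"
            by (induction g) (auto simp: map_poly_pCons)
          then have "poly (map_poly (\<lambda>q. poly q 0) (coeff f n)) y = poly (poly (coeff f n) [:y:]) 0" .
          also have "\<dots> = 0" by (rule co) (simp add: a2)
          finally show ?thesis .
        qed
        then have "map_poly (\<lambda>q. poly q 0) (coeff f n) = 0" using poly_all_0_iff_0 by blast
        then have "coeff (map_poly (\<lambda>q. poly q 0) (coeff f n)) m = 0" by simp
        then have "poly (coeff (coeff f n) m) 0 = 0" by (simp add: coeff_map_poly)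
        then obtain q where q: "coeff (coeff f n) m = [:- 0, 1:] * q" by (auto simp: poly_eq_0_iff_dvd elim: dvdE)
        have "[:- 0, 1:] = [:0, a $ 1:] * [:1 / a $ 1:]" using a1 by simp
        then show ?thesis unfolding q by (metis dvd_mult2 dvd_triv_left)
      qed
      then have "[:[:0, a $ 1:]:] dvd coeff f n" by (simp add: const_poly_dvd_iff)
      then show ?thesis using a2 by (simp add: b_def)
    qed
    then have "[:b:] dvd f" by (simp add: const_poly_dvd_iff)
    then show ?thesis using a3 by (simp add: lf)
  qed
qed

subsection \<open>Homogeneous polynomial functions\<close>

definition poly_funs :: "(real^3 \<Rightarrow> real) set" where "poly_funs = range peval"

lemma poly_fun_I: "(\<And>v. g v = peval f v) \<Longrightarrow> g \<in> poly_funs"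
  unfolding poly_funs_def by (auto intro: range_eqI[of _ _ f])

lemma poly_fun_add: "f \<in> poly_funs \<Longrightarrow> g \<in> poly_funs \<Longrightarrow> (\<lambda>v. f v + g v) \<in> poly_funs"
proof -
  assume "f \<in> poly_funs" "g \<in> poly_funs"
  then obtain p q where "f = peval p" "g = peval q" by (auto simp: poly_funs_def)
  then show ?thesis by (intro poly_fun_I[of _ "p + q"]) simp
qed

lemma poly_fun_mult: "f \<in> poly_funs \<Longrightarrow> g \<in> poly_funs \<Longrightarrow> (\<lambda>v. f v * g v) \<in> poly_funs"
proof -
  assume "f \<in> poly_funs" "g \<in> poly_funs"
  then obtain p q where "f = peval p" "g = peval q" by (auto simp: poly_funs_def)
  then show ?thesis by (intro poly_fun_I[of _ "p * q"]) simp
qed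

lemma poly_fun_const: "(\<lambda>v. c) \<in> poly_funs" by (rule poly_fun_I[of _ "Const c"]) simp
lemma poly_fun_inner: "(\<lambda>v. a \<bullet> v) \<in> poly_funs" by (rule poly_fun_I[of _ "linear_form a"]) simp
lemma poly_fun_coord: "(\<lambda>v. v $ i) \<in> poly_funs"
  using poly_fun_inner[of "axis i 1"] by (simp add: inner_axis')

lemma poly_fun_power: "f \<in> poly_funs \<Longrightarrow> (\<lambda>v. f v ^ n) \<in> poly_funs"
  by (induction n) (auto simp: poly_fun_const poly_fun_mult)

text \<open>The degree is encoded by scaling behaviour, so that homogeneous components are extracted by comparing coefficients
  in the scaling parameter (\<open>real_poly_coeffs_eq\<close>).\<close>

definition hom_funs :: "nat \<Rightarrow> (real^3 \<Rightarrow> real) set" where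
  "hom_funs k = {f \<in> poly_funs. \<forall>t v. f (t *\<^sub>R v) = t ^ k * f v}"

lemma hom_fun_poly_fun: "f \<in> hom_funs k \<Longrightarrow> f \<in> poly_funs" by (simp add: hom_funs_def)
lemma hom_fun_scaleR: "f \<in> hom_funs k \<Longrightarrow> f (t *\<^sub>R v) = t ^ k * f v" by (simp add: hom_funs_def)

lemma hom_fun_mult: "f \<in> hom_funs k \<Longrightarrow> g \<in> hom_funs l \<Longrightarrow> (\<lambda>v. f v * g v) \<in> hom_funs (k + l)"
  by (auto simp: hom_funs_def poly_fun_mult power_add algebra_simps)

lemma hom_fun_add: "f \<in> hom_funs k \<Longrightarrow> g \<in> hom_funs k \<Longrightarrow> (\<lambda>v. f v + g v) \<in> hom_funs k"
  by (auto simp: hom_funs_def poly_fun_add algebra_simps)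

lemma hom_fun_cmult: "f \<in> hom_funs k \<Longrightarrow> (\<lambda>v. c * f v) \<in> hom_funs k"
  by (auto simp: hom_funs_def poly_fun_mult poly_fun_const)

lemma hom_fun_0: "(\<lambda>v. 0) \<in> hom_funs k"
  by (auto simp: hom_funs_def poly_fun_const)

lemma hom_fun_const: "(\<lambda>v. c) \<in> hom_funs 0"
  by (auto simp: hom_funs_def poly_fun_const)

lemma hom_fun_inner: "(\<lambda>v. a \<bullet> v) \<in> hom_funs 1"
  by (auto simp: hom_funs_def poly_fun_inner)

lemma hom_fun_coord: "(\<lambda>v. v $ i) \<in> hom_funs 1"
  by (auto simp: hom_funs_def poly_fun_coord)

lemma hom_fun_power: "f \<in> hom_funs k \<Longrightarrow> (\<lambda>v. f v ^ m) \<in> hom_funs (k * m)"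
  by (auto simp: hom_funs_def poly_fun_power power_mult_distrib power_mult)

lemma hom_fun_sum: "(\<And>i. i \<in> S \<Longrightarrow> f i \<in> hom_funs k) \<Longrightarrow> (\<lambda>v. \<Sum>i\<in>S. f i v) \<in> hom_funs k"
  by (induction S rule: infinite_finite_induct) (auto simp: hom_fun_0 hom_fun_add)

lemma hom_fun_prod: "finite S \<Longrightarrow> (\<And>i. i \<in> S \<Longrightarrow> f i \<in> hom_funs 1) \<Longrightarrow> (\<lambda>v. \<Prod>i\<in>S. f i v) \<in> hom_funs (card S)"
proof (induction S rule: finite_induct)
  case (insert x S)
  then show ?case using hom_fun_mult[of "f x" 1 "\<lambda>v. \<Prod>i\<in>S. f i v" "card S"] by simp
qed (simp add: hom_fun_const)

definition mono3 :: "nat \<times> nat \<times> nat \<Rightarrow> real^3 \<Rightarrow> real" where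
  "mono3 s v = (case s of (a, b, c) \<Rightarrow> v $ 1 ^ a * v $ 2 ^ b * v $ 3 ^ c)"

definition deg3 :: "nat \<times> nat \<times> nat \<Rightarrow> nat" where
  "deg3 s = (case s of (a, b, c) \<Rightarrow> a + b + c)"

lemma mono3_hom_fun: "mono3 s \<in> hom_funs (deg3 s)"
proof -
  obtain a b c where s: "s = (a, b, c)" by (cases s)
  have "(\<lambda>v. v $ 1 ^ a * v $ 2 ^ b * v $ 3 ^ c) \<in> hom_funs (1 * a + 1 * b + 1 * c)"
    by (intro hom_fun_mult hom_fun_power hom_fun_coord)
  moreover have "(\<lambda>v. v $ 1 ^ a * v $ 2 ^ b * v $ 3 ^ c) = mono3 s" by (simp add: mono3_def s fun_eq_iff)
  ultimately show ?thesis by (simp add: deg3_def s)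
qed

lemma poly_fun_monomials:
  assumes "f \<in> poly_funs"
  shows "\<exists>S w. finite S \<and> (\<forall>v. f v = (\<Sum>s\<in>S. w s * mono3 s v))"
proof -
  obtain p where p: "f = peval p" using assms by (auto simp: poly_funs_def)
  define A where "A = (SIGMA c:{..degree p}. SIGMA b:{..degree (coeff p c)}. {..degree (coeff (coeff p c) b)})"
  define g where "g = (\<lambda>(c::nat, b::nat, a::nat). (a, b, c))"
  have finite_dim: "finite A" by (auto simp: A_def)
  have inj: "inj_on g A" by (auto simp: g_def inj_on_def)
  have "f v = (\<Sum>s\<in>g ` A. (case s of (a, b, c) \<Rightarrow> coeff (coeff (coeff p c) b) a) * mono3 s v)" for v
  proof -
    have "f v = (\<Sum>c\<le>degree p. poly (poly (coeff p c) [:v $ 2:]) (v $ 1) * v $ 3 ^ c)"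
      by (simp add: p peval_def poly_altdef[of p] poly_sum poly_power)
    also have "\<dots> = (\<Sum>c\<le>degree p. (\<Sum>b\<le>degree (coeff p c). poly (coeff (coeff p c) b) (v $ 1) * v $ 2 ^ b) * v $ 3 ^ c)"
      by (simp add: poly_altdef[of "coeff p _"] poly_sum poly_power)
    also have "\<dots> = (\<Sum>c\<le>degree p. \<Sum>b\<le>degree (coeff p c). \<Sum>a\<le>degree (coeff (coeff p c) b).
        coeff (coeff (coeff p c) b) a * mono3 (a, b, c) v)"
      by (simp add: poly_altdef[of "coeff (coeff p _) _"] sum_distrib_right sum_distrib_left mono3_def mult_ac)
    also have "\<dots> = (\<Sum>(c, b, a)\<in>A. coeff (coeff (coeff p c) b) a * mono3 (a, b, c) v)"
      unfolding A_def by (simp add: sum.Sigma)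
    also have "\<dots> = (\<Sum>s\<in>g ` A. (case s of (a, b, c) \<Rightarrow> coeff (coeff (coeff p c) b) a) * mono3 s v)"
      by (subst sum.reindex[OF inj]) (auto simp: g_def case_prod_beta intro!: sum.cong)
    finally show ?thesis .
  qed
  then show ?thesis using finite_dim by (intro exI[of _ "g ` A"]) auto
qed

lemma poly_fun_decomp:
  assumes "f \<in> poly_funs"
  shows "\<exists>N g. (\<forall>j. g j \<in> hom_funs j) \<and> (\<forall>v. f v = (\<Sum>j\<le>N. g j v))"
proof -
  obtain S w where S: "finite S" "\<And>v. f v = (\<Sum>s\<in>S. w s * mono3 s v)" using poly_fun_monomials[OF assms] by blast
  define N where "N = Max (insert 0 (deg3 ` S))"
  define g where "g j v = (\<Sum>s\<in>{s\<in>S. deg3 s = j}. w s * mono3 s v)" for j v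
  have "g j \<in> hom_funs j" for j
    unfolding g_def by (intro hom_fun_sum hom_fun_cmult) (use mono3_hom_fun in auto)
  moreover have "f v = (\<Sum>j\<le>N. g j v)" for v
    unfolding S(2) g_def using S(1) by (intro sum.group[symmetric]) (auto simp: N_def)
  ultimately show ?thesis by blast
qed

lemma real_poly_coeffs_eq:
  fixes c :: "nat \<Rightarrow> real"
  assumes "\<And>t. (\<Sum>j\<le>N. c j * t ^ j) = d * t ^ k"
  shows "d = (if k \<le> N then c k else 0)"
proof -
  define p where "p = (\<Sum>j\<le>N. monom (c j) j) - monom d k"
  have "poly p t = 0" for t using assms[of t] by (simp add: p_def poly_sum poly_monom)
  then have "p = 0" using poly_all_0_iff_0 by blast
  then have "coeff p k = 0" by simp
  then show ?thesis by (simp add: p_def coeff_sum coeff_diff sum.delta split: if_splits)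
qed

definition tri :: "nat \<Rightarrow> (nat \<times> nat) set" where "tri k = {(a, b). a + b \<le> k}"

lemma finite_tri [simp]: "finite (tri k)"
  by (rule finite_subset[of _ "{..k} \<times> {..k}"]) (auto simp: tri_def)

lemma card_tri: "2 * card (tri k) = (k + 1) * (k + 2)"
proof -
  have "tri k = (SIGMA a:{..k}. {..k - a})" by (auto simp: tri_def)
  then have "card (tri k) = (\<Sum>a\<le>k. (k - a) + 1)" by simp
  also have "\<dots> = (\<Sum>a\<le>k. a + 1)" by (rule sum.reindex_bij_witness[of _ "\<lambda>a. k - a" "\<lambda>a. k - a"]) auto
  finally have c: "card (tri k) = (\<Sum>a\<le>k. a + 1)" .
  show ?thesis unfolding c by (induction k) auto
qed

text \<open>The exponent of the third variable is determined by the degree \<open>k\<close>, so \<open>tri k\<close> indexes the monomials of degree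
  \<open>k\<close> in three variables.\<close>

definition mono2 :: "nat \<Rightarrow> nat \<times> nat \<Rightarrow> real^3 \<Rightarrow> real" where
  "mono2 k s = mono3 (fst s, snd s, k - fst s - snd s)"

lemma mono2_hom_fun: "s \<in> tri k \<Longrightarrow> mono2 k s \<in> hom_funs k"
  using mono3_hom_fun[of "(fst s, snd s, k - fst s - snd s)"] by (auto simp: mono2_def deg3_def tri_def)

lemma hom_fun_monomials:
  assumes "f \<in> hom_funs k"
  shows "\<exists>w. \<forall>v. f v = (\<Sum>s\<in>tri k. w s * mono2 k s v)"
proof -
  obtain S w where S: "finite S" "\<And>v. f v = (\<Sum>s\<in>S. w s * mono3 s v)" using poly_fun_monomials[OF hom_fun_poly_fun[OF assms]] by blast
  define e where "e = (\<lambda>(a, b). (a, b, k - a - b))"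
  define T where "T = {s\<in>tri k. e s \<in> S}"
  have fv: "f v = (\<Sum>s\<in>{s\<in>S. deg3 s = k}. w s * mono3 s v)" for v
  proof -
    define p where "p = (\<Sum>s\<in>S. monom (w s * mono3 s v) (deg3 s)) - monom (f v) k"
    have "poly p t = 0" for t
    proof -
      have "(\<Sum>s\<in>S. w s * mono3 s v * t ^ deg3 s) = f (t *\<^sub>R v)"
        unfolding S(2) by (intro sum.cong) (simp_all add: hom_fun_scaleR[OF mono3_hom_fun] mult_ac)
      then show ?thesis by (simp add: p_def poly_sum poly_monom hom_fun_scaleR[OF assms] mult_ac)
    qed
    then have "p = 0" using poly_all_0_iff_0 by blast
    then have "coeff p k = 0" by simp
    then have "f v = (\<Sum>s\<in>S. if deg3 s = k then w s * mono3 s v else 0)"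
      by (simp add: p_def coeff_sum coeff_diff)
    then show ?thesis using S(1) by (simp add: sum.inter_filter)
  qed
  have img: "{s\<in>S. deg3 s = k} = e ` T"
    by (force simp: e_def T_def deg3_def tri_def image_iff)
  have inj: "inj_on e T" by (auto simp: e_def inj_on_def)
  have "f v = (\<Sum>s\<in>tri k. (if s \<in> T then w (e s) else 0) * mono2 k s v)" for v
  proof -
    have "f v = (\<Sum>s\<in>T. w (e s) * mono3 (e s) v)"
      unfolding fv img by (simp add: sum.reindex[OF inj])
    also have "\<dots> = (\<Sum>s\<in>T. (if s \<in> T then w (e s) else 0) * mono2 k s v)"
      by (intro sum.cong) (auto simp: e_def mono2_def)
    also have "\<dots> = (\<Sum>s\<in>tri k. (if s \<in> T then w (e s) else 0) * mono2 k s v)"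
      by (intro sum.mono_neutral_left) (auto simp: T_def)
    finally show ?thesis .
  qed
  then show ?thesis by (intro exI[of _ "\<lambda>s. if s \<in> T then w (e s) else 0"] allI)
qed

lemma mono2_independent:
  assumes "\<And>v. (\<Sum>s\<in>tri k. w s * mono2 k s v) = 0" "s \<in> tri k"
  shows "w s = 0"
proof -
  define p :: "real poly poly" where "p = (\<Sum>s\<in>tri k. monom (monom (w s) (fst s)) (snd s))"
  have "p = 0"
  proof (rule poly2_eq_0)
    fix x y :: real
    have "poly (poly p [:y:]) x = (\<Sum>s\<in>tri k. w s * mono2 k s (vector [x, y, 1]))"
      by (simp add: p_def poly_sum poly_monom mono2_def mono3_def poly_power mult_ac)
    then show "poly (poly p [:y:]) x = 0" using assms(1) by simp
  qed
  then have "coeff (coeff p (snd s)) (fst s) = 0" by simp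
  moreover have "coeff (coeff p (snd s)) (fst s) = (\<Sum>r\<in>tri k. if r = s then w s else 0)"
    unfolding p_def coeff_sum by (intro sum.cong) (auto simp: prod_eq_iff)
  ultimately show ?thesis using assms(2) by simp
qed

lemma hom_fun_on_line:
  assumes "f \<in> hom_funs k"
  shows "\<exists>p. degree p \<le> k \<and> (\<forall>s. poly p s = f (u + s *\<^sub>R w))"
proof -
  obtain c where c: "\<And>v. f v = (\<Sum>s\<in>tri k. c s * mono2 k s v)" using hom_fun_monomials[OF assms] by blast
  define q where "q s = smult (c s) ([:u $ 1, w $ 1:] ^ fst s * [:u $ 2, w $ 2:] ^ snd s * [:u $ 3, w $ 3:] ^ (k - fst s - snd s))" for s
  have d: "degree ([:x, y:] ^ m) \<le> m" for x y :: real and m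
    using degree_power_le[of "[:x, y:]" m] by (auto intro: order_trans split: if_splits)
  have "degree (q s) \<le> k" if "s \<in> tri k" for s
  proof -
    have "degree ([:u $ 1, w $ 1:] ^ fst s * [:u $ 2, w $ 2:] ^ snd s * [:u $ 3, w $ 3:] ^ (k - fst s - snd s))
      \<le> fst s + snd s + (k - fst s - snd s)"
      by (intro order_trans[OF degree_mult_le] add_mono d)
    also have "\<dots> = k" using that by (auto simp: tri_def)
    finally show ?thesis unfolding q_def using degree_smult_le order_trans by blast
  qed
  then have "degree (\<Sum>s\<in>tri k. q s) \<le> k" by (intro degree_sum_le) auto
  moreover have "poly (\<Sum>s\<in>tri k. q s) s = f (u + s *\<^sub>R w)" for s
    unfolding c by (simp add: poly_sum q_def poly_power mono2_def mono3_def mult_ac)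
  ultimately show ?thesis by blast
qed

section \<open>Counting regions\<close>

text \<open>The regions cut out in a subspace \<open>W\<close> by the hyperplanes with indices in \<open>I\<close>, represented by their sign
  vectors.\<close>

definition regions :: "(nat \<Rightarrow> 'v::real_inner) \<Rightarrow> 'v set \<Rightarrow> nat set \<Rightarrow> nat set set" where
  "regions a W I = {{i\<in>I. 0 < a i \<bullet> x} | x. x \<in> W \<and> (\<forall>i\<in>I. a i \<bullet> x \<noteq> 0)}"

lemma regions_subset_Pow: "regions a W I \<subseteq> Pow I"
  by (auto simp: regions_def)

lemma finite_regions: "finite I \<Longrightarrow> finite (regions a W I)"
  by (rule finite_subset[OF regions_subset_Pow]) simp

lemma regions_empty: "0 \<in> W \<Longrightarrow> regions a W {} = {{}}"
  by (auto simp: regions_def)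

lemma perturb:
  fixes x y :: "'v::real_inner"
  assumes "finite I"
  shows "\<exists>\<epsilon>>0. \<forall>i\<in>I. a i \<bullet> x \<noteq> 0 \<longrightarrow>
    (\<forall>\<delta>. \<bar>\<delta>\<bar> \<le> \<epsilon> \<longrightarrow> a i \<bullet> (x + \<delta> *\<^sub>R y) \<noteq> 0 \<and> (0 < a i \<bullet> (x + \<delta> *\<^sub>R y) \<longleftrightarrow> 0 < a i \<bullet> x))"
  using assms
proof (induction I)
  case empty
  show ?case by (intro exI[of _ 1]) auto
next
  case (insert j I)
  then obtain e where e: "e > 0" "\<forall>i\<in>I. a i \<bullet> x \<noteq> 0 \<longrightarrow>
    (\<forall>\<delta>. \<bar>\<delta>\<bar> \<le> e \<longrightarrow> a i \<bullet> (x + \<delta> *\<^sub>R y) \<noteq> 0 \<and> (0 < a i \<bullet> (x + \<delta> *\<^sub>R y) \<longleftrightarrow> 0 < a i \<bullet> x))" by blast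
  show ?case
  proof (cases "a j \<bullet> x = 0")
    case True
    with e show ?thesis by auto
  next
    case False
    define f where "f = \<bar>a j \<bullet> x\<bar> / (2 * (\<bar>a j \<bullet> y\<bar> + 1))"
    have f: "f > 0" using False by (auto simp: f_def)
    have "a j \<bullet> (x + \<delta> *\<^sub>R y) \<noteq> 0 \<and> (0 < a j \<bullet> (x + \<delta> *\<^sub>R y) \<longleftrightarrow> 0 < a j \<bullet> x)" if "\<bar>\<delta>\<bar> \<le> f" for \<delta>
    proof -
      have "\<bar>\<delta> * (a j \<bullet> y)\<bar> \<le> f * (\<bar>a j \<bullet> y\<bar> + 1)"
        unfolding abs_mult using that f by (intro mult_mono) auto
      also have "\<dots> = \<bar>a j \<bullet> x\<bar> / 2" by (simp add: f_def field_simps)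
      also have "\<dots> < \<bar>a j \<bullet> x\<bar>" using False by simp
      finally have "\<bar>\<delta> * (a j \<bullet> y)\<bar> < \<bar>a j \<bullet> x\<bar>" .
      then show ?thesis by (auto simp: inner_add_right)
    qed
    then show ?thesis using e f
      by (intro exI[of _ "min e f"]) auto
  qed
qed

text \<open>Deletion and restriction: a new hyperplane cuts exactly those regions in two that it meets.\<close>

lemma card_regions_insert:
  assumes I: "finite I" "j \<notin> I" and W: "subspace W" and y: "y \<in> W" "a j \<bullet> y \<noteq> 0"
  shows "card (regions a W (insert j I)) = card (regions a W I) + card (regions a (W \<inter> form_kernel (a j)) I)"
proof -
  define R where "R = regions a W (insert j I)"
  define P where "P = {\<sigma>. \<sigma> \<subseteq> I \<and> \<sigma> \<in> R}"
  define Q where "Q = {\<sigma>. \<sigma> \<subseteq> I \<and> insert j \<sigma> \<in> R}"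
  have finite_dim: "finite P" "finite Q" using I(1) by (auto simp: P_def Q_def)
  have "R = P \<union> insert j ` Q"
  proof (intro Set.set_eqI iffI)
    fix \<sigma> assume s: "\<sigma> \<in> R"
    then have sub: "\<sigma> \<subseteq> insert j I" using regions_subset_Pow unfolding R_def by blast
    show "\<sigma> \<in> P \<union> insert j ` Q"
    proof (cases "j \<in> \<sigma>")
      case True
      then have "\<sigma> = insert j (\<sigma> - {j})" by auto
      moreover have "\<sigma> - {j} \<in> Q" using s sub True by (auto simp: Q_def insert_absorb)
      ultimately show ?thesis by blast
    qed (use s sub in \<open>auto simp: P_def\<close>)
  qed (auto simp: P_def Q_def)
  moreover have "P \<inter> insert j ` Q = {}" using I(2) by (auto simp: P_def)
  moreover have "inj_on (insert j) Q" using I(2) by (auto simp: inj_on_def Q_def)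
  ultimately have "card R = card P + card Q"
    using finite_dim by (simp add: card_Un_disjoint card_image)
  also have "\<dots> = card (P \<union> Q) + card (P \<inter> Q)" using finite_dim by (rule card_Un_Int)
  also have "P \<union> Q = regions a W I"
  proof (intro Set.set_eqI iffI)
    fix \<sigma> assume "\<sigma> \<in> P \<union> Q"
    then obtain x \<tau> where \<tau>: "\<tau> = \<sigma> \<or> \<tau> = insert j \<sigma>" "\<sigma> \<subseteq> I" "x \<in> W" "\<forall>i\<in>insert j I. a i \<bullet> x \<noteq> 0"
      "\<tau> = {i\<in>insert j I. 0 < a i \<bullet> x}"
      by (auto simp: P_def Q_def R_def regions_def)
    then have "\<sigma> = {i\<in>I. 0 < a i \<bullet> x}" using I(2) by auto
    then show "\<sigma> \<in> regions a W I" using \<tau> by (auto simp: regions_def)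
  next
    fix \<sigma> assume "\<sigma> \<in> regions a W I"
    then obtain x where x: "x \<in> W" "\<forall>i\<in>I. a i \<bullet> x \<noteq> 0" "\<sigma> = {i\<in>I. 0 < a i \<bullet> x}"
      by (auto simp: regions_def)
    obtain z where z: "z \<in> W" "\<forall>i\<in>insert j I. a i \<bullet> z \<noteq> 0" "\<sigma> = {i\<in>I. 0 < a i \<bullet> z}"
    proof (cases "a j \<bullet> x = 0")
      case False
      then show ?thesis using x that by blast
    next
      case True
      obtain e where e: "e > 0" "\<forall>i\<in>I. a i \<bullet> x \<noteq> 0 \<longrightarrow>
        (\<forall>\<delta>. \<bar>\<delta>\<bar> \<le> e \<longrightarrow> a i \<bullet> (x + \<delta> *\<^sub>R y) \<noteq> 0 \<and> (0 < a i \<bullet> (x + \<delta> *\<^sub>R y) \<longleftrightarrow> 0 < a i \<bullet> x))"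
        using perturb[OF I(1)] by blast
      show ?thesis
      proof (rule that[of "x + e *\<^sub>R y"])
        show "x + e *\<^sub>R y \<in> W" using W x(1) y(1) by (simp add: subspace_add subspace_scale)
        show "\<forall>i\<in>insert j I. a i \<bullet> (x + e *\<^sub>R y) \<noteq> 0"
          using e x(2) True y(2) by (auto simp: inner_add_right)
        show "\<sigma> = {i\<in>I. 0 < a i \<bullet> (x + e *\<^sub>R y)}" using e x(2,3) by auto
      qed
    qed
    have "{i\<in>insert j I. 0 < a i \<bullet> z} \<in> R" using z by (auto simp: R_def regions_def)
    moreover have "{i\<in>insert j I. 0 < a i \<bullet> z} = \<sigma> \<or> {i\<in>insert j I. 0 < a i \<bullet> z} = insert j \<sigma>" using z by auto
    moreover have "\<sigma> \<subseteq> I" using x by auto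
    ultimately show "\<sigma> \<in> P \<union> Q" by (auto simp: P_def Q_def)
  qed
  also have "P \<inter> Q = regions a (W \<inter> form_kernel (a j)) I"
  proof (intro Set.set_eqI iffI)
    fix \<sigma> assume \<sigma>: "\<sigma> \<in> P \<inter> Q"
    then obtain u where u: "u \<in> W" "\<forall>i\<in>insert j I. a i \<bullet> u \<noteq> 0" "\<sigma> = {i\<in>insert j I. 0 < a i \<bullet> u}"
      by (auto simp: P_def R_def regions_def)
    from \<sigma> obtain v where v: "v \<in> W" "\<forall>i\<in>insert j I. a i \<bullet> v \<noteq> 0" "insert j \<sigma> = {i\<in>insert j I. 0 < a i \<bullet> v}"
      by (auto simp: Q_def R_def regions_def)
    have j: "j \<notin> \<sigma>" "\<sigma> \<subseteq> I" using \<sigma> I(2) by (auto simp: P_def)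
    have ju: "a j \<bullet> u < 0" using u j by force
    have jv: "a j \<bullet> v > 0" using v(3) by blast
    have sgn: "0 < a i \<bullet> u \<longleftrightarrow> 0 < a i \<bullet> v" if "i \<in> I" for i
    proof -
      have "i \<in> \<sigma> \<longleftrightarrow> 0 < a i \<bullet> u" by (subst u(3)) (use that in simp)
      moreover have "i \<in> insert j \<sigma> \<longleftrightarrow> 0 < a i \<bullet> v" by (subst v(3)) (use that in simp)
      moreover have "i \<noteq> j" using that I(2) by blast
      ultimately show ?thesis by simp
    qed
    define z where "z = (a j \<bullet> v) *\<^sub>R u + (- (a j \<bullet> u)) *\<^sub>R v"
    have z: "z \<in> W" "a j \<bullet> z = 0"
      using W u(1) v(1) by (auto simp: z_def subspace_add subspace_diff subspace_scale inner_add_right inner_diff_right)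
    have iz: "a i \<bullet> z \<noteq> 0 \<and> (0 < a i \<bullet> z \<longleftrightarrow> 0 < a i \<bullet> u)" if i: "i \<in> I" for i
    proof (cases "0 < a i \<bullet> u")
      case True
      then have "0 < (a j \<bullet> v) * (a i \<bullet> u)" "0 < (- (a j \<bullet> u)) * (a i \<bullet> v)"
        using sgn[OF i] ju jv by (auto intro: mult_pos_pos mult_neg_pos)
      then show ?thesis using True by (simp add: z_def inner_add_right inner_diff_right)
    next
      case False
      then have neg: "a i \<bullet> u < 0" "a i \<bullet> v < 0" using sgn[OF i] u(2) v(2) i by force+
      then have "(a j \<bullet> v) * (a i \<bullet> u) < 0" "(- (a j \<bullet> u)) * (a i \<bullet> v) < 0"
        using ju jv by (auto intro: mult_pos_neg mult_neg_neg)
      then show ?thesis using neg by (simp add: z_def inner_add_right inner_diff_right)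
    qed
    have "\<sigma> = {i\<in>I. 0 < a i \<bullet> z}" using u(3) iz j by auto
    then show "\<sigma> \<in> regions a (W \<inter> form_kernel (a j)) I"
      using z iz by (auto simp: regions_def form_kernel_def)
  next
    fix \<sigma> assume "\<sigma> \<in> regions a (W \<inter> form_kernel (a j)) I"
    then obtain x where x: "x \<in> W" "a j \<bullet> x = 0" "\<forall>i\<in>I. a i \<bullet> x \<noteq> 0" "\<sigma> = {i\<in>I. 0 < a i \<bullet> x}"
      by (auto simp: regions_def form_kernel_def)
    obtain e where e: "e > 0" "\<forall>i\<in>I. a i \<bullet> x \<noteq> 0 \<longrightarrow>
      (\<forall>\<delta>. \<bar>\<delta>\<bar> \<le> e \<longrightarrow> a i \<bullet> (x + \<delta> *\<^sub>R y) \<noteq> 0 \<and> (0 < a i \<bullet> (x + \<delta> *\<^sub>R y) \<longleftrightarrow> 0 < a i \<bullet> x))"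
      using perturb[OF I(1)] by blast
    have mem: "{i\<in>insert j I. 0 < a i \<bullet> (x + \<delta> *\<^sub>R y)} \<in> R" if "\<bar>\<delta>\<bar> \<le> e" "\<delta> \<noteq> 0" for \<delta>
    proof -
      have "x + \<delta> *\<^sub>R y \<in> W" using W x(1) y(1) by (simp add: subspace_add subspace_scale)
      moreover have "\<forall>i\<in>insert j I. a i \<bullet> (x + \<delta> *\<^sub>R y) \<noteq> 0"
        using e x y(2) that by (auto simp: inner_add_right)
      ultimately show ?thesis unfolding R_def regions_def by blast
    qed
    have same: "{i\<in>I. 0 < a i \<bullet> (x + \<delta> *\<^sub>R y)} = \<sigma>" if "\<bar>\<delta>\<bar> \<le> e" for \<delta>
      using e x that by auto
    have eq: "{i\<in>insert j I. 0 < a i \<bullet> (x + \<delta> *\<^sub>R y)} = (if 0 < \<delta> * (a j \<bullet> y) then insert j \<sigma> else \<sigma>)"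
      if "\<bar>\<delta>\<bar> \<le> e" for \<delta>
      unfolding same[OF that, symmetric] using x(2) by (auto simp: inner_add_right)
    have "\<sigma> \<subseteq> I" using x by auto
    moreover have "\<sigma> \<in> R \<and> insert j \<sigma> \<in> R"
    proof (cases "0 < a j \<bullet> y")
      case True
      then have n: "\<not> 0 < (-e) * (a j \<bullet> y)" and p: "0 < e * (a j \<bullet> y)" using e(1) by (simp_all add: mult_less_0_iff zero_less_mult_iff)
      have "insert j \<sigma> \<in> R" using mem[of e] eq[of e] e(1) p by simp
      moreover have "\<sigma> \<in> R" using mem[of "-e"] eq[of "-e"] e(1) n by (simp del: scaleR_minus_left)
      ultimately show ?thesis by simp
    next
      case False
      then have n: "0 < (-e) * (a j \<bullet> y)" and p: "\<not> 0 < e * (a j \<bullet> y)" using e(1) y(2) by (simp_all add: mult_less_0_iff zero_less_mult_iff)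
      have "\<sigma> \<in> R" using mem[of e] eq[of e] e(1) p by simp
      moreover have "insert j \<sigma> \<in> R" using mem[of "-e"] eq[of "-e"] e(1) n by (simp del: scaleR_minus_left)
      ultimately show ?thesis by simp
    qed
    ultimately show "\<sigma> \<in> P \<inter> Q" by (auto simp: P_def Q_def)
  qed
  finally show ?thesis by (simp add: R_def)
qed

lemma card_regions_line:
  fixes c :: "'v::real_inner"
  assumes "finite I"
  shows "card (regions a (span {c}) I) =
    (if \<exists>i\<in>I. a i \<bullet> c = 0 then 0 else if I = {} then 1 else 2)"
proof -
  have sp: "x \<in> span {c} \<longleftrightarrow> (\<exists>t. x = t *\<^sub>R c)" for x by (auto simp: span_singleton)
  consider "\<exists>i\<in>I. a i \<bullet> c = 0" | "I = {}" | "I \<noteq> {}" "\<forall>i\<in>I. a i \<bullet> c \<noteq> 0" by blast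
  then show ?thesis
  proof cases
    case 1
    then have "regions a (span {c}) I = {}" by (auto simp: regions_def sp)
    with 1 show ?thesis by simp
  next
    case 2
    then show ?thesis by (simp add: regions_empty span_zero)
  next
    case 3
    define p where "p = {i\<in>I. 0 < a i \<bullet> c}"
    define m where "m = {i\<in>I. a i \<bullet> c < 0}"
    have "regions a (span {c}) I = {p, m}"
    proof (intro Set.set_eqI iffI)
      fix \<sigma> assume "\<sigma> \<in> regions a (span {c}) I"
      then obtain x where x: "x \<in> span {c}" "\<forall>i\<in>I. a i \<bullet> x \<noteq> 0" "\<sigma> = {i\<in>I. 0 < a i \<bullet> x}"
        unfolding regions_def by blast
      then obtain t where "x = t *\<^sub>R c" using sp by blast
      then have t: "\<forall>i\<in>I. t * (a i \<bullet> c) \<noteq> 0" "\<sigma> = {i\<in>I. 0 < t * (a i \<bullet> c)}"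
        using x by auto
      then have "t \<noteq> 0" using 3 by auto
      then consider "t > 0" | "t < 0" by linarith
      then show "\<sigma> \<in> {p, m}" by cases (auto simp: t p_def m_def zero_less_mult_iff)
    next
      fix \<sigma> assume "\<sigma> \<in> {p, m}"
      moreover have "p \<in> regions a (span {c}) I" using 3 by (auto simp: regions_def p_def intro!: exI[of _ c] span_base)
      moreover have "m \<in> regions a (span {c}) I" unfolding regions_def mem_Collect_eq
        using 3 by (intro exI[of _ "- c"]) (auto simp: m_def intro: span_neg span_base)
      ultimately show "\<sigma> \<in> regions a (span {c}) I" by auto
    qed
    moreover have "p \<noteq> m" using 3 unfolding p_def m_def by force
    ultimately show ?thesis using 3 by auto
  qed
qed

lemma span_scale_singleton:
  fixes x :: "'v::real_vector"
  assumes "c \<noteq> 0" shows "span {c *\<^sub>R x} = span {x}"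
proof (intro equalityI subsetI)
  fix y assume "y \<in> span {x}"
  then obtain t where "y = t *\<^sub>R x" by (auto simp: span_singleton)
  then have "y = (t / c) *\<^sub>R (c *\<^sub>R x)" using assms by simp
  then show "y \<in> span {c *\<^sub>R x}" by (metis span_base span_scale singletonI)
next
  fix y assume "y \<in> span {c *\<^sub>R x}"
  then show "y \<in> span {x}" by (auto simp: span_singleton)
qed

lemma subspace_form_kernel: "subspace (form_kernel v)"
  by (auto simp: form_kernel_def subspace_def inner_add_right)

lemma orthogonal_imp_cross3_multiple:
  fixes u v x :: "real^3"
  assumes "cross3 u v \<noteq> 0" "u \<bullet> x = 0" "v \<bullet> x = 0"
  shows "\<exists>c. x = c *\<^sub>R cross3 u v"
proof -
  have "cross3 x (cross3 u v) = 0"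
    using assms(2,3) by (simp add: Lagrange inner_commute)
  then have "cross3 (cross3 u v) x = 0" by (metis cross_skew neg_0_equal_iff_equal)
  then show ?thesis using assms(1)
    by (auto simp: cross_eq_0 collinear_lemma intro: exI[of _ 0])
qed

lemma cross3_eq_0_imp_multiple:
  fixes u v :: "real^3"
  assumes "cross3 u v = 0" "u \<noteq> 0" shows "\<exists>c. v = c *\<^sub>R u"
  using assms by (auto simp: cross_eq_0 collinear_lemma intro: exI[of _ 0])

lemma inner_cross3_self [simp]:
  fixes u v :: "real^3"
  shows "u \<bullet> cross3 u v = 0" "v \<bullet> cross3 u v = 0"
  by (simp_all add: dot_cross_self)

text \<open>Indexed normals instead of a set of planes: the counting inserts the planes in the order of their indices.\<close>

locale plane_arrangement =
  fixes a :: "nat \<Rightarrow> real^3" and n :: nat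
  assumes normal_neq_0: "i < n \<Longrightarrow> a i \<noteq> 0"
    and nonparallel: "i < n \<Longrightarrow> j < n \<Longrightarrow> i \<noteq> j \<Longrightarrow> cross3 (a i) (a j) \<noteq> 0"
    and essential: "(\<And>i. i < n \<Longrightarrow> a i \<bullet> x = 0) \<Longrightarrow> x = 0"
begin

abbreviation plane :: "nat \<Rightarrow> (real^3) set" where
  "plane i \<equiv> form_kernel (a i)"

definition lines :: "nat \<Rightarrow> nat set \<Rightarrow> (real^3) set set" where
  "lines i J = (\<lambda>j. plane i \<inter> plane j) ` J"

lemma finite_lines [simp]: "finite J \<Longrightarrow> finite (lines i J)"
  by (simp add: lines_def)

lemma plane_Int_plane:
  assumes "i < n" "j < n" "i \<noteq> j"
  shows "plane i \<inter> plane j = span {cross3 (a i) (a j)}"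
proof -
  have "x \<in> span {cross3 (a i) (a j)}" if "x \<in> plane i \<inter> plane j" for x
    using orthogonal_imp_cross3_multiple[OF nonparallel[OF assms]] that
    by (auto simp: form_kernel_def span_singleton)
  then show ?thesis by (auto simp: form_kernel_def span_singleton)
qed

lemma same_line_iff:
  assumes "i < n" "j < n" "l < n" "i \<noteq> j" "i \<noteq> l"
  shows "plane i \<inter> plane l = plane i \<inter> plane j \<longleftrightarrow> a l \<bullet> cross3 (a i) (a j) = 0"
proof
  assume eq: "plane i \<inter> plane l = plane i \<inter> plane j"
  have "cross3 (a i) (a j) \<in> plane i \<inter> plane j" by (simp add: form_kernel_def)
  then have "cross3 (a i) (a j) \<in> plane l" using eq by blast
  then show "a l \<bullet> cross3 (a i) (a j) = 0" by (simp add: form_kernel_def)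
next
  assume 0: "a l \<bullet> cross3 (a i) (a j) = 0"
  obtain c where c: "cross3 (a i) (a j) = c *\<^sub>R cross3 (a i) (a l)"
    using orthogonal_imp_cross3_multiple[OF nonparallel[OF assms(1,3,5)] _ 0] inner_cross3_self(1) by blast
  then have "c \<noteq> 0" using nonparallel[OF assms(1,2,4)] by auto
  then have "span {cross3 (a i) (a j)} = span {cross3 (a i) (a l)}"
    unfolding c by (rule span_scale_singleton)
  then show "plane i \<inter> plane l = plane i \<inter> plane j"
    using plane_Int_plane assms by simp
qed

lemma plane_not_within:
  assumes "i < n" "j < n" "i \<noteq> j"
  shows "\<exists>y\<in>plane i. a j \<bullet> y \<noteq> 0"
proof -
  let ?c = "cross3 (a i) (a j)"
  have "a j \<bullet> cross3 (a i) ?c = - (?c \<bullet> ?c)"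
    by (simp add: cross3_simps)
  then have "a j \<bullet> cross3 (a i) ?c \<noteq> 0" using nonparallel[OF assms] by simp
  moreover have "cross3 (a i) ?c \<in> plane i" by (simp add: form_kernel_def)
  ultimately show ?thesis by blast
qed

text \<open>Inside one of the planes the other planes cut out concurrent lines, and \<open>m\<close> lines through the origin leave
  \<open>2 m\<close> sectors.\<close>

lemma card_regions_plane:
  assumes "i < n" "finite J" "J \<noteq> {}" "J \<subseteq> {..<n} - {i}"
  shows "card (regions a (plane i) J) = 2 * card (lines i J)"
  using assms(2-)
proof (induction J rule: finite_ne_induct)
  case (singleton j)
  let ?c = "cross3 (a i) (a j)"
  have j: "j < n" "i \<noteq> j" using singleton by auto
  obtain y where y: "y \<in> plane i" "a j \<bullet> y \<noteq> 0" using plane_not_within[OF assms(1) j] by blast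
  have "card (regions a (plane i) {j}) = card (regions a (plane i) {}) + card (regions a (plane i \<inter> plane j) {})"
    by (rule card_regions_insert[where y = y]) (use y in \<open>auto simp: subspace_form_kernel\<close>)
  also have "\<dots> = 2" by (simp add: regions_empty form_kernel_def)
  finally show ?case by (simp add: lines_def)
next
  case (insert j J)
  let ?c = "cross3 (a i) (a j)"
  have j: "j < n" "i \<noteq> j" and J: "J \<subseteq> {..<n} - {i}" using insert by auto
  obtain y where y: "y \<in> plane i" "a j \<bullet> y \<noteq> 0" using plane_not_within[OF assms(1) j] by blast
  have "card (regions a (plane i) (insert j J))
      = card (regions a (plane i) J) + card (regions a (plane i \<inter> plane j) J)"
    by (rule card_regions_insert[where y = y]) (use y insert in \<open>auto simp: subspace_form_kernel\<close>)
  also have "card (regions a (plane i \<inter> plane j) J) = (if \<exists>l\<in>J. a l \<bullet> ?c = 0 then 0 else 2)"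
    unfolding plane_Int_plane[OF assms(1) j] using card_regions_line[OF insert(1), of a ?c] insert(2) by simp
  also have "(\<exists>l\<in>J. a l \<bullet> ?c = 0) \<longleftrightarrow> plane i \<inter> plane j \<in> lines i J"
  proof -
    have "a l \<bullet> ?c = 0 \<longleftrightarrow> plane i \<inter> plane j = plane i \<inter> plane l" if "l \<in> J" for l
      using same_line_iff[OF assms(1) j(1) _ j(2), of l] J that by auto
    then show ?thesis by (auto simp: lines_def)
  qed
  also have "card (regions a (plane i) J) = 2 * card (lines i J)" using insert J by blast
  finally show ?case using insert(1) by (auto simp: lines_def insert_absorb)
qed

subsection \<open>Walls of chambers and simpliciality\<close>

lemma card_regions_UNIV:
  assumes "m \<le> n"
  shows "card (regions a UNIV {..<m}) = 1 + (\<Sum>i<m. card (regions a (plane i) {..<i}))"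
  using assms
proof (induction m)
  case 0
  then show ?case by (simp add: regions_empty)
next
  case (Suc m)
  have "a m \<bullet> a m \<noteq> 0" using normal_neq_0[of m] Suc by simp
  then have "card (regions a UNIV (insert m {..<m})) = card (regions a UNIV {..<m}) + card (regions a (UNIV \<inter> plane m) {..<m})"
    by (intro card_regions_insert[where y = "a m"]) auto
  then show ?case using Suc by (simp add: lessThan_Suc)
qed

text \<open>Counts every line with multiplicity one less than the number of planes through it (\<open>sum_card_idx\<close>), hence is the
  coefficient of \<open>t\<close> in the characteristic polynomial.\<close>

definition earlier_lines :: nat where
  "earlier_lines = (\<Sum>i<n. card (lines i {..<i}))"

lemma card_all_regions:
  assumes "0 < n"
  shows "card (regions a UNIV {..<n}) = 2 + 2 * earlier_lines"
proof -
  have "card (regions a (plane i) {..<i}) = (if i = 0 then 1 else 0) + 2 * card (lines i {..<i})" if "i < n" for i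
  proof (cases "i = 0")
    case True
    then show ?thesis by (simp add: regions_empty form_kernel_def lines_def)
  next
    case False
    then have "0 \<in> {..<i}" by simp
    then have "{..<i} \<noteq> {}" by blast
    moreover have "{..<i} \<subseteq> {..<n} - {i}" using that by auto
    ultimately show ?thesis using card_regions_plane[of i "{..<i}"] that False by simp
  qed
  then have "(\<Sum>i<n. card (regions a (plane i) {..<i})) = (\<Sum>i<n. (if i = 0 then 1 else 0) + 2 * card (lines i {..<i}))"
    by (intro sum.cong) auto
  also have "\<dots> = 1 + 2 * earlier_lines"
    using assms by (simp add: sum.distrib earlier_lines_def sum_distrib_left)
  finally show ?thesis using card_regions_UNIV[of n] by simp
qed

text \<open>The plane \<open>i\<close> is a wall of a chamber if dropping the \<open>i\<close>-th sign leaves the sign vector of some point on the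
  plane.\<close>

definition walls :: "nat set \<Rightarrow> nat set" where
  "walls \<sigma> = {i. i < n \<and> \<sigma> - {i} \<in> regions a (plane i) ({..<n} - {i})}"

text \<open>Moving a little to either side of a region inside the plane reaches one chamber on each side.\<close>

lemma card_regions_with_wall:
  assumes i: "i < n"
  shows "card {\<sigma> \<in> regions a UNIV {..<n}. i \<in> walls \<sigma>} = 2 * card (regions a (plane i) ({..<n} - {i}))"
proof -
  let ?I = "{..<n} - {i}" and ?R = "regions a UNIV {..<n}" and ?W = "regions a (plane i) ({..<n} - {i})"
  have ai: "a i \<bullet> a i > 0" using normal_neq_0[OF i] by simp
  have both: "\<tau> \<in> ?R \<and> insert i \<tau> \<in> ?R" if \<tau>: "\<tau> \<in> ?W" for \<tau>
  proof -
    obtain x where x: "a i \<bullet> x = 0" "\<forall>j\<in>?I. a j \<bullet> x \<noteq> 0" "\<tau> = {j\<in>?I. 0 < a j \<bullet> x}"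
      using \<tau> by (auto simp: regions_def form_kernel_def)
    obtain e where e: "e > 0" "\<forall>j\<in>?I. a j \<bullet> x \<noteq> 0 \<longrightarrow>
      (\<forall>\<delta>. \<bar>\<delta>\<bar> \<le> e \<longrightarrow> a j \<bullet> (x + \<delta> *\<^sub>R a i) \<noteq> 0 \<and> (0 < a j \<bullet> (x + \<delta> *\<^sub>R a i) \<longleftrightarrow> 0 < a j \<bullet> x))"
      using perturb[of ?I a x "a i"] by auto
    have sgn: "0 < a i \<bullet> (x + \<delta> *\<^sub>R a i) \<longleftrightarrow> 0 < \<delta>" "a i \<bullet> (x + \<delta> *\<^sub>R a i) = 0 \<longleftrightarrow> \<delta> = 0" for \<delta>
    proof -
      define k where "k = a i \<bullet> a i"
      have "a i \<bullet> (x + \<delta> *\<^sub>R a i) = \<delta> * k" by (simp add: inner_add_right x(1) k_def)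
      moreover have "0 < k" using ai by (simp only: k_def)
      ultimately show "0 < a i \<bullet> (x + \<delta> *\<^sub>R a i) \<longleftrightarrow> 0 < \<delta>" "a i \<bullet> (x + \<delta> *\<^sub>R a i) = 0 \<longleftrightarrow> \<delta> = 0"
        by (simp_all add: zero_less_mult_iff)
    qed
    have R: "{j\<in>{..<n}. 0 < a j \<bullet> (x + \<delta> *\<^sub>R a i)} \<in> ?R" if "\<bar>\<delta>\<bar> \<le> e" "\<delta> \<noteq> 0" for \<delta>
    proof -
      have "\<forall>j\<in>{..<n}. a j \<bullet> (x + \<delta> *\<^sub>R a i) \<noteq> 0"
        using e(2) x(2) sgn(2) that by (metis Diff_iff singletonD)
      then show ?thesis unfolding regions_def by blast
    qed
    have eq: "{j\<in>{..<n}. 0 < a j \<bullet> (x + \<delta> *\<^sub>R a i)} = (if 0 < \<delta> then insert i \<tau> else \<tau>)" if "\<bar>\<delta>\<bar> \<le> e" for \<delta>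
    proof (rule Set.set_eqI)
      fix j
      show "j \<in> {j\<in>{..<n}. 0 < a j \<bullet> (x + \<delta> *\<^sub>R a i)} \<longleftrightarrow> j \<in> (if 0 < \<delta> then insert i \<tau> else \<tau>)"
      proof (cases "j = i")
        case True
        then show ?thesis using i x(3) sgn(1) by auto
      next
        case False
        then show ?thesis using e(2) x(2,3) that by auto
      qed
    qed
    have "insert i \<tau> \<in> ?R" using R[of e] eq[of e] e(1) by auto
    moreover have "\<tau> \<in> ?R" using R[of "-e"] eq[of "-e"] e(1) by auto
    ultimately show ?thesis by simp
  qed
  have sub: "\<tau> \<subseteq> ?I" if "\<tau> \<in> ?W" for \<tau> using that regions_subset_Pow by blast
  have "{\<sigma> \<in> ?R. i \<in> walls \<sigma>} = ?W \<union> insert i ` ?W"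
  proof (intro Set.set_eqI iffI)
    fix \<sigma> assume "\<sigma> \<in> {\<sigma> \<in> ?R. i \<in> walls \<sigma>}"
    then have "\<sigma> - {i} \<in> ?W" by (auto simp: walls_def)
    moreover have "\<sigma> = \<sigma> - {i} \<or> \<sigma> = insert i (\<sigma> - {i})" by auto
    ultimately show "\<sigma> \<in> ?W \<union> insert i ` ?W" by (metis UnI1 UnI2 imageI)
  next
    fix \<sigma> assume "\<sigma> \<in> ?W \<union> insert i ` ?W"
    then obtain \<tau> where \<tau>: "\<tau> \<in> ?W" "\<sigma> = \<tau> \<or> \<sigma> = insert i \<tau>" by auto
    have "\<sigma> - {i} = \<tau>" using \<tau> sub[OF \<tau>(1)] by auto
    then have "i \<in> walls \<sigma>" using \<tau>(1) i by (simp add: walls_def)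
    moreover have "\<sigma> \<in> ?R" using both[OF \<tau>(1)] \<tau>(2) by blast
    ultimately show "\<sigma> \<in> {\<sigma> \<in> ?R. i \<in> walls \<sigma>}" by blast
  qed
  moreover have "?W \<inter> insert i ` ?W = {}" using sub by auto
  moreover have "inj_on (insert i) ?W"
    using sub by (intro inj_onI) (metis Diff_iff Diff_insert_absorb insertI1 subset_iff)
  ultimately show ?thesis by (simp add: card_Un_disjoint card_image finite_regions)
qed

definition cone :: "nat set \<Rightarrow> nat set \<Rightarrow> (real^3) set" where
  "cone \<sigma> J = {x. \<forall>i\<in>J. (if i \<in> \<sigma> then 0 < a i \<bullet> x else a i \<bullet> x < 0)}"

definition sgn_normal :: "nat set \<Rightarrow> nat \<Rightarrow> real^3" where
  "sgn_normal \<sigma> i = (if i \<in> \<sigma> then a i else - a i)"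

lemma cone_eq: "cone \<sigma> J = {x. \<forall>i\<in>J. 0 < sgn_normal \<sigma> i \<bullet> x}"
  by (auto simp: cone_def sgn_normal_def)

lemma region_imp_cone:
  assumes "\<sigma> \<in> regions a UNIV {..<n}"
  shows "cone \<sigma> {..<n} \<noteq> {}"
proof -
  obtain x where "\<forall>i\<in>{..<n}. a i \<bullet> x \<noteq> 0" "\<sigma> = {i\<in>{..<n}. 0 < a i \<bullet> x}"
    using assms unfolding regions_def by blast
  then have "x \<in> cone \<sigma> {..<n}" by (force simp: cone_def)
  then show ?thesis by blast
qed

text \<open>In an irredundant system of inequalities for a chamber each plane is a wall. If dropping the \<open>i\<close>-th inequality
  enlarges the solution set, a segment from a new solution to a point of the chamber meets the plane \<open>i\<close> inside all other half-spaces of the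
  system; a small shift within the plane avoids all other planes.\<close>

lemma minimal_walls:
  assumes \<sigma>: "\<sigma> \<subseteq> {..<n}" "cone \<sigma> {..<n} \<noteq> {}" and n: "2 \<le> n"
  shows "\<exists>J \<subseteq> walls \<sigma>. cone \<sigma> J = cone \<sigma> {..<n}"
proof -
  define P where "P = (\<lambda>J. J \<subseteq> {..<n} \<and> cone \<sigma> J = cone \<sigma> {..<n})"
  have "P {..<n}" by (simp add: P_def)
  then obtain J where J: "P J" "\<And>K. P K \<Longrightarrow> card J \<le> card K"
    using ex_has_least_nat[of P _ card] by blast
  define s where "s = sgn_normal \<sigma>"
  have Jn: "J \<subseteq> {..<n}" and cJ: "cone \<sigma> J = cone \<sigma> {..<n}" using J by (auto simp: P_def)
  have "i \<in> walls \<sigma>" if i: "i \<in> J" for i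
  proof -
    have i_n: "i < n" using i Jn by auto
    have fJ: "finite J" using Jn finite_subset by blast
    have "\<not> P (J - {i})"
    proof
      assume "P (J - {i})"
      then have "card J \<le> card (J - {i})" by (rule J(2))
      then show False using card_Diff1_less[OF fJ i] by simp
    qed
    then have "cone \<sigma> (J - {i}) \<noteq> cone \<sigma> J" using J Jn by (auto simp: P_def)
    moreover have "cone \<sigma> J \<subseteq> cone \<sigma> (J - {i})" by (auto simp: cone_def)
    ultimately obtain y where y: "\<forall>j\<in>J - {i}. 0 < s j \<bullet> y" "\<not> 0 < s i \<bullet> y"
      unfolding cone_eq s_def using i by blast
    obtain x where x: "\<forall>j\<in>{..<n}. 0 < s j \<bullet> x" using \<sigma>(2) unfolding cone_eq s_def by blast
    have xi: "0 < s i \<bullet> x" using x i_n by simp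
    \<comment> \<open>Up to a positive factor, the point where the segment from \<open>x\<close> to \<open>y\<close> meets the plane \<open>i\<close>.\<close>
    define z where "z = (s i \<bullet> x) *\<^sub>R y + (- (s i \<bullet> y)) *\<^sub>R x"
    have zi: "s i \<bullet> z = 0" by (simp add: z_def inner_add_right inner_diff_right)
    have zj: "0 < s j \<bullet> z" if "j \<in> J - {i}" for j
    proof -
      have "0 < (s i \<bullet> x) * (s j \<bullet> y)" using xi y(1) that by simp
      moreover have "0 \<le> (- (s i \<bullet> y)) * (s j \<bullet> x)" using y(2) x that Jn by (intro mult_nonneg_nonneg) (auto intro: less_imp_le)
      ultimately show ?thesis by (simp add: z_def inner_add_right inner_diff_right)
    qed
    obtain u where u: "a i \<bullet> u = 0" "\<forall>j\<in>{..<n} - {i}. a j \<bullet> u \<noteq> 0"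
    proof -
      obtain k where k: "k < n" "k \<noteq> i"
      proof (cases "i = 0")
        case True
        then show ?thesis using that[of 1] n by simp
      next
        case False
        then show ?thesis using that[of 0] n by simp
      qed
      then have "card (lines i ({..<n} - {i})) \<noteq> 0" by (auto simp: lines_def)
      then have "card (regions a (plane i) ({..<n} - {i})) \<noteq> 0"
        using k i_n by (subst card_regions_plane) auto
      then have "regions a (plane i) ({..<n} - {i}) \<noteq> {}" by auto
      then obtain u where "u \<in> plane i" "\<forall>j\<in>{..<n} - {i}. a j \<bullet> u \<noteq> 0" unfolding regions_def by blast
      then show ?thesis using that by (auto simp: form_kernel_def)
    qed
    have s0: "s j \<bullet> v = 0 \<longleftrightarrow> a j \<bullet> v = 0" for j v by (simp add: s_def sgn_normal_def)
    obtain e where e: "e > 0" "\<forall>j\<in>{..<n}. s j \<bullet> z \<noteq> 0 \<longrightarrow>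
      (\<forall>\<delta>. \<bar>\<delta>\<bar> \<le> e \<longrightarrow> s j \<bullet> (z + \<delta> *\<^sub>R u) \<noteq> 0 \<and> (0 < s j \<bullet> (z + \<delta> *\<^sub>R u) \<longleftrightarrow> 0 < s j \<bullet> z))"
      using perturb[of "{..<n}" s z u] by auto
    define v where "v = z + e *\<^sub>R u"
    have vi: "s i \<bullet> v = 0" using zi u(1) s0[of i u] by (simp add: v_def inner_add_right)
    have vJ: "0 < s j \<bullet> v" if "j \<in> J - {i}" for j
      using e zj[OF that] that Jn unfolding v_def by (auto dest!: bspec[of _ _ j])
    have v0: "s j \<bullet> v \<noteq> 0" if "j \<in> {..<n} - {i}" for j
    proof (cases "s j \<bullet> z = 0")
      case True
      moreover have "s j \<bullet> u \<noteq> 0" using u(2) that s0 by blast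
      ultimately show ?thesis using e(1) by (simp add: v_def inner_add_right)
    next
      case False
      have "j \<in> {..<n}" using that by simp
      then show ?thesis using e False unfolding v_def by auto
    qed
    have vpos: "0 < s j \<bullet> v" if j: "j \<in> {..<n} - {i}" for j
    proof (rule ccontr)
      assume "\<not> 0 < s j \<bullet> v"
      then have neg: "s j \<bullet> v < 0" using v0[OF j] by simp
      define d where "d = - (s j \<bullet> v) / (2 * (s j \<bullet> x))"
      have jx: "0 < s j \<bullet> x" using x j by simp
      then have d: "d > 0" using neg unfolding d_def by (intro divide_pos_pos) auto
      have "v + d *\<^sub>R x \<in> cone \<sigma> J"
        unfolding cone_eq s_def[symmetric]
      proof (intro CollectI ballI)
        fix k assume k: "k \<in> J"
        have kx: "0 < d * (s k \<bullet> x)" using d x k Jn by auto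
        moreover have "0 \<le> s k \<bullet> v" using vi vJ[of k] k by (cases "k = i") auto
        ultimately show "0 < s k \<bullet> (v + d *\<^sub>R x)" by (simp add: inner_add_right)
      qed
      then have "v + d *\<^sub>R x \<in> cone \<sigma> {..<n}" by (simp only: cJ)
      then have "0 < s j \<bullet> (v + d *\<^sub>R x)" using j unfolding cone_eq s_def by blast
      also have "\<dots> = s j \<bullet> v + d * (s j \<bullet> x)" by (simp add: inner_add_right)
      also have "d * (s j \<bullet> x) = - (s j \<bullet> v) / 2" using jx by (simp add: d_def)
      finally show False using neg by simp
    qed
    have "\<sigma> - {i} = {j\<in>{..<n} - {i}. 0 < a j \<bullet> v}"
    proof (intro Set.set_eqI iffI)
      fix j assume "j \<in> \<sigma> - {i}"
      then show "j \<in> {j\<in>{..<n} - {i}. 0 < a j \<bullet> v}"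
        using vpos[of j] \<sigma>(1) by (auto simp: s_def sgn_normal_def)
    next
      fix j assume "j \<in> {j\<in>{..<n} - {i}. 0 < a j \<bullet> v}"
      then show "j \<in> \<sigma> - {i}"
        using vpos[of j] by (auto simp: s_def sgn_normal_def split: if_splits)
    qed
    moreover have "v \<in> plane i" using vi s0 by (simp add: form_kernel_def)
    moreover have "\<forall>j\<in>{..<n} - {i}. a j \<bullet> v \<noteq> 0" using v0 s0 by blast
    ultimately show "i \<in> walls \<sigma>" using i_n unfolding walls_def regions_def by blast
  qed
  then show ?thesis using cJ by blast
qed

text \<open>The defining normals of a chamber span the space: along a direction orthogonal to all of them the chamber would contain
  a full line, on which all the other forms would be constant as well, against essentiality.\<close>

lemma span_cone_normals:
  assumes J: "J \<subseteq> {..<n}" "cone \<sigma> J = cone \<sigma> {..<n}" and ne: "cone \<sigma> {..<n} \<noteq> {}"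
    and d: "\<And>j. j \<in> J \<Longrightarrow> a j \<bullet> d = 0"
  shows "d = 0"
proof (rule essential)
  fix i assume i: "i < n"
  obtain x where x: "x \<in> cone \<sigma> {..<n}" using ne by blast
  define s where "s = sgn_normal \<sigma>"
  have "s j \<bullet> d = 0" if "j \<in> J" for j using d[OF that] by (simp add: s_def sgn_normal_def)
  then have "x + t *\<^sub>R d \<in> cone \<sigma> J" for t
    using x J(1) unfolding cone_eq s_def[symmetric] by (auto simp: inner_add_right)
  then have "x + t *\<^sub>R d \<in> cone \<sigma> {..<n}" for t by (simp add: J(2))
  then have "0 < s i \<bullet> (x + t *\<^sub>R d)" for t
    using i unfolding cone_eq s_def by blast
  then have pos: "0 < s i \<bullet> x + t * (s i \<bullet> d)" for t by (simp add: inner_add_right)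
  have "s i \<bullet> d = 0"
  proof (rule ccontr)
    assume "s i \<bullet> d \<noteq> 0"
    then show False using pos[of "- (s i \<bullet> x) / (s i \<bullet> d)"] by simp
  qed
  then show "a i \<bullet> d = 0" by (simp add: s_def sgn_normal_def split: if_splits)
qed

end

lemma span_UNIV_if_orthogonal_trivial:
  fixes S :: "'v::euclidean_space set"
  assumes "\<And>d. (\<And>v. v \<in> S \<Longrightarrow> v \<bullet> d = 0) \<Longrightarrow> d = 0"
  shows "span S = UNIV"
proof (rule ccontr)
  assume "span S \<noteq> UNIV"
  then obtain d where d: "d \<noteq> 0" "\<forall>x\<in>span S. d \<bullet> x = 0"
    using span_not_UNIV_orthogonal by blast
  have "v \<bullet> d = 0" if "v \<in> S" for v
    using d(2) span_base[OF that] by (metis inner_commute)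
  then show False using assms[of d] d(1) by blast
qed

text \<open>The generators are the dual basis of the three normals.\<close>

lemma open_simplicial_coneI:
  fixes m :: "'i \<Rightarrow> real^3"
  assumes J: "card J = 3" and m: "\<And>d. (\<And>j. j \<in> J \<Longrightarrow> m j \<bullet> d = 0) \<Longrightarrow> d = 0"
  shows "open_simplicial_cone {x. \<forall>j\<in>J. 0 < m j \<bullet> x}"
proof -
  obtain j1 j2 j3 where J_eq: "J = {j1, j2, j3}" and j: "j1 \<noteq> j2" "j1 \<noteq> j3" "j2 \<noteq> j3"
    using J by (auto simp: card_3_iff)
  define f where "f x = (vector [m j1 \<bullet> x, m j2 \<bullet> x, m j3 \<bullet> x] :: real^3)" for x
  have lin: "linear f"
    by (rule linearI) (simp_all add: f_def vec_eq_iff forall_3 inner_add_right)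
  have "inj f"
    unfolding linear_injective_0[OF lin]
    using m by (auto simp: f_def vec_eq_iff forall_3 J_eq)
  then have "bij f" using linear_injective_imp_surjective[OF lin] by (simp add: bij_def)
  define g where "g = the_inv f"
  have gf: "g (f x) = x" and fg: "f (g y) = y" for x y
    using \<open>bij f\<close> by (simp_all add: g_def bij_def the_inv_f_f f_the_inv_into_f)
  define v where "v k = g (axis k 1)" for k :: 3
  have fv: "m j1 \<bullet> v k = (if k = 1 then 1 else 0)" "m j2 \<bullet> v k = (if k = 2 then 1 else 0)"
    "m j3 \<bullet> v k = (if k = 3 then 1 else 0)" for k
  proof -
    have "f (v k) = axis k 1" by (simp add: fg v_def)
    then show "m j1 \<bullet> v k = (if k = 1 then 1 else 0)" "m j2 \<bullet> v k = (if k = 2 then 1 else 0)"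
      "m j3 \<bullet> v k = (if k = 3 then 1 else 0)"
      by (auto simp: f_def vec_eq_iff forall_3 axis_def)
  qed
  have comb: "x = (m j1 \<bullet> x) *\<^sub>R v 1 + (m j2 \<bullet> x) *\<^sub>R v 2 + (m j3 \<bullet> x) *\<^sub>R v 3" for x
  proof -
    have "f x = f ((m j1 \<bullet> x) *\<^sub>R v 1 + (m j2 \<bullet> x) *\<^sub>R v 2 + (m j3 \<bullet> x) *\<^sub>R v 3)"
      by (simp add: f_def inner_add_right fv)
    then show ?thesis using \<open>inj f\<close> by (simp add: inj_eq)
  qed
  have dist: "distinct [v 1, v 2, v 3]" using fv(1)[of 1] fv(1)[of 2] fv(1)[of 3] fv(2)[of 2] fv(2)[of 3] by force
  have sp: "span {v 1, v 2, v 3} = UNIV"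
  proof -
    have "(m j1 \<bullet> x) *\<^sub>R v 1 + (m j2 \<bullet> x) *\<^sub>R v 2 + (m j3 \<bullet> x) *\<^sub>R v 3 \<in> span {v 1, v 2, v 3}" for x
      by (intro span_add span_scale span_base) auto
    then show ?thesis unfolding comb[symmetric] by blast
  qed
  have "card {v 1, v 2, v 3} = 3" using dist by simp
  then have ind: "independent {v 1, v 2, v 3}"
    using sp by (intro card_le_dim_spanning[of _ UNIV]) (auto simp: dim_UNIV)
  have "{x. \<forall>j\<in>J. 0 < m j \<bullet> x} = {a1 *\<^sub>R v 1 + a2 *\<^sub>R v 2 + a3 *\<^sub>R v 3 | a1 a2 a3. a1 > 0 \<and> a2 > 0 \<and> a3 > 0}"
  proof (intro Set.set_eqI iffI)
    fix x assume "x \<in> {x. \<forall>j\<in>J. 0 < m j \<bullet> x}"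
    then show "x \<in> {a1 *\<^sub>R v 1 + a2 *\<^sub>R v 2 + a3 *\<^sub>R v 3 | a1 a2 a3. a1 > 0 \<and> a2 > 0 \<and> a3 > 0}"
      by (intro CollectI exI[of _ "m j1 \<bullet> x"] exI[of _ "m j2 \<bullet> x"] exI[of _ "m j3 \<bullet> x"] conjI comb)
        (auto simp: J_eq)
  qed (auto simp: J_eq inner_add_right fv)
  then show ?thesis unfolding open_simplicial_cone_def using dist ind sp by blast
qed

context plane_arrangement
begin

lemma chamber_is_cone:
  assumes C: "C \<in> chambers (plane ` {..<n})"
  shows "\<exists>\<sigma>\<in>regions a UNIV {..<n}. C = cone \<sigma> {..<n}"
proof -
  let ?U = "UNIV - \<Union>(plane ` {..<n})"
  have U: "x \<in> ?U \<longleftrightarrow> (\<forall>i<n. a i \<bullet> x \<noteq> 0)" for x by (auto simp: form_kernel_def)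
  have CU: "C \<subseteq> ?U" "C \<noteq> {}" "connected C"
    using C in_components_subset in_components_nonempty in_components_connected unfolding chambers_def by blast+
  obtain x where x: "x \<in> C" using CU by blast
  define \<sigma> where "\<sigma> = {i\<in>{..<n}. 0 < a i \<bullet> x}"
  have x0: "\<forall>i<n. a i \<bullet> x \<noteq> 0" using x CU U by blast
  then have R: "\<sigma> \<in> regions a UNIV {..<n}" by (auto simp: regions_def \<sigma>_def)
  have xc: "x \<in> cone \<sigma> {..<n}" using x0 by (force simp: cone_def \<sigma>_def)
  have conv: "convex (cone \<sigma> {..<n})"
  proof -
    have "cone \<sigma> {..<n} = (\<Inter>i\<in>{..<n}. {y. 0 < sgn_normal \<sigma> i \<bullet> y})" by (auto simp: cone_eq)
    then show ?thesis by (auto intro!: convex_INT convex_halfspace_gt)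
  qed
  have "cone \<sigma> {..<n} \<subseteq> ?U"
  proof
    fix y assume y: "y \<in> cone \<sigma> {..<n}"
    have "a i \<bullet> y \<noteq> 0" if "i < n" for i
    proof -
      have "if i \<in> \<sigma> then 0 < a i \<bullet> y else a i \<bullet> y < 0" using y that by (simp add: cone_def)
      then show ?thesis by (auto split: if_splits)
    qed
    then show "y \<in> ?U" unfolding U by blast
  qed
  then have "cone \<sigma> {..<n} \<subseteq> C"
    using components_maximal[OF C[unfolded chambers_def] convex_connected[OF conv]] x xc by blast
  moreover have "C \<subseteq> cone \<sigma> {..<n}"
  proof
    fix y assume y: "y \<in> C"
    have "0 < sgn_normal \<sigma> i \<bullet> y" if i: "i < n" for i
    proof (rule ccontr)
      assume "\<not> 0 < sgn_normal \<sigma> i \<bullet> y"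
      moreover have "0 < sgn_normal \<sigma> i \<bullet> x" using xc i by (auto simp: cone_eq)
      moreover have "connected ((\<lambda>z. sgn_normal \<sigma> i \<bullet> z) ` C)"
        by (intro connected_continuous_image CU continuous_intros)
      ultimately have "0 \<in> (\<lambda>z. sgn_normal \<sigma> i \<bullet> z) ` C"
        using connectedD_interval[of "(\<lambda>z. sgn_normal \<sigma> i \<bullet> z) ` C" "sgn_normal \<sigma> i \<bullet> y" "sgn_normal \<sigma> i \<bullet> x" 0] x y by fastforce
      then obtain z where "z \<in> C" "a i \<bullet> z = 0" by (auto simp: sgn_normal_def split: if_splits)
      then show False using CU(1) U i by blast
    qed
    then show "y \<in> cone \<sigma> {..<n}" by (auto simp: cone_eq)
  qed
  ultimately show ?thesis using R by blast
qed

text \<open>Double counting of pairs of a chamber and a wall. Each chamber has at least three walls, and by the hypothesis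
  three is also the average, so every chamber has exactly three.\<close>

theorem simplicial_if_count:
  assumes n: "2 \<le> n" and count: "2 * (\<Sum>i<n. card (lines i ({..<n} - {i}))) = 3 * (1 + earlier_lines)"
  shows "simplicial_arrangement (plane ` {..<n})"
proof -
  let ?R = "regions a UNIV {..<n}"
  have fR: "finite ?R" by (simp add: finite_regions)
  have sub: "\<sigma> \<subseteq> {..<n}" if "\<sigma> \<in> ?R" for \<sigma> using that regions_subset_Pow by blast
  have walls_n: "walls \<sigma> \<subseteq> {..<n}" for \<sigma> by (auto simp: walls_def)
  have key: "3 \<le> card J" if "J \<subseteq> {..<n}" "cone \<sigma> J = cone \<sigma> {..<n}" "\<sigma> \<in> ?R" for \<sigma> J
  proof -
    have "span (a ` J) = UNIV"
      using span_cone_normals[OF that(1,2) region_imp_cone[OF that(3)]]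
      by (intro span_UNIV_if_orthogonal_trivial) blast
    then have "3 \<le> card (a ` J)"
      using dim_le_card[of UNIV "a ` J"] that(1) finite_subset by (fastforce simp: dim_UNIV)
    also have "\<dots> \<le> card J" using that(1) by (intro card_image_le) (auto intro: finite_subset)
    finally show ?thesis .
  qed
  have ge: "3 \<le> card (walls \<sigma>)" if s: "\<sigma> \<in> ?R" for \<sigma>
  proof -
    obtain J where J: "J \<subseteq> walls \<sigma>" "cone \<sigma> J = cone \<sigma> {..<n}"
      using minimal_walls[OF sub[OF s] region_imp_cone[OF s] n] by blast
    then have "3 \<le> card J" using key s walls_n by blast
    also have "\<dots> \<le> card (walls \<sigma>)" using J(1) walls_n finite_subset by (intro card_mono) blast+
    finally show ?thesis .
  qed
  have "(\<Sum>\<sigma>\<in>?R. card (walls \<sigma>)) = (\<Sum>\<sigma>\<in>?R. \<Sum>i<n. if i \<in> walls \<sigma> then 1 else 0)"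
  proof (rule sum.cong)
    fix \<sigma>
    have "card (walls \<sigma>) = card {i\<in>{..<n}. i \<in> walls \<sigma>}" using walls_n by (intro arg_cong[where f = card]) blast
    then show "card (walls \<sigma>) = (\<Sum>i<n. if i \<in> walls \<sigma> then 1 else 0)"
      by (simp add: sum.If_cases Int_def)
  qed simp
  also have "\<dots> = (\<Sum>i<n. \<Sum>\<sigma>\<in>?R. if i \<in> walls \<sigma> then 1 else 0)" by (rule sum.swap)
  also have "\<dots> = (\<Sum>i<n. card {\<sigma>\<in>?R. i \<in> walls \<sigma>})"
    using fR by (simp add: sum.If_cases Int_def)
  also have "\<dots> = (\<Sum>i<n. 2 * card (regions a (plane i) ({..<n} - {i})))"
    by (intro sum.cong) (auto simp: card_regions_with_wall)
  also have "\<dots> = (\<Sum>i<n. 4 * card (lines i ({..<n} - {i})))"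
  proof (rule sum.cong)
    fix i assume "i \<in> {..<n}"
    moreover have "{..<n} - {i} \<noteq> {}"
    proof
      assume "{..<n} - {i} = {}"
      then have "card {..<n} \<le> card {i}" by (intro card_mono) auto
      then show False using n by simp
    qed
    ultimately show "2 * card (regions a (plane i) ({..<n} - {i})) = 4 * card (lines i ({..<n} - {i}))"
      by (simp add: card_regions_plane)
  qed simp
  also have "\<dots> = 3 * card ?R"
    using card_all_regions n count by (simp add: sum_distrib_left[symmetric])
  finally have total: "(\<Sum>\<sigma>\<in>?R. card (walls \<sigma>)) = (\<Sum>\<sigma>\<in>?R. 3)" by simp
  \<comment> \<open>A sum of terms that are at least 3 attains its minimum only if all terms equal 3.\<close>
  have eq: "card (walls \<sigma>) = 3" if "\<sigma> \<in> ?R" for \<sigma>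
    using sum_mono_inv[of "\<lambda>_. 3" ?R "\<lambda>\<sigma>. card (walls \<sigma>)" \<sigma>] total ge fR that by simp
  show ?thesis
    unfolding simplicial_arrangement_def
  proof
    fix C assume "C \<in> chambers (plane ` {..<n})"
    then obtain \<sigma> where s: "\<sigma> \<in> ?R" and C: "C = cone \<sigma> {..<n}" using chamber_is_cone by blast
    obtain J where J: "J \<subseteq> walls \<sigma>" "cone \<sigma> J = cone \<sigma> {..<n}"
      using minimal_walls[OF sub[OF s] region_imp_cone[OF s] n] by blast
    have Jn: "J \<subseteq> {..<n}" using J(1) walls_n by blast
    have "card J \<le> 3" using card_mono[OF _ J(1)] walls_n[of \<sigma>] finite_subset eq[OF s] by fastforce
    then have "card J = 3" using key[OF Jn J(2) s] by simp
    then have "open_simplicial_cone {x. \<forall>j\<in>J. 0 < sgn_normal \<sigma> j \<bullet> x}"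
    proof (rule open_simplicial_coneI)
      fix d assume d: "\<And>j. j \<in> J \<Longrightarrow> sgn_normal \<sigma> j \<bullet> d = 0"
      have "a j \<bullet> d = 0" if "j \<in> J" for j using d[OF that] by (simp add: sgn_normal_def split: if_splits)
      then show "d = 0" by (rule span_cone_normals[OF Jn J(2) region_imp_cone[OF s]])
    qed
    then show "open_simplicial_cone C" using C J(2) by (simp add: cone_eq)
  qed
qed

end

section \<open>The characteristic polynomial\<close>

lemma moebius_from_top:
  assumes "finite L" "Y \<noteq> UNIV"
  shows "moebius L UNIV Y = - (\<Sum>Z\<in>{Z\<in>L. Y \<subset> Z}. moebius L UNIV Z)"
proof -
  have "Y \<subset> UNIV" using assms(2) by blast
  then show ?thesis using assms by (subst moebius.simps) simp
qed

lemma dim_form_kernel: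
  fixes v :: "real^3"
  shows "v \<noteq> 0 \<Longrightarrow> dim (form_kernel v) = 2"
  unfolding form_kernel_def by (simp add: dim_hyperplane)

context plane_arrangement
begin

abbreviation arr :: "(real^3) set set" where
  "arr \<equiv> plane ` {..<n}"

lemma plane_inj: "i < n \<Longrightarrow> j < n \<Longrightarrow> plane i = plane j \<Longrightarrow> i = j"
  using plane_not_within[of i j] by (auto simp: form_kernel_def)

lemma inj_on_plane: "inj_on plane {..<n}"
  using plane_inj by (auto intro: inj_onI)

lemma hyperplane_arrangement_arr: "hyperplane_arrangement arr"
  using normal_neq_0 by (auto simp: hyperplane_arrangement_def subspace_form_kernel dim_form_kernel)

text \<open>The elements of codimension 2 of the intersection lattice, that is, the lines in which planes meet.\<close>

definition rank2 :: "(real^3) set set" where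
  "rank2 = {plane i \<inter> plane j | i j. i < n \<and> j < n \<and> i \<noteq> j}"

text \<open>A flat is handled through the set of planes containing it, from which it can be recovered (\<open>flat_idx\<close>).\<close>

definition idx :: "(real^3) set \<Rightarrow> nat set" where
  "idx X = {i. i < n \<and> X \<subseteq> plane i}"

lemma finite_idx [simp]: "finite (idx X)" by (simp add: idx_def)

lemma finite_rank2: "finite rank2"
proof -
  have "rank2 \<subseteq> (\<lambda>(i, j). plane i \<inter> plane j) ` ({..<n} \<times> {..<n})" by (auto simp: rank2_def)
  then show ?thesis by (rule finite_subset) simp
qed

lemma rank2_span:
  assumes "X \<in> rank2"
  obtains c where "c \<noteq> 0" "X = span {c}"
  using assms plane_Int_plane nonparallel unfolding rank2_def by blast

lemma rank2_eqI:
  assumes "X \<in> rank2" "Y \<in> rank2" "X \<subseteq> Y"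
  shows "X = Y"
proof -
  obtain c d where c: "c \<noteq> 0" "X = span {c}" and d: "Y = span {d}" using rank2_span assms(1,2) by metis
  have "c \<in> span {d}" using assms(3) c d span_base by blast
  then obtain t where t: "c = t *\<^sub>R d" by (auto simp: span_singleton)
  then have "t \<noteq> 0" using c by auto
  then show ?thesis unfolding c d t by (rule span_scale_singleton)
qed

lemma rank2_eq_Int:
  assumes "X \<in> rank2" "i \<in> idx X" "j \<in> idx X" "i \<noteq> j"
  shows "X = plane i \<inter> plane j"
proof (rule rank2_eqI)
  show "plane i \<inter> plane j \<in> rank2" using assms by (auto simp: rank2_def idx_def)
qed (use assms in \<open>auto simp: idx_def\<close>)

lemma card_idx_ge_2:
  assumes "X \<in> rank2" shows "2 \<le> card (idx X)"
proof -
  obtain i j where "i < n" "j < n" "i \<noteq> j" "X = plane i \<inter> plane j" using assms by (auto simp: rank2_def)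
  then have "{i, j} \<subseteq> idx X" by (auto simp: idx_def)
  then show ?thesis using card_mono[of "idx X" "{i, j}"] \<open>i \<noteq> j\<close> by simp
qed

lemma dim_rank2: "X \<in> rank2 \<Longrightarrow> dim X = 1"
proof -
  assume "X \<in> rank2"
  then obtain c where "c \<noteq> 0" "X = span {c}" using rank2_span by metis
  then show ?thesis by (simp add: dim_eq_card_independent)
qed

lemma rank2_neq:
  assumes "X \<in> rank2"
  shows "X \<noteq> UNIV" "X \<noteq> {0}" "i < n \<Longrightarrow> X \<noteq> plane i"
proof -
  have d: "dim X = 1" using assms by (rule dim_rank2)
  have "dim (UNIV :: (real^3) set) = 3" by (simp add: dim_UNIV)
  then show "X \<noteq> UNIV" using d by auto
  show "X \<noteq> {0}" using d by auto
  show "X \<noteq> plane i" if "i < n" for i using d dim_form_kernel[OF normal_neq_0[OF that]] by auto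
qed

lemma intersection_lattice_eq:
  "intersection_lattice arr = insert UNIV (insert {0} (arr \<union> rank2))"
proof (intro Set.set_eqI iffI)
  fix X assume "X \<in> intersection_lattice arr"
  then obtain S where S: "S \<subseteq> {..<n}" "X = \<Inter>(plane ` S)"
    unfolding intersection_lattice_def by (auto elim!: subset_imageE)
  consider "S = {}" | i where "S = {i}" | i j where "i \<in> S" "j \<in> S" "i \<noteq> j" by (metis is_singletonI' is_singleton_def ex_in_conv)
  then show "X \<in> insert UNIV (insert {0} (arr \<union> rank2))"
  proof cases
    case 3
    have ij: "i < n" "j < n" using 3 S by auto
    define c where "c = cross3 (a i) (a j)"
    have c: "c \<noteq> 0" "plane i \<inter> plane j = span {c}"
      using nonparallel[OF ij 3(3)] plane_Int_plane[OF ij 3(3)] by (simp_all add: c_def)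
    have sub: "X \<subseteq> plane i \<inter> plane j" using 3 S by blast
    show ?thesis
    proof (cases "\<forall>k\<in>S. a k \<bullet> c = 0")
      case True
      then have "span {c} \<subseteq> X" unfolding S(2) by (auto simp: span_singleton form_kernel_def)
      then have "X = plane i \<inter> plane j" using sub c by simp
      then show ?thesis using ij 3 by (auto simp: rank2_def)
    next
      case False
      then obtain k where k: "k \<in> S" "a k \<bullet> c \<noteq> 0" by blast
      have "x = 0" if "x \<in> X" for x
      proof -
        have "x \<in> span {c}" using that sub c(2) by blast
        then obtain t where t: "x = t *\<^sub>R c" by (auto simp: span_singleton)
        have "a k \<bullet> x = 0" using that k(1) S(2) by (auto simp: form_kernel_def)
        then show ?thesis using k(2) t by simp
      qed
      moreover have "0 \<in> X" by (auto simp: S(2) form_kernel_def)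
      ultimately have "X = {0}" by blast
      then show ?thesis by blast
    qed
  qed (use S in auto)
next
  fix X assume "X \<in> insert UNIV (insert {0} (arr \<union> rank2))"
  then consider "X = UNIV" | "X = {0}" | "X \<in> arr" | "X \<in> rank2" by blast
  then show "X \<in> intersection_lattice arr"
  proof cases
    case 1
    then show ?thesis unfolding intersection_lattice_def by (intro CollectI exI[of _ "{}"]) simp
  next
    case 2
    then have "X = \<Inter>arr" using essential by (auto simp: form_kernel_def)
    then show ?thesis unfolding intersection_lattice_def by blast
  next
    case 3
    then show ?thesis unfolding intersection_lattice_def by (intro CollectI exI[of _ "{X}"]) simp
  next
    case 4
    then obtain i j where "i < n" "j < n" "X = plane i \<inter> plane j" by (auto simp: rank2_def)
    then show ?thesis unfolding intersection_lattice_def by (intro CollectI exI[of _ "{plane i, plane j}"]) auto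
  qed
qed

abbreviation lat :: "(real^3) set set" where "lat \<equiv> intersection_lattice arr"

lemma finite_lat: "finite lat"
  by (simp add: intersection_lattice_eq finite_rank2)

lemma plane_psubset_UNIV: "i < n \<Longrightarrow> plane i \<subset> UNIV"
proof -
  assume "i < n"
  then have "a i \<notin> plane i" using normal_neq_0[of i] by (simp add: form_kernel_def)
  then show ?thesis by blast
qed

lemma moebius_UNIV: "moebius lat UNIV UNIV = 1"
  by (subst moebius.simps) simp

lemma plane_not_subset_rank2: "X \<in> rank2 \<Longrightarrow> i < n \<Longrightarrow> \<not> plane i \<subseteq> X"
proof
  assume X: "X \<in> rank2" and i: "i < n" and s: "plane i \<subseteq> X"
  have "dim (plane i) \<le> dim X" by (rule dim_subset[OF s])
  then show False using dim_rank2[OF X] dim_form_kernel[OF normal_neq_0[OF i]] by simp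
qed

lemma plane_subset_plane: "i < n \<Longrightarrow> j < n \<Longrightarrow> plane i \<subseteq> plane j \<Longrightarrow> i = j"
  using plane_not_within[of i j] by (auto simp: form_kernel_def)

lemma zero_in_plane [simp]: "0 \<in> plane i" by (simp add: form_kernel_def)

lemma zero_in_rank2: "X \<in> rank2 \<Longrightarrow> 0 \<in> X"
  by (auto simp: rank2_def)

lemma moebius_plane:
  assumes i: "i < n" shows "moebius lat UNIV (plane i) = - 1"
proof -
  have "{Z \<in> lat. plane i \<subset> Z} = {UNIV}"
  proof -
    have "Z = UNIV" if "Z \<in> lat" "plane i \<subset> Z" for Z
    proof -
      have "Z \<noteq> {0}" using that(2) zero_in_plane[of i] by blast
      moreover have "Z \<notin> rank2" using plane_not_subset_rank2[OF _ i] that(2) by blast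
      moreover have "Z \<notin> arr" using plane_subset_plane[OF i] that(2) by blast
      ultimately show ?thesis using that(1) by (auto simp: intersection_lattice_eq)
    qed
    moreover have "UNIV \<in> lat" by (simp add: intersection_lattice_eq)
    ultimately show ?thesis using plane_psubset_UNIV[OF i] by blast
  qed
  moreover have "plane i \<noteq> UNIV" using plane_psubset_UNIV[OF i] by blast
  ultimately show ?thesis using moebius_from_top[OF finite_lat] by (simp add: moebius_UNIV)
qed

lemma moebius_rank2:
  assumes X: "X \<in> rank2" shows "moebius lat UNIV X = int (card (idx X)) - 1"
proof -
  have "{Z \<in> lat. X \<subset> Z} = insert UNIV (plane ` idx X)"
  proof (intro Set.set_eqI iffI)
    fix Z assume Z: "Z \<in> {Z \<in> lat. X \<subset> Z}"
    have "Z \<noteq> {0}" using Z zero_in_rank2[OF X] by blast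
    moreover have "Z \<notin> rank2" using Z rank2_eqI[OF X] by blast
    ultimately have "Z = UNIV \<or> Z \<in> arr" using Z by (auto simp: intersection_lattice_eq)
    then show "Z \<in> insert UNIV (plane ` idx X)" using Z by (auto simp: idx_def)
  next
    fix Z assume "Z \<in> insert UNIV (plane ` idx X)"
    then have "X \<subseteq> Z" "Z \<in> lat" by (auto simp: intersection_lattice_eq idx_def)
    moreover have "X \<noteq> Z" using \<open>Z \<in> insert UNIV (plane ` idx X)\<close> rank2_neq[OF X] by (auto simp: idx_def)
    ultimately show "Z \<in> {Z \<in> lat. X \<subset> Z}" by blast
  qed
  moreover have "UNIV \<notin> plane ` idx X" using plane_psubset_UNIV by (auto simp: idx_def)
  moreover have "inj_on plane (idx X)" using inj_on_plane by (rule inj_on_subset) (auto simp: idx_def)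
  then have "(\<Sum>Z\<in>plane ` idx X. moebius lat UNIV Z) = (\<Sum>i\<in>idx X. - 1)"
    by (subst sum.reindex) (auto simp: moebius_plane idx_def intro!: sum.cong)
  ultimately show ?thesis using moebius_from_top[OF finite_lat rank2_neq(1)[OF X]] by (simp add: moebius_UNIV)
qed

text \<open>Among the planes through a line, exactly those other than the one with least index meet an earlier plane in
  this line.\<close>

lemma sum_card_idx: "(\<Sum>X\<in>rank2. card (idx X) - 1) = earlier_lines"
proof -
  have mem: "X \<in> lines i {..<i} \<longleftrightarrow> i \<in> idx X - {Min (idx X)}" if X: "X \<in> rank2" and i: "i < n" for X i
  proof
    have ne: "idx X \<noteq> {}" using card_idx_ge_2[OF X] by auto
    assume "X \<in> lines i {..<i}"
    then obtain j where j: "j < i" "X = plane i \<inter> plane j" by (auto simp: lines_def)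
    then have "j \<in> idx X" "i \<in> idx X" using i by (auto simp: idx_def)
    then have "Min (idx X) \<le> j" by simp
    then show "i \<in> idx X - {Min (idx X)}" using \<open>i \<in> idx X\<close> j by auto
  next
    assume i': "i \<in> idx X - {Min (idx X)}"
    have m: "Min (idx X) \<in> idx X" using i' by (intro Min_in) auto
    have "Min (idx X) < i" using i' by (intro le_neq_trans) auto
    moreover have "X = plane i \<inter> plane (Min (idx X))" using rank2_eq_Int[OF X] i' m by auto
    ultimately show "X \<in> lines i {..<i}" by (auto simp: lines_def)
  qed
  have "earlier_lines = (\<Sum>i<n. card {X\<in>rank2. X \<in> lines i {..<i}})"
    unfolding earlier_lines_def
  proof (intro sum.cong refl arg_cong[where f = card])
    fix i assume "i \<in> {..<n}"
    then show "lines i {..<i} = {X\<in>rank2. X \<in> lines i {..<i}}"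
      by (fastforce simp: lines_def rank2_def)
  qed
  also have "\<dots> = (\<Sum>i<n. \<Sum>X\<in>rank2. if X \<in> lines i {..<i} then 1 else 0)"
    using finite_rank2 by (simp add: sum.If_cases Int_def)
  also have "\<dots> = (\<Sum>X\<in>rank2. \<Sum>i<n. if X \<in> lines i {..<i} then 1 else 0)" by (rule sum.swap)
  also have "\<dots> = (\<Sum>X\<in>rank2. card (idx X) - 1)"
  proof (rule sum.cong)
    fix X assume X: "X \<in> rank2"
    have "(\<Sum>i<n. if X \<in> lines i {..<i} then 1 else 0) = card {i\<in>{..<n}. X \<in> lines i {..<i}}"
      by (simp add: sum.If_cases Int_def)
    also have "{i\<in>{..<n}. X \<in> lines i {..<i}} = idx X - {Min (idx X)}"
      using mem[OF X] by (auto simp: idx_def)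
    also have "card \<dots> = card (idx X) - 1"
    proof -
      have "idx X \<noteq> {}" using card_idx_ge_2[OF X] by auto
      then show ?thesis by (simp add: card_Diff_singleton)
    qed
    finally show "(\<Sum>i<n. if X \<in> lines i {..<i} then 1 else 0) = card (idx X) - 1" .
  qed simp
  finally show ?thesis by simp
qed

lemma sum_card_lines: "(\<Sum>i<n. card (lines i ({..<n} - {i}))) = (\<Sum>X\<in>rank2. card (idx X))"
proof -
  have mem: "X \<in> lines i ({..<n} - {i}) \<longleftrightarrow> i \<in> idx X" if X: "X \<in> rank2" and i: "i < n" for X i
  proof
    assume i': "i \<in> idx X"
    have "idx X - {i} \<noteq> {}"
    proof
      assume "idx X - {i} = {}"
      then have "card (idx X) \<le> card {i}" by (intro card_mono) auto
      then show False using card_idx_ge_2[OF X] by simp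
    qed
    then obtain j where j: "j \<in> idx X" "j \<noteq> i" by blast
    then have "X = plane i \<inter> plane j" using rank2_eq_Int[OF X i' j(1)] by auto
    moreover have "j < n" using j(1) by (simp add: idx_def)
    ultimately show "X \<in> lines i ({..<n} - {i})" using j(2) by (auto simp: lines_def)
  qed (use i in \<open>auto simp: lines_def idx_def\<close>)
  have "(\<Sum>i<n. card (lines i ({..<n} - {i}))) = (\<Sum>i<n. card {X\<in>rank2. i \<in> idx X})"
  proof (intro sum.cong refl arg_cong[where f = card])
    fix i assume i: "i \<in> {..<n}"
    have "lines i ({..<n} - {i}) \<subseteq> rank2" using i by (fastforce simp: lines_def rank2_def)
    then show "lines i ({..<n} - {i}) = {X\<in>rank2. i \<in> idx X}" using mem i by blast
  qed
  also have "\<dots> = (\<Sum>i<n. \<Sum>X\<in>rank2. if i \<in> idx X then 1 else 0)"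
    using finite_rank2 by (simp add: sum.If_cases Int_def)
  also have "\<dots> = (\<Sum>X\<in>rank2. \<Sum>i<n. if i \<in> idx X then 1 else 0)" by (rule sum.swap)
  also have "\<dots> = (\<Sum>X\<in>rank2. card (idx X))"
  proof (rule sum.cong)
    fix X
    have "{i \<in> {..<n}. i \<in> idx X} = idx X" by (auto simp: idx_def)
    then show "(\<Sum>i<n. if i \<in> idx X then 1 else 0) = card (idx X)"
      by (simp add: sum.If_cases Int_def)
  qed simp
  finally show ?thesis .
qed

lemma sum_moebius_rank2: "(\<Sum>X\<in>rank2. moebius lat UNIV X) = int earlier_lines"
proof -
  have "(\<Sum>X\<in>rank2. moebius lat UNIV X) = (\<Sum>X\<in>rank2. int (card (idx X) - 1))"
    using card_idx_ge_2 by (intro sum.cong refl) (force simp: moebius_rank2 of_nat_diff)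
  then show ?thesis by (simp only: sum_card_idx flip: of_nat_sum)
qed

lemma zero_not_flat: "{0} \<noteq> (UNIV :: (real^3) set)" "{0} \<notin> arr" "{0} \<notin> rank2"
proof -
  show "{0} \<noteq> (UNIV :: (real^3) set)" by (metis UNIV_I axis_eq_0_iff singletonD zero_neq_one)
  show "{0} \<notin> arr"
  proof
    assume "{0} \<in> arr"
    then obtain i where "i < n" "plane i = {0}" by force
    then show False using dim_form_kernel[OF normal_neq_0] by force
  qed
  show "{0} \<notin> rank2" using dim_rank2 by fastforce
qed

lemma flats_disjoint: "UNIV \<notin> arr" "UNIV \<notin> rank2" "arr \<inter> rank2 = {}"
proof -
  show "UNIV \<notin> arr" using plane_psubset_UNIV by auto
  show "UNIV \<notin> rank2" using dim_rank2[of UNIV] by (auto simp: dim_UNIV)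
  show "arr \<inter> rank2 = {}" using plane_not_subset_rank2 by fastforce
qed

lemma sum_over_lat:
  fixes f :: "(real^3) set \<Rightarrow> 'b::comm_monoid_add"
  shows "(\<Sum>X\<in>lat. f X) = f UNIV + (f {0} + ((\<Sum>i<n. f (plane i)) + (\<Sum>X\<in>rank2. f X)))"
proof -
  have "(\<Sum>X\<in>arr \<union> rank2. f X) = (\<Sum>i<n. f (plane i)) + (\<Sum>X\<in>rank2. f X)"
    using flats_disjoint(3) finite_rank2 inj_on_plane by (subst sum.union_disjoint) (auto simp: sum.reindex)
  moreover have "{0} \<notin> arr \<union> rank2" "UNIV \<notin> insert {0} (arr \<union> rank2)"
    using zero_not_flat flats_disjoint by (blast, metis UnE insertE)
  ultimately show ?thesis unfolding intersection_lattice_eq using finite_rank2 by (simp del: Un_iff insert_iff)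
qed

lemma moebius_zero: "moebius lat UNIV {0} = - (1 - int n + int earlier_lines)"
proof -
  have "{Z \<in> lat. {0} \<subset> Z} = lat - {{0}}"
  proof -
    have "{0} \<subseteq> Z" if "Z \<in> lat" for Z using that zero_in_rank2 by (auto simp: intersection_lattice_eq)
    then show ?thesis by blast
  qed
  moreover have "{0} \<in> lat" by (simp add: intersection_lattice_eq)
  then have "(\<Sum>Z\<in>lat. moebius lat UNIV Z) = moebius lat UNIV {0} + (\<Sum>Z\<in>lat - {{0}}. moebius lat UNIV Z)"
    using finite_lat by (rule sum.remove[rotated])
  moreover have "(\<Sum>i<n. moebius lat UNIV (plane i)) = - int n" by (simp add: moebius_plane)
  ultimately have "(\<Sum>Z\<in>{Z \<in> lat. {0} \<subset> Z}. moebius lat UNIV Z) = 1 - int n + int earlier_lines"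
    using sum_over_lat[of "moebius lat UNIV"] by (simp add: moebius_UNIV sum_moebius_rank2)
  then show ?thesis using moebius_from_top[OF finite_lat zero_not_flat(1)] by simp
qed

theorem characteristic_polynomial_arr:
  "characteristic_polynomial arr =
     [:- (1 - int n + int earlier_lines), int earlier_lines, - int n, 1:]"
proof -
  have "(\<Sum>X\<in>rank2. monom (moebius lat UNIV X) (dim X)) = (\<Sum>X\<in>rank2. monom (moebius lat UNIV X) 1)"
    by (intro sum.cong) (auto simp: dim_rank2)
  also have "\<dots> = monom (int earlier_lines) 1" by (simp add: sum_moebius_rank2 flip: monom_sum)
  finally have r2: "(\<Sum>X\<in>rank2. monom (moebius lat UNIV X) (dim X)) = monom (int earlier_lines) 1" .
  have "(\<Sum>i<n. monom (moebius lat UNIV (plane i)) (dim (plane i))) = (\<Sum>i<n. monom (- 1) 2)"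
    by (intro sum.cong) (auto simp: moebius_plane dim_form_kernel normal_neq_0)
  also have "\<dots> = monom (\<Sum>i<n. - 1) 2" by (rule monom_sum[symmetric])
  also have "(\<Sum>i<n. - 1 :: int) = - int n" by simp
  finally have "(\<Sum>i<n. monom (moebius lat UNIV (plane i)) (dim (plane i))) = monom (- int n) 2" .
  then show ?thesis
    unfolding characteristic_polynomial_def sum_over_lat r2
    by (simp add: moebius_UNIV moebius_zero dim_UNIV monom_altdef power_numeral_reduce numeral_2_eq_2 numeral_3_eq_3 algebra_simps)
qed

end

section \<open>Polynomial vector fields tangent to the planes\<close>

interpretation vf: real_space "\<lambda>c (m :: real^3 \<Rightarrow> real^3) v. c *\<^sub>R m v"
  by unfold_locales (auto simp: fun_eq_iff algebra_simps)

lemma sum_fun_apply: "(\<Sum>i\<in>I. f i) v = (\<Sum>i\<in>I. f i v)" for f :: "'i \<Rightarrow> 'a \<Rightarrow> 'b::comm_monoid_add"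
  by (induction I rule: infinite_finite_induct) auto

text \<open>A derivation of the polynomial ring corresponds to a polynomial vector field; \<open>k\<close> is the degree of its
  components.\<close>

definition hom_fields :: "nat \<Rightarrow> (real^3 \<Rightarrow> real^3) set" where
  "hom_fields k = {m. \<forall>i. (\<lambda>v. m v $ i) \<in> hom_funs k}"

lemma hom_field_subspace: "vf.subspace (hom_fields k)"
  by (auto simp: vf.subspace_def hom_fields_def hom_fun_0 hom_fun_add hom_fun_cmult)

lemma hom_field_scaleR: "m \<in> hom_fields k \<Longrightarrow> m (t *\<^sub>R v) = t ^ k *\<^sub>R m v"
  using hom_fun_scaleR[of "\<lambda>v. m v $ _" k t v] by (simp add: hom_fields_def vec_eq_iff)

lemma hom_field_inner: "m \<in> hom_fields k \<Longrightarrow> (\<lambda>v. b \<bullet> m v) \<in> hom_funs k"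
  unfolding inner_vec_def by (intro hom_fun_sum) (auto simp: hom_fields_def hom_fun_cmult)

lemma hom_field_mult: "f \<in> hom_funs k \<Longrightarrow> m \<in> hom_fields l \<Longrightarrow> (\<lambda>v. f v *\<^sub>R m v) \<in> hom_fields (k + l)"
  by (auto simp: hom_fields_def intro: hom_fun_mult)

lemma hom_field_const: "f \<in> hom_funs k \<Longrightarrow> (\<lambda>v. f v *\<^sub>R d) \<in> hom_fields k"
proof -
  assume f: "f \<in> hom_funs k"
  have "(\<lambda>v. f v * d $ i) \<in> hom_funs k" for i using hom_fun_cmult[OF f, of "d $ i"] by (simp add: mult.commute)
  then show ?thesis by (simp add: hom_fields_def)
qed

lemma dim_hom_fields: "vf.finite_dim (hom_fields k)" "vf.dim (hom_fields k) = 3 * card (tri k)"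
proof -
  define w where "w = (\<lambda>(i :: 3, s) v. mono2 k s v *\<^sub>R (axis i 1 :: real^3))"
  let ?I = "(UNIV :: 3 set) \<times> tri k"
  have wI: "w i \<in> hom_fields k" if "i \<in> ?I" for i
    using that mono2_hom_fun by (auto simp: w_def intro!: hom_field_const)
  have comp: "(\<Sum>i\<in>?I. (\<lambda>v. c i *\<^sub>R w i v)) v $ j = (\<Sum>s\<in>tri k. c (j, s) * mono2 k s v)" for c v j
  proof -
    have "(\<Sum>i\<in>?I. (\<lambda>v. c i *\<^sub>R w i v)) v $ j = (\<Sum>i\<in>?I. (c i *\<^sub>R w i v) $ j)"
      by (simp only: sum_fun_apply sum_component)
    also have "\<dots> = (\<Sum>i\<in>UNIV. \<Sum>s\<in>tri k. (if j = i then c (i, s) * mono2 k s v else 0))"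
      by (simp add: w_def sum.cartesian_product axis_def if_distrib cong: if_cong) (intro sum.cong refl, auto)
    also have "\<dots> = (\<Sum>s\<in>tri k. \<Sum>i\<in>UNIV. (if j = i then c (i, s) * mono2 k s v else 0))"
      by (rule sum.swap)
    also have "\<dots> = (\<Sum>s\<in>tri k. c (j, s) * mono2 k s v)" by simp
    finally show ?thesis .
  qed
  have indep: "\<forall>i\<in>?I. c i = 0" if "(\<Sum>i\<in>?I. (\<lambda>v. c i *\<^sub>R w i v)) = 0" for c
  proof -
    have z: "(\<Sum>s\<in>tri k. c (j, s) * mono2 k s v) = 0" for j v
      using comp[of c v j] by (simp only: that) simp
    have "c (j, s) = 0" if "s \<in> tri k" for j s
      using mono2_independent[where w = "\<lambda>s. c (j, s)", OF z that] .
    then show ?thesis by auto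
  qed
  have span: "\<exists>c. x = (\<Sum>i\<in>?I. (\<lambda>v. c i *\<^sub>R w i v))" if "x \<in> hom_fields k" for x
  proof -
    have "\<forall>j. \<exists>c. \<forall>v. x v $ j = (\<Sum>s\<in>tri k. c s * mono2 k s v)"
      using that hom_fun_monomials unfolding hom_fields_def by blast
    then obtain c where c: "\<And>j v. x v $ j = (\<Sum>s\<in>tri k. c j s * mono2 k s v)" by metis
    have "x = (\<Sum>i\<in>?I. (\<lambda>v. (case i of (j, s) \<Rightarrow> c j s) *\<^sub>R w i v))"
      by (rule ext) (simp add: vec_eq_iff comp c)
    then show ?thesis by blast
  qed
  have fI: "finite ?I" by simp
  show "vf.finite_dim (hom_fields k)" by (rule vf.dim_family(1)[OF hom_field_subspace fI wI indep span])
  have "vf.dim (hom_fields k) = card ?I" by (rule vf.dim_family(2)[OF hom_field_subspace fI wI indep span])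
  then show "vf.dim (hom_fields k) = 3 * card (tri k)" by (simp add: card_cartesian_product)
qed

context plane_arrangement
begin

definition tangent :: "nat \<Rightarrow> (real^3 \<Rightarrow> real^3) \<Rightarrow> bool" where
  "tangent i m \<longleftrightarrow> (\<forall>v. a i \<bullet> v = 0 \<longrightarrow> a i \<bullet> m v = 0)"

text \<open>The fields of degree \<open>k\<close> tangent to the planes before the \<open>i\<close>-th. The dimension is estimated by imposing one
  plane at a time.\<close>

definition tangent_below :: "nat \<Rightarrow> nat \<Rightarrow> (real^3 \<Rightarrow> real^3) set" where
  "tangent_below i k = {m \<in> hom_fields k. \<forall>j<i. tangent j m}"

lemma tangent_below_subspace: "vf.subspace (tangent_below i k)"
  using hom_field_subspace[of k] unfolding vf.subspace_def
  by (auto simp: tangent_below_def tangent_def inner_add_right)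

lemma tangent_below_fin: "vf.finite_dim (tangent_below i k)"
  by (rule vf.fin_subset[OF dim_hom_fields(1) tangent_below_subspace]) (auto simp: tangent_below_def)

lemma plane_has_nonzero:
  assumes "i < n" shows "\<exists>w\<in>plane i. w \<noteq> 0"
proof -
  have "dim (plane i) \<noteq> 0" using dim_form_kernel[OF normal_neq_0[OF assms]] by linarith
  then have "\<not> plane i \<subseteq> {0}" by (simp only: dim_eq_0 not_False_eq_True)
  then show ?thesis by blast
qed

text \<open>Coordinates \<open>lu, lw\<close> on a plane with respect to a basis \<open>u, w\<close>, given by vectors of the ambient space so that
  they extend to linear forms.\<close>

lemma plane_frame:
  assumes i: "i < n" and w: "w \<in> plane i" "w \<noteq> 0"
  obtains u lu lw where "u \<in> plane i" "lu \<bullet> u = 1" "lu \<bullet> w = 0" "lw \<bullet> u = 0" "lw \<bullet> w = 1"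
    "\<And>v. v \<in> plane i \<Longrightarrow> v = (lu \<bullet> v) *\<^sub>R u + (lw \<bullet> v) *\<^sub>R w"
proof -
  define u where "u = cross3 (a i) w"
  have aw: "a i \<bullet> w = 0" using w by (simp add: form_kernel_def)
  have "(norm u)\<^sup>2 = (norm (a i) * norm w)\<^sup>2"
    using norm_cross_dot[of "a i" w] aw by (simp add: u_def)
  then have u0: "u \<noteq> 0" using normal_neq_0[OF i] w(2) by auto
  have au: "a i \<bullet> u = 0" and wu: "w \<bullet> u = 0" by (simp_all add: u_def)
  define lu lw where "lu = (1 / (u \<bullet> u)) *\<^sub>R u" and "lw = (1 / (w \<bullet> w)) *\<^sub>R w"
  have uu: "u \<bullet> u \<noteq> 0" and ww: "w \<bullet> w \<noteq> 0" using u0 w(2) by auto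
  show ?thesis
  proof (rule that[of u lu lw])
    show "u \<in> plane i" using au by (simp add: form_kernel_def)
    show "lu \<bullet> u = 1" "lw \<bullet> w = 1" using uu ww by (simp_all add: lu_def lw_def)
    show "lu \<bullet> w = 0" "lw \<bullet> u = 0" using wu by (simp_all add: lu_def lw_def inner_commute)
    fix v assume v: "v \<in> plane i"
    define d where "d = v - ((lu \<bullet> v) *\<^sub>R u + (lw \<bullet> v) *\<^sub>R w)"
    have "a i \<bullet> d = 0" using v au aw by (simp add: d_def form_kernel_def inner_diff_right inner_add_right)
    moreover have "w \<bullet> d = 0" using wu ww by (simp add: d_def inner_diff_right inner_add_right lw_def)
    moreover have ud: "u \<bullet> d = 0" using wu uu by (simp add: d_def inner_diff_right inner_add_right lu_def inner_commute)
    ultimately obtain c where "d = c *\<^sub>R u"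
      using orthogonal_imp_cross3_multiple[of "a i" w d] u0 unfolding u_def by blast
    then have "d = 0" using ud uu by auto
    then show "v = (lu \<bullet> v) *\<^sub>R u + (lw \<bullet> v) *\<^sub>R w" by (simp add: d_def)
  qed
qed

lemma hom_fun_zero_on_plane:
  assumes f: "f \<in> hom_funs k" and z: "\<And>s. s \<le> k \<Longrightarrow> f (u + real s *\<^sub>R w) = 0"
  shows "f (\<alpha> *\<^sub>R u + \<beta> *\<^sub>R w) = 0"
proof -
  obtain p where p: "degree p \<le> k" "\<And>s. poly p s = f (u + s *\<^sub>R w)" using hom_fun_on_line[OF f] by blast
  have "p = 0"
  proof (rule ccontr)
    assume p0: "p \<noteq> 0"
    have "real ` {..k} \<subseteq> {x. poly p x = 0}" using z by (auto simp: p(2))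
    then have "card (real ` {..k}) \<le> card {x. poly p x = 0}" by (rule card_mono[OF poly_roots_finite[OF p0]])
    also have "\<dots> \<le> degree p" using p0 by (rule card_poly_roots_bound)
    finally show False using p(1) by (simp add: card_image)
  qed
  then have z': "f (u + s *\<^sub>R w) = 0" for s using p(2)[of s] by simp
  have nz: "f (\<alpha> *\<^sub>R u + \<beta> *\<^sub>R w) = 0" if "\<alpha> \<noteq> 0" for \<alpha>
  proof -
    have "\<alpha> *\<^sub>R u + \<beta> *\<^sub>R w = \<alpha> *\<^sub>R (u + (\<beta> / \<alpha>) *\<^sub>R w)" using that by (simp add: algebra_simps)
    then show ?thesis using hom_fun_scaleR[OF f] z' by simp
  qed
  show ?thesis
  proof (cases "\<alpha> = 0")
    case True
    obtain q where q: "\<And>s. poly q s = f (\<beta> *\<^sub>R w + s *\<^sub>R u)" using hom_fun_on_line[OF f] by blast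
    have "q = 0"
    proof (rule ccontr)
      assume "q \<noteq> 0"
      then have "finite {x. poly q x = 0}" by (rule poly_roots_finite)
      moreover have "{0<..} \<subseteq> {x. poly q x = 0}" using nz by (auto simp: q add.commute)
      ultimately show False using infinite_Ioi finite_subset by blast
    qed
    then show ?thesis using q[of 0] True by simp
  qed (rule nz)
qed

text \<open>The normal component of a field, restricted to the plane, is a form of degree \<open>k\<close> in two variables, which vanishes
  if it does so at \<open>k + 1\<close> points of an affine line (\<open>hom_fun_zero_on_plane\<close>). Hence tangency amounts to at most
  \<open>k + 1\<close> linear conditions.\<close>

lemma dim_tangent_below_upper_drop:
  assumes i: "i < n"
  shows "vf.dim (tangent_below i k) \<le> vf.dim (tangent_below (Suc i) k) + (k + 1)"
proof -
  obtain w where w: "w \<in> plane i" "w \<noteq> 0" using plane_has_nonzero[OF i] by blast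
  obtain u lu lw where fr: "u \<in> plane i" "\<And>v. v \<in> plane i \<Longrightarrow> v = (lu \<bullet> v) *\<^sub>R u + (lw \<bullet> v) *\<^sub>R w"
    using plane_frame[OF i w] by metis
  define K where "K r = {m \<in> tangent_below i k. \<forall>s<r. a i \<bullet> m (u + real s *\<^sub>R w) = 0}" for r
  have K: "vf.subspace (K r) \<and> vf.dim (tangent_below i k) \<le> vf.dim (K r) + r" for r
  proof (induction r)
    case 0
    have "K 0 = tangent_below i k" by (simp add: K_def)
    then show ?case using tangent_below_subspace by simp
  next
    case (Suc r)
    have fK: "vf.finite_dim (K r)" using vf.fin_subset[OF tangent_below_fin[of i k]] Suc by (auto simp: K_def)
    have eq: "K (Suc r) = {m \<in> K r. a i \<bullet> m (u + real r *\<^sub>R w) = 0}" by (auto simp: K_def less_Suc_eq)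
    have "vf.subspace (K (Suc r))" "vf.dim (K r) \<le> vf.dim (K (Suc r)) + 1"
      unfolding eq by (rule vf.dim_kernel_functional[OF fK]; simp add: inner_add_right)+
    then show ?case using Suc by linarith
  qed
  have "K (k + 1) = tangent_below (Suc i) k"
  proof (intro Set.set_eqI iffI)
    fix m assume m: "m \<in> K (k + 1)"
    have "tangent i m"
      unfolding tangent_def
    proof (intro allI impI)
      fix v assume "a i \<bullet> v = 0"
      then have v: "v = (lu \<bullet> v) *\<^sub>R u + (lw \<bullet> v) *\<^sub>R w" by (intro fr(2)) (simp add: form_kernel_def)
      have "a i \<bullet> m ((lu \<bullet> v) *\<^sub>R u + (lw \<bullet> v) *\<^sub>R w) = 0"
        using m by (intro hom_fun_zero_on_plane[where f = "\<lambda>v. a i \<bullet> m v" and k = k] hom_field_inner) (auto simp: K_def tangent_below_def)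
      then show "a i \<bullet> m v = 0" using v by simp
    qed
    then show "m \<in> tangent_below (Suc i) k" using m by (auto simp: K_def tangent_below_def less_Suc_eq)
  next
    fix m assume m: "m \<in> tangent_below (Suc i) k"
    have "a i \<bullet> m (u + real s *\<^sub>R w) = 0" for s
      using m fr(1) w(1) by (auto simp: tangent_below_def tangent_def form_kernel_def inner_add_right)
    then show "m \<in> K (k + 1)" using m by (auto simp: K_def tangent_below_def)
  qed
  then show ?thesis using K[of "k + 1"] by simp
qed

text \<open>Such a vector exists because the earlier planes cut the plane \<open>i\<close> into at least one region.\<close>

lemma generic_in_plane:
  assumes i: "i < n"
  obtains w where "w \<in> plane i" "w \<noteq> 0" "\<And>j. j < i \<Longrightarrow> a j \<bullet> w \<noteq> 0"
proof (cases "i = 0")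
  case True
  obtain w where w: "w \<in> plane i" "w \<noteq> 0" using plane_has_nonzero[OF i] by blast
  then show ?thesis using that True by blast
next
  case False
  then have ne: "{..<i} \<noteq> {}" by (auto simp: lessThan_def)
  have "card (lines i {..<i}) \<noteq> 0" using ne by (simp add: lines_def)
  then have "card (regions a (plane i) {..<i}) \<noteq> 0"
    using i ne by (subst card_regions_plane) auto
  then have "regions a (plane i) {..<i} \<noteq> {}" by auto
  then obtain w where w: "w \<in> plane i" "\<forall>j\<in>{..<i}. a j \<bullet> w \<noteq> 0" unfolding regions_def by blast
  moreover have "w \<noteq> 0" using w(2) ne by auto
  ultimately show ?thesis using that by blast
qed

text \<open>Tangency to plane \<open>i\<close> imposes at least as many conditions as there are independent restrictions of normal components. Let \<open>j\<close> be an
  earlier plane and \<open>d\<close> a direction in plane \<open>j\<close> that is not in plane \<open>i\<close>. The product of the forms of the other earlier planes, times an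
  arbitrary form of degree \<open>k + 1 - i\<close>, times \<open>d\<close>, is tangent to all earlier planes. On plane \<open>i\<close>, with the
  inhomogeneous coordinate \<open>s\<close>, the normal components are multiples of \<open>\<Prod>(s - t l)\<close> over
  \<open>l \<noteq> j\<close>, where \<open>t l\<close> marks the line shared with plane \<open>l\<close>. One \<open>j\<close> with all \<open>k + 2 - i\<close> monomials in \<open>s\<close>, and one field for every further
  line, give independent functions, as in Lagrange interpolation.\<close>

lemma dim_tangent_below_lower_drop:
  assumes i: "i < n" and k: "n \<le> k"
  shows "vf.dim (tangent_below (Suc i) k) + (k + 1 - i + card (lines i {..<i})) \<le> vf.dim (tangent_below i k)"
proof -
  obtain w where w: "w \<in> plane i" "w \<noteq> 0" "\<And>j. j < i \<Longrightarrow> a j \<bullet> w \<noteq> 0" using generic_in_plane[OF i] by metis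
  obtain u lu lw where fr: "u \<in> plane i" "lu \<bullet> u = 1" "lu \<bullet> w = 0" "lw \<bullet> u = 0" "lw \<bullet> w = 1"
    using plane_frame[OF i w(1,2)] by metis
  have ev: "lu \<bullet> (u + s *\<^sub>R w) = 1" "lw \<bullet> (u + s *\<^sub>R w) = s" "a i \<bullet> (u + s *\<^sub>R w) = 0" for s
    using fr w(1) by (simp_all add: inner_add_right form_kernel_def)
  have sub: "tangent_below (Suc i) k \<subseteq> tangent_below i k" by (auto simp: tangent_below_def)
  show ?thesis
  proof (cases "i = 0")
    case True
    define X where "X e v = ((lu \<bullet> v) ^ (k - e) * (lw \<bullet> v) ^ e) *\<^sub>R a i" for e v
    have XT: "X e \<in> tangent_below i k" if "e \<in> {..k}" for e
    proof -
      have "(\<lambda>v. (lu \<bullet> v) ^ (k - e) * (lw \<bullet> v) ^ e) \<in> hom_funs (1 * (k - e) + 1 * e)"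
        by (intro hom_fun_mult hom_fun_power hom_fun_inner)
      then have "X e \<in> hom_fields k" using that unfolding X_def by (intro hom_field_const) simp
      then show ?thesis using True by (simp add: tangent_below_def)
    qed
    have indep: "\<forall>e\<in>{..k}. c e = 0" if "(\<Sum>e\<in>{..k}. (\<lambda>v. c e *\<^sub>R X e v)) \<in> tangent_below (Suc i) k" for c
    proof -
      have "(\<Sum>e\<le>k. c e * s ^ e) = 0" for s
      proof -
        have "a i \<bullet> (\<Sum>e\<in>{..k}. (\<lambda>v. c e *\<^sub>R X e v)) (u + s *\<^sub>R w) = 0"
          using that ev(3) by (simp add: tangent_below_def tangent_def)
        moreover have "a i \<bullet> (\<Sum>e\<in>{..k}. (\<lambda>v. c e *\<^sub>R X e v)) (u + s *\<^sub>R w) = (\<Sum>e\<le>k. c e * s ^ e) * (a i \<bullet> a i)"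
          by (simp add: sum_fun_apply inner_sum_right X_def ev sum_distrib_right sum_distrib_left mult_ac)
        ultimately have "(\<Sum>e\<le>k. c e * s ^ e) * (a i \<bullet> a i) = 0" by simp
        then show ?thesis using normal_neq_0[OF i] by (simp only: mult_eq_0_iff inner_eq_zero_iff) simp
      qed
      then show ?thesis using polyfun_eq_0[of c k] by simp
    qed
    have "vf.dim (tangent_below (Suc i) k) + card {..k} \<le> vf.dim (tangent_below i k)"
      by (rule vf.independent_modulo[OF tangent_below_fin tangent_below_fin sub _ XT indep]) auto
    then show ?thesis using True by (simp add: lines_def)
  next
    case False
    define t where "t j = - (a j \<bullet> u) / (a j \<bullet> w)" for j
    have at: "a j \<bullet> (u + s *\<^sub>R w) = (a j \<bullet> w) * (s - t j)" if "j < i" for j s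
      using w(3)[OF that] by (simp add: t_def inner_add_right field_simps)
    have line: "plane i \<inter> plane j = span {u + t j *\<^sub>R w}" if j: "j < i" for j
    proof -
      have "j < n" "i \<noteq> j" using j i by auto
      define c where "c = cross3 (a i) (a j)"
      have pl: "plane i \<inter> plane j = span {c}" using plane_Int_plane[OF i \<open>j < n\<close> \<open>i \<noteq> j\<close>] by (simp add: c_def)
      have "u + t j *\<^sub>R w \<in> plane i \<inter> plane j" using ev(3) at[OF j] by (simp add: form_kernel_def)
      then obtain g where g: "u + t j *\<^sub>R w = g *\<^sub>R c" unfolding pl span_singleton by blast
      have "g \<noteq> 0"
      proof
        assume "g = 0"
        then show False using g ev(1)[of "t j"] by simp
      qed
      then show ?thesis unfolding pl g by (rule span_scale_singleton[symmetric])
    qed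
    have inj_span: "\<tau> = \<tau>'" if "span {u + \<tau> *\<^sub>R w} = span {u + \<tau>' *\<^sub>R w}" for \<tau> \<tau>'
    proof -
      have "u + \<tau> *\<^sub>R w \<in> span {u + \<tau>' *\<^sub>R w}" using that span_base by blast
      then obtain g where g: "u + \<tau> *\<^sub>R w = g *\<^sub>R (u + \<tau>' *\<^sub>R w)" unfolding span_singleton by blast
      have "g = 1" using arg_cong[OF g, of "\<lambda>x. lu \<bullet> x"] ev by simp
      then show ?thesis using arg_cong[OF g, of "\<lambda>x. lw \<bullet> x"] ev by simp
    qed
    have "lines i {..<i} = (\<lambda>\<tau>. span {u + \<tau> *\<^sub>R w}) ` t ` {..<i}"
      unfolding lines_def image_image by (intro image_cong) (auto simp: line)
    moreover have "inj_on (\<lambda>\<tau>. span {u + \<tau> *\<^sub>R w}) (t ` {..<i})" using inj_span by (auto intro: inj_onI)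
    ultimately have card_lines: "card (lines i {..<i}) = card (t ` {..<i})" by (simp add: card_image)
    \<comment> \<open>One representative plane for each line.\<close>
    obtain J where J: "J \<subseteq> {..<i}" "inj_on t J" "t ` {..<i} = t ` J"
      using subset_image_inj[of "t ` {..<i}" t "{..<i}"] by auto
    have finJ: "finite J" using J(1) finite_subset by blast
    have cJ: "card J = card (lines i {..<i})" using card_lines J(2,3) by (simp add: card_image)
    have "J \<noteq> {}" using J(3) False by auto
    then obtain j0 where j0: "j0 \<in> J" by blast
    have "\<forall>j\<in>J. \<exists>d. a j \<bullet> d = 0 \<and> a i \<bullet> d \<noteq> 0"
    proof
      fix j assume "j \<in> J"
      then have "j < i" using J(1) by blast
      then show "\<exists>d. a j \<bullet> d = 0 \<and> a i \<bullet> d \<noteq> 0"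
        using plane_not_within[of j i] i by (auto simp: form_kernel_def)
    qed
    from bchoice[OF this] obtain d where d: "\<And>j. j \<in> J \<Longrightarrow> a j \<bullet> d j = 0 \<and> a i \<bullet> d j \<noteq> 0" by blast
    define N where "N = k + 1 - i"
    define I where "I = {j0} \<times> {..N} \<union> (J - {j0}) \<times> {0::nat}"
    have finI: "finite I" using finJ by (simp add: I_def)
    have cI: "card I = N + card J"
      using finJ j0 card_Diff_singleton[OF j0] card_gt_0_iff[of J]
      by (subst I_def, subst card_Un_disjoint) (auto simp: card_cartesian_product)
    have IJ: "j \<in> J" "e \<le> N" if "(j, e) \<in> I" for j e using that j0 by (auto simp: I_def)
    define X where "X = (\<lambda>(j, e) v. ((\<Prod>l\<in>{..<i} - {j}. a l \<bullet> v) * ((lu \<bullet> v) ^ (N - e) * (lw \<bullet> v) ^ e)) *\<^sub>R d j)"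
    have XT: "X p \<in> tangent_below i k" if pI: "p \<in> I" for p
    proof -
      obtain j e where p: "p = (j, e)" by (cases p)
      have je: "j \<in> J" "e \<le> N" using IJ pI p by auto
      then have ji: "j < i" using J(1) by auto
      have "(\<lambda>v. (\<Prod>l\<in>{..<i} - {j}. a l \<bullet> v) * ((lu \<bullet> v) ^ (N - e) * (lw \<bullet> v) ^ e))
          \<in> hom_funs (card ({..<i} - {j}) + (1 * (N - e) + 1 * e))"
        by (intro hom_fun_mult hom_fun_prod hom_fun_power hom_fun_inner) auto
      moreover have "card ({..<i} - {j}) + (1 * (N - e) + 1 * e) = k"
        using ji je k i by (simp add: N_def card_Diff_singleton)
      ultimately have "X p \<in> hom_fields k" unfolding X_def p by (auto intro: hom_field_const)
      moreover have "tangent l (X p)" if "l < i" for l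
      proof (cases "l = j")
        case True
        then show ?thesis using d[OF je(1)] by (simp add: tangent_def X_def p)
      next
        case False
        then have "(\<Prod>l\<in>{..<i} - {j}. a l \<bullet> v) = 0" if "a l \<bullet> v = 0" for v
          using that \<open>l < i\<close> by (intro prod_zero) auto
        then show ?thesis by (simp add: tangent_def X_def p)
      qed
      ultimately show ?thesis by (simp add: tangent_below_def)
    qed
    have indep: "\<forall>p\<in>I. c p = 0" if c: "(\<Sum>p\<in>I. (\<lambda>v. c p *\<^sub>R X p v)) \<in> tangent_below (Suc i) k" for c
    proof -
      define \<kappa> where "\<kappa> j = (a i \<bullet> d j) * (\<Prod>l\<in>{..<i} - {j}. a l \<bullet> w)" for j
      have \<kappa>: "\<kappa> j \<noteq> 0" if "j \<in> J" for j using d[OF that] w(3) by (auto simp: \<kappa>_def)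
      have rel: "(\<Sum>(j, e)\<in>I. c (j, e) * \<kappa> j * ((\<Prod>l\<in>{..<i} - {j}. s - t l) * s ^ e)) = 0" for s
      proof -
        have "a i \<bullet> (\<Sum>p\<in>I. (\<lambda>v. c p *\<^sub>R X p v)) (u + s *\<^sub>R w) = 0"
          using c ev(3) by (simp add: tangent_below_def tangent_def)
        moreover have "a i \<bullet> (\<Sum>p\<in>I. (\<lambda>v. c p *\<^sub>R X p v)) (u + s *\<^sub>R w)
           = (\<Sum>(j, e)\<in>I. c (j, e) * \<kappa> j * ((\<Prod>l\<in>{..<i} - {j}. s - t l) * s ^ e))"
          unfolding sum_fun_apply inner_sum_right
        proof (intro sum.cong refl, clarify)
          fix j e assume "(j, e) \<in> I"
          have "(\<Prod>l\<in>{..<i} - {j}. a l \<bullet> (u + s *\<^sub>R w)) = (\<Prod>l\<in>{..<i} - {j}. a l \<bullet> w) * (\<Prod>l\<in>{..<i} - {j}. s - t l)"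
            unfolding prod.distrib[symmetric] by (intro prod.cong) (auto simp: at)
          then show "a i \<bullet> (c (j, e) *\<^sub>R X (j, e) (u + s *\<^sub>R w))
             = c (j, e) * \<kappa> j * ((\<Prod>l\<in>{..<i} - {j}. s - t l) * s ^ e)"
            by (simp add: X_def ev \<kappa>_def)
        qed
        ultimately show ?thesis by simp
      qed
      \<comment> \<open>The factors common to all products cancel, leaving one factor per line.\<close>
      define Q where "Q j = (\<Prod>l\<in>J - {j}. [:- t l, 1:])" for j
      define P where "P = (\<Sum>(j, e)\<in>I. monom (c (j, e) * \<kappa> j) e * Q j)"
      have pP: "poly P s = (\<Sum>(j, e)\<in>I. c (j, e) * \<kappa> j * s ^ e * (\<Prod>l\<in>J - {j}. s - t l))" for s
        by (simp add: P_def Q_def poly_sum poly_monom poly_prod case_prod_beta)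
      have "P = 0"
      proof (rule ccontr)
        assume "P \<noteq> 0"
        then have fr: "finite {s. poly P s = 0}" by (rule poly_roots_finite)
        have "poly P s = 0" if s: "s \<notin> t ` {..<i}" for s
        proof -
          define F where "F = (\<Prod>l<i. s - t l)"
          define G where "G = (\<Prod>l\<in>J. s - t l)"
          have F0: "F \<noteq> 0" using s by (auto simp: F_def)
          have FG: "(\<Prod>l\<in>J - {j}. s - t l) * F = (\<Prod>l\<in>{..<i} - {j}. s - t l) * G" if "j \<in> J" for j
          proof -
            have "F = (s - t j) * (\<Prod>l\<in>{..<i} - {j}. s - t l)" unfolding F_def
              using that J(1) by (intro prod.remove) auto
            moreover have "G = (s - t j) * (\<Prod>l\<in>J - {j}. s - t l)" unfolding G_def
              using that finJ by (intro prod.remove) auto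
            ultimately show ?thesis by simp
          qed
          have "poly P s * F = (\<Sum>(j, e)\<in>I. c (j, e) * \<kappa> j * ((\<Prod>l\<in>{..<i} - {j}. s - t l) * s ^ e)) * G"
            unfolding pP sum_distrib_right
          proof (intro sum.cong refl, clarify)
            fix j e assume "(j, e) \<in> I"
            then have "j \<in> J" by (rule IJ)
            then show "c (j, e) * \<kappa> j * s ^ e * (\<Prod>l\<in>J - {j}. s - t l) * F
               = c (j, e) * \<kappa> j * ((\<Prod>l\<in>{..<i} - {j}. s - t l) * s ^ e) * G"
              using FG[of j] by (simp add: mult.assoc; simp add: mult.left_commute)
          qed
          then show ?thesis using rel[of s] F0 by simp
        qed
        then have "UNIV \<subseteq> {s. poly P s = 0} \<union> t ` {..<i}" by blast
        then have "finite (UNIV :: real set)" using fr finite_subset by blast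
        then show False using infinite_UNIV_char_0 by blast
      qed
      \<comment> \<open>At \<open>t j\<close> only the term of \<open>j\<close> survives.\<close>
      have c1: "c (j, 0) = 0" if j: "j \<in> J - {j0}" for j
      proof -
        have jI: "(j, 0) \<in> I" using j by (auto simp: I_def)
        have "0 = (\<Sum>(j', e)\<in>I. c (j', e) * \<kappa> j' * t j ^ e * (\<Prod>l\<in>J - {j'}. t j - t l))"
          using pP[of "t j"] \<open>P = 0\<close> by simp
        also have "\<dots> = (\<Sum>p\<in>I. if p = (j, 0) then c (j, 0) * \<kappa> j * (\<Prod>l\<in>J - {j}. t j - t l) else 0)"
        proof (intro sum.cong refl, clarify)
          fix j' e assume p: "(j', e) \<in> I"
          show "c (j', e) * \<kappa> j' * t j ^ e * (\<Prod>l\<in>J - {j'}. t j - t l)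
             = (if (j', e) = (j, 0) then c (j, 0) * \<kappa> j * (\<Prod>l\<in>J - {j}. t j - t l) else 0)"
          proof (cases "j' = j")
            case True
            then have "e = 0" using p j by (auto simp: I_def)
            then show ?thesis using True by simp
          next
            case False
            then have "(\<Prod>l\<in>J - {j'}. t j - t l) = 0" using j finJ by (intro prod_zero) auto
            then show ?thesis using False by simp
          qed
        qed
        also have "\<dots> = c (j, 0) * \<kappa> j * (\<Prod>l\<in>J - {j}. t j - t l)" using jI finI by simp
        finally have "c (j, 0) * \<kappa> j * (\<Prod>l\<in>J - {j}. t j - t l) = 0" by simp
        moreover have "(\<Prod>l\<in>J - {j}. t j - t l) \<noteq> 0"
          using finJ J(2) j by (auto simp: inj_on_def)
        ultimately show ?thesis using \<kappa>[of j] j by auto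
      qed
      have "P = (\<Sum>e\<le>N. monom (c (j0, e) * \<kappa> j0) e) * Q j0"
      proof -
        have "P = (\<Sum>(j, e)\<in>{j0} \<times> {..N}. monom (c (j, e) * \<kappa> j) e * Q j)"
          unfolding P_def using finI c1 by (intro sum.mono_neutral_right) (auto simp: I_def)
        also have "\<dots> = (\<Sum>e\<le>N. monom (c (j0, e) * \<kappa> j0) e * Q j0)"
          by (simp flip: sum.cartesian_product)
        finally show ?thesis by (simp add: sum_distrib_right)
      qed
      moreover have "Q j0 \<noteq> 0" unfolding Q_def using finJ by auto
      ultimately have "(\<Sum>e\<le>N. monom (c (j0, e) * \<kappa> j0) e) = 0" using \<open>P = 0\<close> by simp
      then have "coeff (\<Sum>e\<le>N. monom (c (j0, e) * \<kappa> j0) e) r = 0" for r by simp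
      moreover have "coeff (\<Sum>e\<le>N. monom (c (j0, e) * \<kappa> j0) e) r = c (j0, r) * \<kappa> j0" if "r \<le> N" for r
        using that by (simp add: coeff_sum)
      ultimately have "c (j0, e) * \<kappa> j0 = 0" if "e \<le> N" for e using that by metis
      then have "c (j0, e) = 0" if "e \<le> N" for e using that \<kappa>[OF j0] by auto
      then show ?thesis using c1 by (auto simp: I_def)
    qed
    have "vf.dim (tangent_below (Suc i) k) + card I \<le> vf.dim (tangent_below i k)"
      by (rule vf.independent_modulo[OF tangent_below_fin tangent_below_fin sub finI XT indep])
    then show ?thesis using cI cJ by (simp add: N_def)
  qed
qed

definition tangent_deg :: "nat \<Rightarrow> (real^3 \<Rightarrow> real^3) set" where "tangent_deg k = tangent_below n k"

lemma tangent_below_0: "tangent_below 0 k = hom_fields k" by (simp add: tangent_below_def)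

lemma dim_tangent_deg_lower: "3 * card (tri k) \<le> vf.dim (tangent_deg k) + n * (k + 1)"
proof -
  have "3 * card (tri k) \<le> vf.dim (tangent_below i k) + i * (k + 1)" if "i \<le> n" for i
    using that
  proof (induction i)
    case 0
    then show ?case by (simp add: tangent_below_0 dim_hom_fields)
  next
    case (Suc i)
    then show ?case using dim_tangent_below_upper_drop[of i k] by simp
  qed
  then show ?thesis by (simp add: tangent_deg_def)
qed

lemma dim_tangent_deg_upper:
  assumes "n \<le> k"
  shows "vf.dim (tangent_deg k) + (\<Sum>i<n. k + 1 - i) + earlier_lines \<le> 3 * card (tri k)"
proof -
  have "vf.dim (tangent_below i k) + (\<Sum>j<i. k + 1 - j + card (lines j {..<j})) \<le> 3 * card (tri k)" if "i \<le> n" for i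
    using that
  proof (induction i)
    case 0
    then show ?case by (simp add: tangent_below_0 dim_hom_fields)
  next
    case (Suc i)
    then show ?case using dim_tangent_below_lower_drop[of i k] assms by simp
  qed
  from this[of n] show ?thesis by (simp add: tangent_deg_def sum.distrib earlier_lines_def)
qed

end

section \<open>The Hilbert function of the module of tangent fields\<close>

text \<open>The third difference \<open>h\<close> of \<open>d\<close> would, for a free graded module, count the generators by degree. Here only
  \<open>h \<ge> 0\<close> is known. Summing three times writes \<open>2 d(k)\<close> through the moments \<open>H0, H1, H2\<close> of \<open>h\<close>.
  Comparison with the growth of the bounds for \<open>k \<rightarrow> \<infinity>\<close> forces \<open>H0 = 3\<close> and \<open>H1 = n\<close>, and bounds the second moment by
  \<open>H2 \<le> n\<^sup>2 - 2 C\<close>. On the other hand the sum of \<open>(2 j - (n - 1))\<^sup>2 h(j)\<close> is at least its term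
  \<open>(n - 3)\<^sup>2\<close> for \<open>j = 1\<close>; expanded in the moments, this is the claim.\<close>

lemma hilbert_bound:
  fixes d :: "int \<Rightarrow> int" and n C :: int
  assumes neg: "\<And>k. k < 0 \<Longrightarrow> d k = 0" and d0: "d 0 = 0" and d1: "1 \<le> d 1"
    and diff3: "\<And>k. 0 \<le> d k - 3 * d (k - 1) + 3 * d (k - 2) - d (k - 3)"
    and n: "0 \<le> n" and C: "0 \<le> C"
    and lower: "\<And>k. n \<le> k \<Longrightarrow> 3 * ((k + 1) * (k + 2)) \<le> 2 * d k + 2 * n * (k + 1)"
    and upper: "\<And>k. n \<le> k \<Longrightarrow> 2 * d k + 2 * n * (k + 1) - n * (n - 1) + 2 * C \<le> 3 * ((k + 1) * (k + 2))"
  shows "4 * (C - n + 1) \<le> (n - 1)\<^sup>2"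
proof -
  define h where "h k = d k - 3 * d (k - 1) + 3 * d (k - 2) - d (k - 3)" for k
  define H0 H1 H2 where "H0 J = (\<Sum>j\<le>J. h (int j))" and "H1 J = (\<Sum>j\<le>J. int j * h (int j))"
    and "H2 J = (\<Sum>j\<le>J. (int j)\<^sup>2 * h (int j))" for J :: nat
  have h: "0 \<le> h k" for k using diff3 by (simp add: h_def)
  have S: "H0 (Suc J) = H0 J + h (int J + 1)" "H1 (Suc J) = H1 J + (int J + 1) * h (int J + 1)"
    "H2 (Suc J) = H2 J + (int J + 1)\<^sup>2 * h (int J + 1)" for J
    by (simp_all add: H0_def H1_def H2_def add.commute)
  \<comment> \<open>Twice the Hilbert function of a free module whose generators are counted by \<open>h\<close> up to degree \<open>J\<close>.\<close>
  define P where "P J k = (k + 1) * (k + 2) * H0 J - (2 * k + 3) * H1 J + H2 J" for J k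
  have PS: "P (Suc J) k = P J k + h (int J + 1) * ((k - int J) * (k + 1 - int J))" for J k
    by (simp add: P_def S algebra_simps power2_eq_square)
  have ABD: "d (int k) - 2 * d (int k - 1) + d (int k - 2) = H0 k
     \<and> d (int k) - d (int k - 1) = (int k + 1) * H0 k - H1 k \<and> 2 * d (int k) = P k (int k)" for k
  proof (induction k)
    case 0
    then show ?case by (simp add: H0_def H1_def H2_def P_def h_def neg d0)
  next
    case (Suc k)
    have A: "d (int k + 1) - 2 * d (int k) + d (int k - 1) = H0 (Suc k)"
      using Suc by (simp add: S h_def algebra_simps)
    have B: "d (int k + 1) - d (int k) = (int k + 2) * H0 (Suc k) - H1 (Suc k)"
    proof -
      have "d (int k + 1) - d (int k) = (d (int k + 1) - 2 * d (int k) + d (int k - 1)) + (d (int k) - d (int k - 1))" by simp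
      also have "\<dots> = H0 (Suc k) + ((int k + 1) * H0 k - H1 k)" using A Suc by simp
      also have "\<dots> = (int k + 2) * H0 (Suc k) - H1 (Suc k)"
        unfolding S by (simp add: algebra_simps)
      finally show ?thesis .
    qed
    have "2 * d (int k + 1) = P k (int k) + 2 * ((int k + 2) * H0 (Suc k) - H1 (Suc k))"
      using B Suc by simp
    also have "\<dots> = P (Suc k) (int k + 1)"
      unfolding P_def S
      by (simp add: algebra_simps power2_eq_square)
    finally show ?case using A B by (simp add: algebra_simps)
  qed
  have H0mono: "H0 J \<le> H0 (J + i)" for J i
    by (induction i) (use h in \<open>auto simp: S intro: order_trans add_increasing2\<close>)
  have Pmono: "P J (int (J + i)) \<le> 2 * d (int (J + i))" for J i
  proof -
    have "P J (int (J + i)) \<le> P (J + r) (int (J + i))" if "r \<le> i" for r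
      using that
    proof (induction r)
      case (Suc r)
      have "0 \<le> h (int (J + r) + 1) * ((int (J + i) - int (J + r)) * (int (J + i) + 1 - int (J + r)))"
        using h Suc.prems by (intro mult_nonneg_nonneg) auto
      then show ?case using Suc PS[of "J + r" "int (J + i)"] by simp
    qed simp
    from this[of i] show ?thesis using ABD[of "J + i"] by simp
  qed
  have H1pos: "0 \<le> H1 J" and H2pos: "0 \<le> H2 J" for J
    unfolding H1_def H2_def using h by (auto intro!: sum_nonneg mult_nonneg_nonneg)
  have up: "2 * d k \<le> 3 * ((k + 1) * (k + 2)) + n * n" if "n \<le> k" for k
  proof -
    have "0 \<le> 2 * n * (k + 1)" using n that by simp
    moreover have "n * (n - 1) \<le> n * n" using n by (simp add: algebra_simps)
    ultimately show ?thesis using upper[OF that] C by linarith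
  qed
  \<comment> \<open>Otherwise the leading coefficient of \<open>d\<close> would be too large.\<close>
  have le3: "H0 J \<le> 3" for J
  proof (rule ccontr)
    assume "\<not> H0 J \<le> 3"
    then have H4: "4 \<le> H0 J" by simp
    define k where "k = int J + n + 2 * H1 J + n * n + 1"
    have k: "n \<le> k" "int J \<le> k" "2 * H1 J + n * n + 1 \<le> k + 1" "0 \<le> k"
      using n H1pos[of J] by (auto simp: k_def)
    have "P J k \<le> 2 * d k" using Pmono[of J "nat (k - int J)"] k(2) by simp
    moreover have "(k + 1) * (k + 2) * 4 \<le> (k + 1) * (k + 2) * H0 J"
      using H4 k(4) by (intro mult_left_mono) auto
    ultimately have "(k + 1) * (k + 2) \<le> (2 * k + 3) * H1 J + n * n"
      using up[OF k(1)] H2pos[of J] unfolding P_def by linarith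
    moreover have "(2 * H1 J + n * n + 1) * (k + 2) \<le> (k + 1) * (k + 2)"
      using k by (intro mult_right_mono) auto
    moreover have "(2 * k + 3) * H1 J \<le> 2 * H1 J * (k + 2)"
      using H1pos[of J] by (simp add: algebra_simps)
    moreover have "0 \<le> n * n * (k + 1)" using k(4) n by simp
    moreover have "(2 * H1 J + n * n + 1) * (k + 2) = 2 * H1 J * (k + 2) + n * n * (k + 1) + n * n + (k + 2)"
      by (simp add: algebra_simps)
    ultimately show False using k(4) by linarith
  qed
  obtain J where J: "\<And>K. H0 K \<le> H0 J"
  proof -
    have pos: "0 \<le> H0 K" for K unfolding H0_def using h by (intro sum_nonneg) auto
    have "finite (range H0)" by (rule finite_subset[of _ "{0..3}"]) (use le3 pos in auto)
    then have "Max (range H0) \<in> range H0" by (intro Max_in) auto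
    then obtain J where "H0 J = Max (range H0)" by auto
    then have "H0 K \<le> H0 J" for K using \<open>finite (range H0)\<close> by simp
    then show ?thesis using that by blast
  qed
  have h0: "h (int J + int i + 1) = 0" for i
    using H0mono[of J i] J[of "Suc (J + i)"] J[of "J + i"] h[of "int J + int i + 1"] by (simp add: S)
  have dP: "2 * d k = P J k" if "int J \<le> k" for k
  proof -
    have "P (J + r) k = P J k" for r
      by (induction r) (simp_all add: PS h0)
    from this[of "nat (k - int J)"] show ?thesis
      using ABD[of "nat k"] that by (simp add: nat_diff_distrib')
  qed
  have H3: "H0 J = 3"
  proof (rule ccontr)
    assume "H0 J \<noteq> 3"
    then have H2: "H0 J \<le> 2" using le3[of J] by simp
    define k where "k = int J + n + 2 * n + H2 J + 1"
    have k: "n \<le> k" "int J \<le> k" "2 * n + H2 J + 1 \<le> k + 2" "0 \<le> k"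
      using n H2pos[of J] by (auto simp: k_def)
    have "(k + 1) * (k + 2) * H0 J \<le> (k + 1) * (k + 2) * 2"
      using H2 k(4) by (intro mult_left_mono) auto
    moreover have "0 \<le> (2 * k + 3) * H1 J" using k(4) H1pos[of J] by simp
    ultimately have "(k + 1) * (k + 2) \<le> H2 J + 2 * n * (k + 1)"
      using lower[OF k(1)] dP[OF k(2)] unfolding P_def by linarith
    moreover have "(k + 1) * (2 * n + H2 J + 1) \<le> (k + 1) * (k + 2)"
      using k by (intro mult_left_mono) auto
    moreover have "H2 J * 1 \<le> H2 J * (k + 1)" using k(4) H2pos[of J] by (intro mult_left_mono) auto
    ultimately show False using k(4) by (simp add: algebra_simps)
  qed
  have H1le: "H1 J \<le> n"
  proof (rule ccontr)
    assume "\<not> H1 J \<le> n"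
    then have g: "n + 1 \<le> H1 J" by simp
    define k where "k = int J + n + H2 J"
    have k: "n \<le> k" "int J \<le> k" "H2 J \<le> k" "0 \<le> k"
      using n H2pos[of J] by (auto simp: k_def)
    have "(2 * k + 3) * H1 J \<le> H2 J + 2 * n * (k + 1)"
      using lower[OF k(1)] dP[OF k(2)] unfolding P_def H3 by linarith
    moreover have "(2 * k + 3) * (n + 1) \<le> (2 * k + 3) * H1 J"
      using g k(4) by (intro mult_left_mono) auto
    ultimately show False using k n by (simp add: algebra_simps)
  qed
  have H1ge: "n \<le> H1 J"
  proof (rule ccontr)
    assume "\<not> n \<le> H1 J"
    then have g: "H1 J \<le> n - 1" by simp
    define k where "k = int J + n + n * n"
    have k: "n \<le> k" "int J \<le> k" "n * n \<le> k" "0 \<le> k"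
      using n by (auto simp: k_def)
    have "2 * n * (k + 1) - n * (n - 1) + 2 * C + H2 J \<le> (2 * k + 3) * H1 J"
      using upper[OF k(1)] dP[OF k(2)] unfolding P_def H3 by linarith
    moreover have "(2 * k + 3) * H1 J \<le> (2 * k + 3) * (n - 1)"
      using g k(4) by (intro mult_left_mono) auto
    ultimately show False using k n C H2pos[of J] by (simp add: algebra_simps)
  qed
  have H1n: "H1 J = n" using H1le H1ge by simp
  have "H2 J \<le> n\<^sup>2 - 2 * C"
  proof -
    define k where "k = int J + n"
    have k: "n \<le> k" "int J \<le> k" using n by (auto simp: k_def)
    have "2 * n * (k + 1) - n * (n - 1) + 2 * C + H2 J \<le> (2 * k + 3) * n"
      using upper[OF k(1)] dP[OF k(2)] unfolding P_def H3 H1n by linarith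
    then show ?thesis by (simp add: algebra_simps power2_eq_square)
  qed
  moreover have "(n - 3)\<^sup>2 \<le> 4 * H2 J - 4 * (n - 1) * n + 3 * (n - 1)\<^sup>2"
  proof -
    have h1: "1 \<le> h 1" using d0 d1 neg by (simp add: h_def)
    have J1: "1 \<le> J"
    proof (rule ccontr)
      assume "\<not> 1 \<le> J"
      then have "J = 0" by simp
      then have "h 1 = 0" using h0[of 0] by simp
      then show False using h1 by simp
    qed
    have "(n - 3)\<^sup>2 \<le> (2 * int 1 - (n - 1))\<^sup>2 * h (int 1)"
    proof -
      have "(n - 3)\<^sup>2 * 1 \<le> (n - 3)\<^sup>2 * h 1" using h1 by (intro mult_left_mono) auto
      moreover have "2 * int 1 - (n - 1) = - (n - 3)" by simp
      then have "(2 * int 1 - (n - 1))\<^sup>2 = (n - 3)\<^sup>2" by (simp only: power2_minus)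
      ultimately show ?thesis by simp
    qed
    also have "\<dots> \<le> (\<Sum>j\<le>J. (2 * int j - (n - 1))\<^sup>2 * h (int j))"
      using J1 h by (intro member_le_sum) auto
    also have "\<dots> = (\<Sum>j\<le>J. 4 * ((int j)\<^sup>2 * h (int j)) - 4 * (n - 1) * (int j * h (int j)) + (n - 1)\<^sup>2 * h (int j))"
      by (intro sum.cong refl) (simp add: algebra_simps power2_eq_square)
    also have "\<dots> = 4 * H2 J - 4 * (n - 1) * H1 J + (n - 1)\<^sup>2 * H0 J"
      by (simp add: sum.distrib sum_subtractf H0_def H1_def H2_def sum_distrib_left)
    finally show ?thesis by (simp add: H1n H3)
  qed
  ultimately show ?thesis by (simp add: algebra_simps power2_eq_square)
qed

lemma poly_fun_mult_coord_eq_0: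
  assumes g: "g \<in> poly_funs" and 0: "\<And>v. v $ j * g v = 0"
  shows "g v = 0"
proof -
  obtain p where p: "g = peval p" using g by (auto simp: poly_funs_def)
  have "peval (linear_form (axis j 1) * p) v = 0" for v using 0[of v] by (simp add: p inner_axis')
  then have "linear_form (axis j 1) * p = 0" by (rule peval_eq_0)
  moreover have "linear_form (axis j 1) \<noteq> 0"
  proof
    assume "linear_form (axis j 1) = 0"
    then have "peval (linear_form (axis j 1)) (axis j 1) = 0" by simp
    then show False by (simp add: inner_axis_axis)
  qed
  ultimately show ?thesis by (simp add: p)
qed

definition coord_mult :: "3 \<Rightarrow> (real^3 \<Rightarrow> real^3) \<Rightarrow> real^3 \<Rightarrow> real^3" where
  "coord_mult j m = (\<lambda>v. v $ j *\<^sub>R m v)"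

lemma coord_mult_add: "coord_mult j (x + y) = coord_mult j x + coord_mult j y" by (simp add: coord_mult_def fun_eq_iff algebra_simps)
lemma coord_mult_scale: "coord_mult j (\<lambda>v. c *\<^sub>R x v) = (\<lambda>v. c *\<^sub>R coord_mult j x v)" by (simp add: coord_mult_def mult.commute)
lemma coord_mult_commute: "coord_mult i (coord_mult j x) = coord_mult j (coord_mult i x)" by (simp add: coord_mult_def mult.commute)

context plane_arrangement
begin

text \<open>Isomorphic to the module of logarithmic derivations through \<open>field_of\<close>.\<close>

definition tangent_fields :: "(real^3 \<Rightarrow> real^3) set" where
  "tangent_fields = {m. (\<forall>i. (\<lambda>v. m v $ i) \<in> poly_funs) \<and> (\<forall>j<n. tangent j m)}"

lemma tangent_deg_tangent_field: "m \<in> tangent_deg k \<Longrightarrow> m \<in> tangent_fields"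
  by (auto simp: tangent_deg_def tangent_below_def tangent_fields_def hom_fields_def intro: hom_fun_poly_fun)

lemma coord_mult_inj: "m \<in> tangent_fields \<Longrightarrow> coord_mult j m = 0 \<Longrightarrow> m = 0"
proof (rule ext)
  fix v assume m: "m \<in> tangent_fields" and 0: "coord_mult j m = 0"
  have "m v $ i = 0" for i
  proof (rule poly_fun_mult_coord_eq_0[of "\<lambda>v. m v $ i"])
    show "(\<lambda>v. m v $ i) \<in> poly_funs" using m by (simp add: tangent_fields_def)
    show "v $ j * m v $ i = 0" for v using fun_cong[OF 0, of v] by (auto simp: coord_mult_def vec_eq_iff)
  qed
  then show "m v = 0 v" by (simp add: vec_eq_iff)
qed

text \<open>Tangency to a plane through the origin is a homogeneous condition, so the homogeneous components of a tangent field
  are tangent.\<close>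

lemma tangent_field_decomp:
  assumes m: "m \<in> tangent_fields"
  shows "\<exists>N g. (\<forall>j. g j \<in> tangent_deg j) \<and> (\<forall>v. m v = (\<Sum>j\<le>N. g j v))"
proof -
  have "\<forall>i. \<exists>N g. (\<forall>j. g j \<in> hom_funs j) \<and> (\<forall>v. m v $ i = (\<Sum>j\<le>N. g j v))"
    using m poly_fun_decomp unfolding tangent_fields_def by blast
  then obtain N g where g: "\<And>i j. g i j \<in> hom_funs j" "\<And>i v. m v $ i = (\<Sum>j\<le>N i. g i j v)" by metis
  define K where "K = Max (range N)"
  have NK: "N i \<le> K" for i :: 3 by (simp add: K_def)
  define G where "G j v = (\<chi> i. if j \<le> N i then g i j v else 0)" for j v
  have GV: "G j \<in> hom_fields j" for j
  proof -
    have "(\<lambda>v. G j v $ i) = (if j \<le> N i then g i j else (\<lambda>v. 0))" for i by (auto simp: G_def)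
    then show ?thesis using g(1) hom_fun_0 by (simp add: hom_fields_def)
  qed
  have mG: "m v = (\<Sum>j\<le>K. G j v)" for v
  proof -
    have "m v $ i = (\<Sum>j\<le>K. G j v) $ i" for i
    proof -
      have "(\<Sum>j\<le>K. G j v) $ i = (\<Sum>j\<le>K. if j \<le> N i then g i j v else 0)" by (simp add: G_def)
      also have "\<dots> = (\<Sum>j\<le>N i. g i j v)"
        using NK[of i] by (subst sum.inter_filter[symmetric]) (auto intro!: sum.cong)
      finally show ?thesis by (simp add: g(2))
    qed
    then show ?thesis by (simp add: vec_eq_iff)
  qed
  define F where "F j = (if j \<le> K then G j else 0)" for j
  have "F j \<in> tangent_deg j" for j
  proof (cases "j \<le> K")
    case False
    then show ?thesis using tangent_below_subspace[of n j] vf.subspace_0 by (simp add: F_def tangent_deg_def)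
  next
    case True
    have "tangent l (G j)" if l: "l < n" for l
      unfolding tangent_def
    proof (intro allI impI)
      fix v assume v: "a l \<bullet> v = 0"
      have "a l \<bullet> m (t *\<^sub>R v) = 0" for t
        using m l v by (auto simp: tangent_fields_def tangent_def)
      then have "(\<Sum>j\<le>K. (a l \<bullet> G j v) * t ^ j) = 0 * t ^ j" for t
        by (simp add: mG inner_sum_right hom_field_scaleR[OF GV] mult.commute)
      then have "0 = (if j \<le> K then a l \<bullet> G j v else 0)" by (rule real_poly_coeffs_eq)
      then show "a l \<bullet> G j v = 0" using True by simp
    qed
    then show ?thesis using GV True by (simp add: F_def tangent_deg_def tangent_below_def)
  qed
  moreover have "m v = (\<Sum>j\<le>K. F j v)" for v unfolding mG by (intro sum.cong) (auto simp: F_def)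
  ultimately show ?thesis by blast
qed

text \<open>Continued by zero to negative degrees, so that differences make sense in all degrees.\<close>

definition graded :: "int \<Rightarrow> (real^3 \<Rightarrow> real^3) set" where
  "graded k = (if k < 0 then {0} else tangent_deg (nat k))"

lemma graded_subspace: "vf.subspace (graded k)"
  using tangent_below_subspace[of n "nat k"] by (simp add: graded_def tangent_deg_def)

lemma graded_fin: "vf.finite_dim (graded k)"
proof (rule vf.fin_subset[OF tangent_below_fin[of n "nat k"] graded_subspace])
  show "graded k \<subseteq> tangent_below n (nat k)" using tangent_below_subspace[of n "nat k"] vf.subspace_0 by (auto simp: graded_def tangent_deg_def)
qed

lemma graded_tangent_field: "m \<in> graded k \<Longrightarrow> m \<in> tangent_fields"
proof -
  assume "m \<in> graded k"
  then have "m \<in> tangent_deg (nat k)" using vf.subspace_0[OF tangent_below_subspace[of n "nat k"]] by (auto simp: graded_def tangent_deg_def split: if_splits)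
  then show ?thesis by (rule tangent_deg_tangent_field)
qed

lemma coord_mult_graded: "m \<in> graded (k - 1) \<Longrightarrow> coord_mult j m \<in> graded k"
proof -
  assume m: "m \<in> graded (k - 1)"
  show ?thesis
  proof (cases "k - 1 < 0")
    case True
    then have "m = 0" using m by (simp add: graded_def)
    then have "coord_mult j m = 0" by (simp add: coord_mult_def fun_eq_iff)
    then show ?thesis using graded_subspace vf.subspace_0 by metis
  next
    case False
    then have k: "nat k = 1 + nat (k - 1)" "\<not> k < 0" by auto
    have "m \<in> tangent_below n (nat (k - 1))" using m False by (simp add: graded_def tangent_deg_def)
    then have "coord_mult j m \<in> tangent_below n (nat k)"
      unfolding k(1) tangent_below_def coord_mult_def using hom_field_mult[OF hom_fun_coord] by (auto simp: tangent_def)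
    then show ?thesis using k by (simp add: graded_def tangent_deg_def)
  qed
qed

text \<open>A relation between a homogeneous field and arbitrary ones passes to the component of matching degree.\<close>

lemma graded_pick:
  assumes m: "m \<in> graded k" and p: "p \<in> tangent_fields" and q: "q \<in> tangent_fields" and eq: "m = coord_mult i p + coord_mult j q"
  shows "\<exists>p'\<in>graded (k - 1). \<exists>q'\<in>graded (k - 1). m = coord_mult i p' + coord_mult j q' \<and> (p = 0 \<longrightarrow> p' = 0)"
proof (cases "k < 0")
  case True
  then have "m = 0" using m by (simp add: graded_def)
  then have "m = coord_mult i 0 + coord_mult j 0" by (simp add: coord_mult_def fun_eq_iff)
  then show ?thesis using graded_subspace vf.subspace_0 by blast
next
  case False
  obtain N g where g: "\<And>j. g j \<in> tangent_deg j" "\<And>v. p v = (\<Sum>j\<le>N. g j v)" "p = 0 \<Longrightarrow> g = (\<lambda>_. 0)"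
  proof (cases "p = 0")
    case True
    have "(0 :: real^3 \<Rightarrow> real^3) \<in> tangent_deg j" for j unfolding tangent_deg_def using tangent_below_subspace vf.subspace_0 by blast
    then show ?thesis using that[of "\<lambda>_. 0" 0] True by simp
  next
    case False
    then show ?thesis using that tangent_field_decomp[OF p] by blast
  qed
  obtain N' g' where g': "\<And>j. g' j \<in> tangent_deg j" "\<And>v. q v = (\<Sum>j\<le>N'. g' j v)" using tangent_field_decomp[OF q] by blast
  define p' q' where "p' = (if 1 \<le> k \<and> nat (k - 1) \<le> N then g (nat (k - 1)) else 0)"
    and "q' = (if 1 \<le> k \<and> nat (k - 1) \<le> N' then g' (nat (k - 1)) else 0)"
  have in_graded: "p' \<in> graded (k - 1)" "q' \<in> graded (k - 1)"
    using g(1) g'(1) vf.subspace_0[OF graded_subspace[of "k - 1"]] unfolding p'_def q'_def by (auto simp: graded_def)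
  have mk: "m \<in> hom_fields (nat k)" using m False by (simp add: graded_def tangent_deg_def tangent_below_def)
  have hom_fields: "g j \<in> hom_fields j" "g' j \<in> hom_fields j" for j using g(1) g'(1) by (auto simp: tangent_deg_def tangent_below_def)
  have "m v = coord_mult i p' v + coord_mult j q' v" for v
  proof -
    have "m v $ l = coord_mult i p' v $ l + coord_mult j q' v $ l" for l
    proof -
      define c where "c r = (if 1 \<le> r \<and> r - 1 \<le> N then v $ i * g (r - 1) v $ l else 0)
         + (if 1 \<le> r \<and> r - 1 \<le> N' then v $ j * g' (r - 1) v $ l else 0)" for r
      have shift: "(\<Sum>r\<le>Suc (N + N'). (if 1 \<le> r \<and> r - 1 \<le> L then b (r - 1) else 0) * t ^ r)
           = t * (\<Sum>r\<le>L. b r * t ^ r)" if "L \<le> N + N'" for b and t :: real and L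
      proof -
        have "(\<Sum>r\<le>Suc (N + N'). (if 1 \<le> r \<and> r - 1 \<le> L then b (r - 1) else 0) * t ^ r)
           = (\<Sum>r\<le>N + N'. (if r \<le> L then b r else 0) * t ^ Suc r)"
          by (subst sum.atMost_Suc_shift) (simp cong: if_cong)
        also have "\<dots> = (\<Sum>r\<le>L. b r * t ^ Suc r)"
          using that by (intro sum.mono_neutral_cong_right) auto
        finally show ?thesis by (simp add: sum_distrib_left mult_ac)
      qed
      have "(\<Sum>r\<le>Suc (N + N'). c r * t ^ r) = m v $ l * t ^ nat k" for t
      proof -
        have "(\<Sum>r\<le>Suc (N + N'). c r * t ^ r)
           = t * (\<Sum>r\<le>N. v $ i * g r v $ l * t ^ r) + t * (\<Sum>r\<le>N'. v $ j * g' r v $ l * t ^ r)"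
          unfolding c_def distrib_right sum.distrib
          using shift[of N "\<lambda>r. v $ i * g r v $ l" t] shift[of N' "\<lambda>r. v $ j * g' r v $ l" t] by simp
        also have "\<dots> = (t *\<^sub>R v) $ i * p (t *\<^sub>R v) $ l + (t *\<^sub>R v) $ j * q (t *\<^sub>R v) $ l"
          by (simp add: g(2) g'(2) hom_field_scaleR[OF hom_fields(1)] hom_field_scaleR[OF hom_fields(2)] sum_distrib_left mult_ac)
        also have "\<dots> = m (t *\<^sub>R v) $ l" by (simp add: eq coord_mult_def)
        also have "\<dots> = m v $ l * t ^ nat k" using hom_field_scaleR[OF mk] by simp
        finally show ?thesis .
      qed
      then have e: "m v $ l = (if nat k \<le> Suc (N + N') then c (nat k) else 0)" by (rule real_poly_coeffs_eq)
      have n1: "nat k - 1 = nat (k - 1)" "1 \<le> nat k \<longleftrightarrow> 1 \<le> k" by auto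
      show ?thesis unfolding e c_def n1 p'_def q'_def coord_mult_def by auto
    qed
    then show ?thesis by (simp add: vec_eq_iff)
  qed
  then have "m = coord_mult i p' + coord_mult j q'" by (simp add: fun_eq_iff)
  moreover have "p = 0 \<longrightarrow> p' = 0" using g(3) by (simp add: p'_def)
  ultimately show ?thesis using in_graded by blast
qed

text \<open>The hypotheses say that \<open>z, y, x\<close> is a regular sequence on the module, given that multiplication by \<open>z\<close> is injective. Write \<open>N k\<close> for the part
  of degree \<open>k\<close> and \<open>W k = y N(k-1) + z N(k-1)\<close>. By the hypotheses
  \<open>y N(k-1) \<inter> z N(k-1) = y z N(k-2)\<close> and \<open>x N(k-1) \<inter> W k = x W(k-1)\<close>. The dimension formula then expresses
  \<open>dim (x N(k-1) + W k)\<close>, which is at most \<open>dim (N k)\<close>.\<close>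

lemma third_difference_nonneg:
  assumes K1: "\<And>x y. x \<in> tangent_fields \<Longrightarrow> y \<in> tangent_fields \<Longrightarrow> coord_mult 2 x = coord_mult 3 y \<Longrightarrow> \<exists>z\<in>tangent_fields. x = coord_mult 3 z"
    and K2: "\<And>m p q. m \<in> tangent_fields \<Longrightarrow> p \<in> tangent_fields \<Longrightarrow> q \<in> tangent_fields \<Longrightarrow> coord_mult 1 m = coord_mult 2 p + coord_mult 3 q \<Longrightarrow>
        \<exists>p'\<in>tangent_fields. \<exists>q'\<in>tangent_fields. m = coord_mult 2 p' + coord_mult 3 q'"
  shows "0 \<le> int (vf.dim (graded k)) - 3 * int (vf.dim (graded (k - 1))) + 3 * int (vf.dim (graded (k - 2))) - int (vf.dim (graded (k - 3)))"
proof -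
  have cmG: "vf.finite_dim (coord_mult j ` graded k)" "vf.dim (coord_mult j ` graded k) = vf.dim (graded k)" for j k
    by (rule vf.dim_injective_image[OF graded_fin coord_mult_add coord_mult_scale]; use coord_mult_inj graded_tangent_field in blast)+
  define W where "W k = {x + y | x y. x \<in> coord_mult 2 ` graded (k - 1) \<and> y \<in> coord_mult 3 ` graded (k - 1)}" for k
  have add: "x + y \<in> graded k" if "x \<in> graded k" "y \<in> graded k" for x y k using that graded_subspace vf.subspace_add by blast
  have W_sub: "W k \<subseteq> graded k" for k unfolding W_def using coord_mult_graded add by auto
  have finW: "vf.finite_dim (W k)" for k unfolding W_def by (rule vf.dim_sum_Int(1)[OF cmG(1) cmG(1)])
  have dimW: "vf.dim (W k) + vf.dim (graded (k - 2)) = 2 * vf.dim (graded (k - 1))" for k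
  proof -
    have "coord_mult 2 ` graded (k - 1) \<inter> coord_mult 3 ` graded (k - 1) = coord_mult 2 ` coord_mult 3 ` graded (k - 2)"
    proof (intro equalityI subsetI)
      fix m assume "m \<in> coord_mult 2 ` graded (k - 1) \<inter> coord_mult 3 ` graded (k - 1)"
      then obtain x y where xy: "x \<in> graded (k - 1)" "y \<in> graded (k - 1)" "m = coord_mult 2 x" "coord_mult 2 x = coord_mult 3 y" by auto
      then obtain z where z: "z \<in> tangent_fields" "x = coord_mult 3 z" using K1 graded_tangent_field by blast
      have z0: "(0 :: real^3 \<Rightarrow> real^3) \<in> tangent_fields" using graded_tangent_field[of 0 0] graded_subspace vf.subspace_0 by blast
      have c0: "coord_mult 1 0 = 0" by (simp add: coord_mult_def fun_eq_iff)
      then obtain p' q' where pq: "p' = 0" "q' \<in> graded (k - 1 - 1)" "x = coord_mult 1 p' + coord_mult 3 q'"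
        using graded_pick[OF xy(1) z0 z(1), of 1 3] z(2) by auto
      have "k - 1 - 1 = k - 2" by simp
      then have "q' \<in> graded (k - 2)" "x = coord_mult 3 q'" using pq c0 by auto
      then show "m \<in> coord_mult 2 ` coord_mult 3 ` graded (k - 2)" using xy(3) by blast
    next
      fix m assume "m \<in> coord_mult 2 ` coord_mult 3 ` graded (k - 2)"
      then obtain z where z: "z \<in> graded (k - 1 - 1)" "m = coord_mult 2 (coord_mult 3 z)" by auto
      then have "coord_mult 3 z \<in> graded (k - 1)" "coord_mult 2 z \<in> graded (k - 1)" using coord_mult_graded by blast+
      then show "m \<in> coord_mult 2 ` graded (k - 1) \<inter> coord_mult 3 ` graded (k - 1)" using z(2) coord_mult_commute[of 2 3 z] by (metis IntI imageI)
    qed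
    moreover have "vf.dim (coord_mult 2 ` coord_mult 3 ` graded (k - 2)) = vf.dim (graded (k - 2))"
    proof -
      have "coord_mult 3 ` graded (k - 2) \<subseteq> tangent_fields" using coord_mult_graded[of _ "k - 1" 3] graded_tangent_field by (fastforce simp: diff_diff_eq)
      then have "vf.dim (coord_mult 2 ` coord_mult 3 ` graded (k - 2)) = vf.dim (coord_mult 3 ` graded (k - 2))"
        by (intro vf.dim_injective_image(2)[OF cmG(1) coord_mult_add coord_mult_scale]) (use coord_mult_inj in blast)
      then show ?thesis by (simp add: cmG)
    qed
    ultimately show ?thesis
      using vf.dim_sum_Int(2)[OF cmG(1)[of 2 "k - 1"] cmG(1)[of 3 "k - 1"]] by (simp add: W_def cmG)
  qed
  have "coord_mult 1 ` graded (k - 1) \<inter> W k = coord_mult 1 ` W (k - 1)"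
  proof (intro equalityI subsetI)
    fix m assume "m \<in> coord_mult 1 ` graded (k - 1) \<inter> W k"
    then obtain x p q where x: "x \<in> graded (k - 1)" "m = coord_mult 1 x" "p \<in> graded (k - 1)" "q \<in> graded (k - 1)" "coord_mult 1 x = coord_mult 2 p + coord_mult 3 q"
      by (auto simp: W_def)
    then obtain p' q' where pq: "p' \<in> tangent_fields" "q' \<in> tangent_fields" "x = coord_mult 2 p' + coord_mult 3 q'" using K2 graded_tangent_field by metis
    then have "x \<in> W (k - 1)" using graded_pick[OF x(1) pq] unfolding W_def by blast
    then show "m \<in> coord_mult 1 ` W (k - 1)" using x(2) by blast
  next
    fix m assume "m \<in> coord_mult 1 ` W (k - 1)"
    then obtain p q where pq: "p \<in> graded (k - 1 - 1)" "q \<in> graded (k - 1 - 1)" "m = coord_mult 1 (coord_mult 2 p + coord_mult 3 q)"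
      by (auto simp: W_def)
    have "coord_mult 2 p + coord_mult 3 q \<in> graded (k - 1)" using pq coord_mult_graded add by blast
    moreover have "m = coord_mult 2 (coord_mult 1 p) + coord_mult 3 (coord_mult 1 q)" using pq(3) by (simp add: coord_mult_add coord_mult_commute)
    moreover have "coord_mult 1 p \<in> graded (k - 1)" "coord_mult 1 q \<in> graded (k - 1)" using pq coord_mult_graded by blast+
    ultimately show "m \<in> coord_mult 1 ` graded (k - 1) \<inter> W k" using pq(3) unfolding W_def by blast
  qed
  moreover have "vf.dim (coord_mult 1 ` W (k - 1)) = vf.dim (W (k - 1))"
    by (rule vf.dim_injective_image(2)[OF finW coord_mult_add coord_mult_scale]) (use coord_mult_inj graded_tangent_field W_sub in blast)
  ultimately have "vf.dim {x + y | x y. x \<in> coord_mult 1 ` graded (k - 1) \<and> y \<in> W k} + vf.dim (W (k - 1)) = vf.dim (graded (k - 1)) + vf.dim (W k)"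
    using vf.dim_sum_Int(2)[OF cmG(1)[of 1 "k - 1"] finW[of k]] by (simp add: cmG)
  moreover have "vf.dim {x + y | x y. x \<in> coord_mult 1 ` graded (k - 1) \<and> y \<in> W k} \<le> vf.dim (graded k)"
  proof (rule vf.fin_dim_mono[OF graded_fin])
    show "vf.subspace {x + y | x y. x \<in> coord_mult 1 ` graded (k - 1) \<and> y \<in> W k}"
      by (rule vf.fin_subspace[OF vf.dim_sum_Int(1)[OF cmG(1) finW]])
    show "{x + y | x y. x \<in> coord_mult 1 ` graded (k - 1) \<and> y \<in> W k} \<subseteq> graded k" using coord_mult_graded add W_sub by blast
  qed
  ultimately show ?thesis using dimW[of k] dimW[of "k - 1"] by (simp add: diff_diff_eq)
qed

lemma dim_graded_0: "vf.dim (graded 0) = 0"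
proof -
  have "graded 0 \<subseteq> {0}"
  proof
    fix m assume m: "m \<in> graded 0"
    then have mT: "m \<in> tangent_below n 0" by (simp add: graded_def tangent_deg_def)
    have const: "m v = m 0" for v
    proof -
      have "m (0 *\<^sub>R v) = 0 ^ 0 *\<^sub>R m v" using mT by (intro hom_field_scaleR) (auto simp: tangent_below_def)
      then show ?thesis by simp
    qed
    have "a i \<bullet> m 0 = 0" if "i < n" for i
    proof -
      have "a i \<bullet> (0 :: real^3) = 0" by simp
      then show ?thesis using mT that unfolding tangent_below_def tangent_def by blast
    qed
    then have "m 0 = 0" by (rule essential)
    then have "m = 0" using const by (simp add: fun_eq_iff)
    then show "m \<in> {0}" by simp
  qed
  then have "graded 0 \<subseteq> vf.span {}" by simp
  from vf.dim_le_card[OF this] show ?thesis by simp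
qed

text \<open>The Euler field \<open>v \<mapsto> v\<close> is tangent to all planes.\<close>

lemma dim_graded_1: "1 \<le> vf.dim (graded 1)"
proof -
  define e :: "real^3 \<Rightarrow> real^3" where "e = (\<lambda>v. v)"
  have "e \<in> graded 1" by (simp add: graded_def tangent_deg_def tangent_below_def tangent_def hom_fields_def hom_fun_coord[unfolded One_nat_def] e_def)
  moreover have "e \<noteq> 0"
  proof
    assume "e = 0"
    then have "e (axis 1 1) = 0" by simp
    then show False by (simp add: e_def)
  qed
  then have "vf.independent {e}" by (simp add: vf.dependent_single)
  ultimately have "card {e} \<le> vf.dim (graded 1)" by (intro vf.independent_card_le(2)[OF graded_fin]) auto
  then show ?thesis by simp
qed

theorem koszul_imp_discriminant:
  assumes "\<And>x y. x \<in> tangent_fields \<Longrightarrow> y \<in> tangent_fields \<Longrightarrow> coord_mult 2 x = coord_mult 3 y \<Longrightarrow> \<exists>z\<in>tangent_fields. x = coord_mult 3 z"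
    and "\<And>m p q. m \<in> tangent_fields \<Longrightarrow> p \<in> tangent_fields \<Longrightarrow> q \<in> tangent_fields \<Longrightarrow> coord_mult 1 m = coord_mult 2 p + coord_mult 3 q \<Longrightarrow>
        \<exists>p'\<in>tangent_fields. \<exists>q'\<in>tangent_fields. m = coord_mult 2 p' + coord_mult 3 q'"
  shows "4 * (int earlier_lines - int n + 1) \<le> (int n - 1)\<^sup>2"
proof (rule hilbert_bound[where d = "\<lambda>k. int (vf.dim (graded k))"])
  show "int (vf.dim (graded k)) = 0" if "k < 0" for k
  proof -
    have "graded k \<subseteq> vf.span {}" using that by (simp add: graded_def)
    from vf.dim_le_card[OF this] show ?thesis by simp
  qed
  show "0 \<le> int (vf.dim (graded k)) - 3 * int (vf.dim (graded (k - 1))) + 3 * int (vf.dim (graded (k - 2))) - int (vf.dim (graded (k - 3)))" for k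
    by (rule third_difference_nonneg[OF assms])
  fix k :: int assume k: "int n \<le> k"
  define l where "l = nat k"
  have l: "k = int l" "n \<le> l" using k by (auto simp: l_def)
  have graded: "graded k = tangent_deg l" using l by (simp add: graded_def)
  have tri: "2 * int (card (tri l)) = (k + 1) * (k + 2)"
    using arg_cong[OF card_tri[of l], of int] l by (simp add: algebra_simps)
  have "int (3 * card (tri l)) \<le> int (vf.dim (tangent_deg l) + n * (l + 1))"
    using dim_tangent_deg_lower[of l] by (simp only: of_nat_le_iff)
  then have "3 * int (card (tri l)) \<le> int (vf.dim (tangent_deg l)) + int n * (k + 1)"
    by (simp add: l(1) algebra_simps)
  then show "3 * ((k + 1) * (k + 2)) \<le> 2 * int (vf.dim (graded k)) + 2 * int n * (k + 1)"
    using tri unfolding graded by linarith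
  have gauss: "2 * int (\<Sum>i<r. l + 1 - i) = 2 * int r * (k + 1) - int r * (int r - 1)" if "r \<le> l" for r
    using that by (induction r) (simp_all add: l(1) of_nat_diff algebra_simps)
  have "int (vf.dim (tangent_deg l)) + int (\<Sum>i<n. l + 1 - i) + int earlier_lines \<le> 3 * int (card (tri l))"
    using dim_tangent_deg_upper[OF l(2)] by linarith
  then show "2 * int (vf.dim (graded k)) + 2 * int n * (k + 1) - int n * (int n - 1) + 2 * int earlier_lines \<le> 3 * ((k + 1) * (k + 2))"
    using tri gauss[OF l(2)] unfolding graded by linarith
qed (use dim_graded_0 dim_graded_1 in auto)

end

section \<open>Logarithmic derivations and freeness\<close>

lemma map_poly_derivation:
  fixes d :: "'a::comm_ring_1 \<Rightarrow> 'a"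
  assumes add: "\<And>a b. d (a + b) = d a + d b" and mult: "\<And>a b. d (a * b) = a * d b + b * d a"
  shows "map_poly d (f + g) = map_poly d f + map_poly d g"
    and "map_poly d (f * g) = f * map_poly d g + g * map_poly d f"
proof -
  have d0: "d 0 = 0" using add[of 0 0] by simp
  have dsum: "d (\<Sum>i\<in>S. h i) = (\<Sum>i\<in>S. d (h i))" for S :: "nat set" and h
    by (induction S rule: infinite_finite_induct) (auto simp: d0 add)
  show "map_poly d (f + g) = map_poly d f + map_poly d g"
    by (rule poly_eqI) (simp add: coeff_map_poly d0 add)
  show "map_poly d (f * g) = f * map_poly d g + g * map_poly d f"
  proof (rule poly_eqI)
    fix m
    have "coeff (map_poly d (f * g)) m
       = (\<Sum>i\<le>m. coeff f i * d (coeff g (m - i))) + (\<Sum>i\<le>m. d (coeff f i) * coeff g (m - i))"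
      by (simp add: coeff_map_poly d0 coeff_mult dsum mult sum.distrib mult.commute)
    also have "\<dots> = coeff (f * map_poly d g) m + coeff (map_poly d f * g) m"
      by (simp add: coeff_mult coeff_map_poly d0)
    finally show "coeff (map_poly d (f * g)) m = coeff (f * map_poly d g + g * map_poly d f) m"
      by (simp add: mult.commute)
  qed
qed

definition dz :: "poly3 \<Rightarrow> poly3" where "dz = pderiv"
definition dy :: "poly3 \<Rightarrow> poly3" where "dy = map_poly pderiv"
definition dx :: "poly3 \<Rightarrow> poly3" where "dx = map_poly (map_poly pderiv)"

lemma partial_derivations:
  assumes "D \<in> {dx, dy, dz}"
  shows "D (f + g) = D f + D g" "D (f * g) = f * D g + g * D f"
proof -
  have pd: "pderiv (p + q) = pderiv p + pderiv q" "pderiv (p * q) = p * pderiv q + q * pderiv p"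
    for p q :: "'b::idom poly"
    by (simp_all add: pderiv_add pderiv_mult)
  note m1 = map_poly_derivation[where d = "pderiv :: real poly \<Rightarrow> _", OF pd]
  note m1' = map_poly_derivation[where d = "pderiv :: real poly poly \<Rightarrow> _", OF pd]
  note m2 = map_poly_derivation[where d = "map_poly (pderiv :: real poly \<Rightarrow> _)", OF m1]
  show "D (f + g) = D f + D g" "D (f * g) = f * D g + g * D f"
    using assms m1' m2 pd by (auto simp: dx_def dy_def dz_def)
qed

lemma partial_values:
  "dx Xvar = 1" "dx Yvar = 0" "dx Zvar = 0" "dx (Const c) = 0"
  "dy Xvar = 0" "dy Yvar = 1" "dy Zvar = 0" "dy (Const c) = 0"
  "dz Xvar = 0" "dz Yvar = 0" "dz Zvar = 1" "dz (Const c) = 0"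
  by (simp_all add: dx_def dy_def dz_def Xvar_def Yvar_def Zvar_def Const_def map_poly_pCons pderiv_pCons one_pCons)

lemma derivation_sum_of_partials:
  "(\<lambda>f. p * dx f + q * dy f + r * dz f) \<in> derivations"
  unfolding derivations_def
  by (simp add: partial_derivations partial_values algebra_simps)

lemma derivationsD:
  assumes "\<delta> \<in> derivations"
  shows "\<delta> (f + g) = \<delta> f + \<delta> g" "\<delta> (Const c * f) = Const c * \<delta> f" "\<delta> (f * g) = f * \<delta> g + g * \<delta> f"
  using assms unfolding derivations_def by blast+

text \<open>The three cases follow the tower \<open>\<real>[x][y][z]\<close>, by induction on the polynomials of each level.\<close>

lemma derivation_0:
  assumes \<delta>: "\<delta> \<in> derivations" and 0: "\<delta> Xvar = 0" "\<delta> Yvar = 0" "\<delta> Zvar = 0"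
  shows "\<delta> f = 0"
proof -
  have add: "\<delta> (f + g) = \<delta> f + \<delta> g" and sc: "\<delta> (Const c * f) = Const c * \<delta> f"
    and mult: "\<delta> (f * g) = f * \<delta> g + g * \<delta> f" for f g c using derivationsD[OF \<delta>] by blast+
  have "\<delta> 1 = 0" using mult[of 1 1] by simp
  then have C: "\<delta> (Const c) = 0" for c using sc[of c 1] by simp
  have r: "\<delta> [:[:r:]:] = 0" for r
  proof (induction r)
    case 0
    then show ?case using C[of 0] by (simp add: Const_def)
  next
    case (pCons c r)
    have "[:[:pCons c r:]:] = Const c + Xvar * [:[:r:]:]" by (simp add: Const_def Xvar_def)
    then show ?case by (simp only: add mult C 0 pCons; simp)
  qed
  have q: "\<delta> [:q:] = 0" for q
  proof (induction q)
    case 0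
    then show ?case using C[of 0] by (simp add: Const_def)
  next
    case (pCons r q)
    have "[:pCons r q:] = [:[:r:]:] + Yvar * [:q:]" by (simp add: Yvar_def)
    then show ?case by (simp only: add mult r 0 pCons; simp)
  qed
  show ?thesis
  proof (induction f)
    case 0
    then show ?case using C[of 0] by (simp add: Const_def)
  next
    case (pCons q f)
    have "pCons q f = [:q:] + Zvar * f" by (simp add: Zvar_def)
    then show ?case by (simp only: add mult q 0 pCons; simp)
  qed
qed

lemma regular_sequence_2:
  assumes "Yvar * r = Zvar * p" shows "\<exists>s. r = Zvar * s"
proof -
  have "coeff (Yvar * r) 0 = coeff (Zvar * p) 0" using assms by simp
  then have "coeff r 0 = 0" by (simp add: Yvar_def Zvar_def coeff_mult)
  then obtain s where "r = pCons 0 s" by (cases r) auto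
  then show ?thesis by (intro exI[of _ s]) (simp add: Zvar_def)
qed

lemma regular_sequence_3:
  assumes "Xvar * r = Yvar * p + Zvar * q" shows "\<exists>s t. r = Yvar * s + Zvar * t"
proof -
  obtain r0 r1 where r: "r = pCons r0 r1" by (cases r)
  obtain r00 r01 where r0: "r0 = pCons r00 r01" by (cases r0)
  have "coeff (coeff (Xvar * r) 0) 0 = coeff (coeff (Yvar * p + Zvar * q) 0) 0" using assms by simp
  then have "[:0, 1:] * r00 = 0" by (simp add: Xvar_def Yvar_def Zvar_def coeff_mult r r0)
  then have "r00 = 0" by simp
  then have "r = Yvar * [:r01:] + Zvar * r1" by (simp add: r r0 Yvar_def Zvar_def flip: one_pCons)
  then show ?thesis by blast
qed

interpretation dm: Modules.module der_scale by (rule module_der_scale)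

text \<open>Both statements on regular sequences hold in the polynomial ring, and coordinates with respect to a basis carry them over
  to a free module.\<close>

lemma free_koszul_2:
  assumes B: "\<not> dm.dependent B" and \<theta>: "\<theta> \<in> dm.span B" "\<theta>1 \<in> dm.span B"
    and eq: "der_scale Yvar \<theta> = der_scale Zvar \<theta>1"
  shows "\<exists>\<theta>'\<in>dm.span B. \<theta> = der_scale Zvar \<theta>'"
proof -
  define r where "r = dm.representation B"
  have "Yvar * r \<theta> b = Zvar * r \<theta>1 b" for b
    using arg_cong[OF eq, of "\<lambda>t. r t b"] dm.representation_scale[OF B] \<theta> by (simp add: r_def)
  then have "\<exists>s. r \<theta> b = Zvar * s" for b by (rule regular_sequence_2)
  then obtain s where s: "\<And>b. r \<theta> b = Zvar * s b" by metis
  let ?S = "{b. r \<theta> b \<noteq> 0}"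
  have S: "?S \<subseteq> B" unfolding r_def using dm.representation_ne_zero by blast
  have "\<theta> = (\<Sum>b\<in>?S. der_scale (r \<theta> b) b)"
    unfolding r_def by (rule dm.sum_nonzero_representation_eq[OF B \<theta>(1), symmetric])
  also have "\<dots> = der_scale Zvar (\<Sum>b\<in>?S. der_scale (s b) b)"
    by (simp add: dm.scale_sum_right s)
  finally have "\<theta> = der_scale Zvar (\<Sum>b\<in>?S. der_scale (s b) b)" .
  moreover have "(\<Sum>b\<in>?S. der_scale (s b) b) \<in> dm.span B"
    using S by (intro dm.span_sum dm.span_scale dm.span_base) auto
  ultimately show ?thesis by blast
qed

lemma free_koszul_3:
  assumes B: "\<not> dm.dependent B" and \<theta>: "\<theta> \<in> dm.span B" "\<theta>1 \<in> dm.span B" "\<theta>2 \<in> dm.span B"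
    and eq: "der_scale Xvar \<theta> = der_scale Yvar \<theta>1 + der_scale Zvar \<theta>2"
  shows "\<exists>\<theta>'\<in>dm.span B. \<exists>\<theta>''\<in>dm.span B. \<theta> = der_scale Yvar \<theta>' + der_scale Zvar \<theta>''"
proof -
  define r where "r = dm.representation B"
  have "Xvar * r \<theta> b = Yvar * r \<theta>1 b + Zvar * r \<theta>2 b" for b
    using arg_cong[OF eq, of "\<lambda>t. r t b"] dm.representation_scale[OF B] dm.representation_add[OF B] \<theta>
    by (simp add: r_def dm.span_scale)
  then have "\<exists>s t. r \<theta> b = Yvar * s + Zvar * t" for b by (rule regular_sequence_3)
  then obtain s t where st: "\<And>b. r \<theta> b = Yvar * s b + Zvar * t b" by metis
  let ?S = "{b. r \<theta> b \<noteq> 0}"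
  have S: "?S \<subseteq> B" unfolding r_def using dm.representation_ne_zero by blast
  have "\<theta> = (\<Sum>b\<in>?S. der_scale (r \<theta> b) b)"
    unfolding r_def by (rule dm.sum_nonzero_representation_eq[OF B \<theta>(1), symmetric])
  also have "\<dots> = der_scale Yvar (\<Sum>b\<in>?S. der_scale (s b) b) + der_scale Zvar (\<Sum>b\<in>?S. der_scale (t b) b)"
    by (simp add: dm.scale_sum_right st dm.scale_left_distrib sum.distrib)
  finally have "\<theta> = \<dots>" .
  moreover have "(\<Sum>b\<in>?S. der_scale (c b) b) \<in> dm.span B" for c
    using S by (intro dm.span_sum dm.span_scale dm.span_base) auto
  ultimately show ?thesis by blast
qed

definition field_of :: "(poly3 \<Rightarrow> poly3) \<Rightarrow> real^3 \<Rightarrow> real^3" where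
  "field_of \<theta> v = vector [peval (\<theta> Xvar) v, peval (\<theta> Yvar) v, peval (\<theta> Zvar) v]"

lemma field_of_nth: "field_of \<theta> v $ 1 = peval (\<theta> Xvar) v" "field_of \<theta> v $ 2 = peval (\<theta> Yvar) v" "field_of \<theta> v $ 3 = peval (\<theta> Zvar) v"
  by (simp_all add: field_of_def)

lemma field_of_scale_add:
  "field_of (der_scale f \<theta>) v = peval f v *\<^sub>R field_of \<theta> v" "field_of (\<theta> + \<theta>') = field_of \<theta> + field_of \<theta>'"
  by (simp_all add: vec_eq_iff forall_3 field_of_nth der_scale_def fun_eq_iff)

lemma coord_mult_field_of: "coord_mult 1 (field_of \<theta>) = field_of (der_scale Xvar \<theta>)" "coord_mult 2 (field_of \<theta>) = field_of (der_scale Yvar \<theta>)"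
  "coord_mult 3 (field_of \<theta>) = field_of (der_scale Zvar \<theta>)"
  by (simp_all add: fun_eq_iff coord_mult_def field_of_scale_add)

lemma field_of_inj:
  assumes "\<theta> \<in> derivations" "\<theta>' \<in> derivations" "field_of \<theta> = field_of \<theta>'"
  shows "\<theta> = \<theta>'"
proof -
  have d: "\<theta> - \<theta>' \<in> derivations"
    unfolding derivations_def mem_Collect_eq fun_diff_def
  proof (intro conjI allI)
    fix f g c
    show "\<theta> (f + g) - \<theta>' (f + g) = \<theta> f - \<theta>' f + (\<theta> g - \<theta>' g)"
      by (simp add: derivationsD(1)[OF assms(1)] derivationsD(1)[OF assms(2)])
    show "\<theta> (Const c * f) - \<theta>' (Const c * f) = Const c * (\<theta> f - \<theta>' f)"
      by (simp only: derivationsD(2)[OF assms(1)] derivationsD(2)[OF assms(2)] right_diff_distrib)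
    show "\<theta> (f * g) - \<theta>' (f * g) = f * (\<theta> g - \<theta>' g) + g * (\<theta> f - \<theta>' f)"
      unfolding derivationsD(3)[OF assms(1)] derivationsD(3)[OF assms(2)] by (simp add: algebra_simps)
  qed
  have "peval (\<theta> Xvar) v = peval (\<theta>' Xvar) v" "peval (\<theta> Yvar) v = peval (\<theta>' Yvar) v"
    "peval (\<theta> Zvar) v = peval (\<theta>' Zvar) v" for v
    using field_of_nth[of \<theta> v] field_of_nth[of \<theta>' v] assms(3) by simp_all
  then have "peval (\<theta> Xvar) = peval (\<theta>' Xvar)" "peval (\<theta> Yvar) = peval (\<theta>' Yvar)"
    "peval (\<theta> Zvar) = peval (\<theta>' Zvar)" by (simp_all add: fun_eq_iff)
  then have e: "\<theta> Xvar = \<theta>' Xvar" "\<theta> Yvar = \<theta>' Yvar" "\<theta> Zvar = \<theta>' Zvar"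
    by (blast intro: peval_inj)+
  have "(\<theta> - \<theta>') f = 0" for f
    by (rule derivation_0[OF d]) (simp_all only: e fun_diff_def diff_self)
  then show ?thesis by (simp add: fun_eq_iff)
qed

lemma derivation_linear_form:
  assumes "\<theta> \<in> derivations"
  shows "peval (\<theta> (linear_form u)) v = u \<bullet> field_of \<theta> v"
  unfolding linear_form_def derivationsD(1,2)[OF assms] by (simp add: inner_vec_def sum_3 field_of_nth)

context plane_arrangement
begin

lemma field_of_log_derivation:
  assumes "\<theta> \<in> log_derivations arr" shows "field_of \<theta> \<in> tangent_fields"
proof -
  have \<theta>: "\<theta> \<in> derivations" using assms by (simp add: log_derivations_def)
  have "(\<lambda>v. field_of \<theta> v $ 1) \<in> poly_funs" "(\<lambda>v. field_of \<theta> v $ 2) \<in> poly_funs" "(\<lambda>v. field_of \<theta> v $ 3) \<in> poly_funs"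
    by (simp_all add: field_of_nth poly_funs_def)
  then have "(\<lambda>v. field_of \<theta> v $ i) \<in> poly_funs" for i by (metis exhaust_3)
  moreover have "tangent j (field_of \<theta>)" if j: "j < n" for j
    unfolding tangent_def
  proof (intro allI impI)
    fix v assume v: "a j \<bullet> v = 0"
    have "linear_form (a j) dvd \<theta> (linear_form (a j))"
      using assms normal_neq_0[OF j] j by (simp add: log_derivations_def)
    then obtain q where "\<theta> (linear_form (a j)) = linear_form (a j) * q" by (elim dvdE)
    then have "peval (\<theta> (linear_form (a j))) v = 0" using v by simp
    then show "a j \<bullet> field_of \<theta> v = 0" by (simp add: derivation_linear_form[OF \<theta>])
  qed
  ultimately show ?thesis by (simp add: tangent_fields_def)
qed

lemma log_derivation_of_field:
  assumes "m \<in> tangent_fields" shows "\<exists>\<theta>\<in>log_derivations arr. field_of \<theta> = m"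
proof -
  have "\<exists>p. (\<lambda>v. m v $ i) = peval p" for i using assms by (auto simp: tangent_fields_def poly_funs_def)
  then obtain p where p: "\<And>i v. m v $ i = peval (p i) v" by metis
  define \<theta> where "\<theta> f = p 1 * dx f + p 2 * dy f + p 3 * dz f" for f
  have \<theta>: "\<theta> \<in> derivations" unfolding \<theta>_def by (rule derivation_sum_of_partials)
  have f: "field_of \<theta> = m"
    by (simp add: fun_eq_iff vec_eq_iff forall_3 field_of_nth \<theta>_def partial_values p)
  have "linear_form u dvd \<theta> (linear_form u)" if u: "u \<noteq> 0" "form_kernel u \<in> arr" for u
  proof (rule linear_form_dvd[OF u(1)])
    fix v assume v: "u \<bullet> v = 0"
    obtain i where i: "i < n" "form_kernel u = plane i" using u(2) by auto
    have "v \<in> plane i" using v i(2) by (auto simp: form_kernel_def)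
    then have "m v \<in> plane i" using assms i(1) by (auto simp: tangent_fields_def tangent_def form_kernel_def)
    then have "m v \<in> form_kernel u" using i(2) by simp
    then show "peval (\<theta> (linear_form u)) v = 0"
      by (simp add: derivation_linear_form[OF \<theta>] f form_kernel_def)
  qed
  then show ?thesis using \<theta> f by (auto simp: log_derivations_def)
qed

text \<open>This is what remains of Terao's factorization theorem: with \<open>b = earlier_lines - n + 1\<close>, the factor
  \<open>t\<^sup>2 - (n - 1) t + b\<close> of the characteristic polynomial has nonnegative discriminant.\<close>

theorem free_imp_discriminant:
  assumes "free_arrangement arr"
  shows "4 * (int earlier_lines - int n + 1) \<le> (int n - 1)\<^sup>2"
proof -
  obtain B where B: "\<not> dm.dependent B" "dm.span B = log_derivations arr"
    using assms unfolding free_arrangement_def free_submodule_def by blast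
  have der: "\<theta> \<in> derivations" if "\<theta> \<in> dm.span B" for \<theta> using that B(2) by (simp add: log_derivations_def)
  show ?thesis
  proof (rule koszul_imp_discriminant)
    fix x y assume xy: "x \<in> tangent_fields" "y \<in> tangent_fields" "coord_mult 2 x = coord_mult 3 y"
    obtain \<theta> where t: "\<theta> \<in> dm.span B" "x = field_of \<theta>" using log_derivation_of_field[OF xy(1)] B(2) by auto
    obtain \<theta>1 where t1: "\<theta>1 \<in> dm.span B" "y = field_of \<theta>1" using log_derivation_of_field[OF xy(2)] B(2) by auto
    have "der_scale Yvar \<theta> = der_scale Zvar \<theta>1"
      using xy(3) by (intro field_of_inj der dm.span_scale t(1) t1(1)) (simp add: t t1 coord_mult_field_of)
    then obtain \<theta>' where t': "\<theta>' \<in> dm.span B" "\<theta> = der_scale Zvar \<theta>'"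
      using free_koszul_2[OF B(1) t(1) t1(1)] by blast
    then have "x = coord_mult 3 (field_of \<theta>')" by (simp add: t(2) coord_mult_field_of)
    moreover have "field_of \<theta>' \<in> tangent_fields" using t'(1) B(2) field_of_log_derivation by blast
    ultimately show "\<exists>z\<in>tangent_fields. x = coord_mult 3 z" by blast
  next
    fix m p q assume mpq: "m \<in> tangent_fields" "p \<in> tangent_fields" "q \<in> tangent_fields" "coord_mult 1 m = coord_mult 2 p + coord_mult 3 q"
    obtain \<theta> where t: "\<theta> \<in> dm.span B" "m = field_of \<theta>" using log_derivation_of_field[OF mpq(1)] B(2) by auto
    obtain \<theta>1 where t1: "\<theta>1 \<in> dm.span B" "p = field_of \<theta>1" using log_derivation_of_field[OF mpq(2)] B(2) by auto
    obtain \<theta>2 where t2: "\<theta>2 \<in> dm.span B" "q = field_of \<theta>2" using log_derivation_of_field[OF mpq(3)] B(2) by auto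
    have "der_scale Xvar \<theta> = der_scale Yvar \<theta>1 + der_scale Zvar \<theta>2"
      using mpq(4) by (intro field_of_inj der dm.span_scale dm.span_add t(1) t1(1) t2(1)) (simp add: t t1 t2 coord_mult_field_of field_of_scale_add)
    then obtain \<theta>' \<theta>'' where t': "\<theta>' \<in> dm.span B" "\<theta>'' \<in> dm.span B" "\<theta> = der_scale Yvar \<theta>' + der_scale Zvar \<theta>''"
      using free_koszul_3[OF B(1) t(1) t1(1) t2(1)] by blast
    then have "m = coord_mult 2 (field_of \<theta>') + coord_mult 3 (field_of \<theta>'')" by (simp add: t(2) coord_mult_field_of field_of_scale_add)
    moreover have "field_of \<theta>' \<in> tangent_fields" "field_of \<theta>'' \<in> tangent_fields" using t'(1,2) B(2) field_of_log_derivation by blast+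
    ultimately show "\<exists>p'\<in>tangent_fields. \<exists>q'\<in>tangent_fields. m = coord_mult 2 p' + coord_mult 3 q'" by blast
  qed
qed

end

section \<open>Automorphisms of the intersection lattice\<close>

context plane_arrangement
begin

lemma idx_plane: "i < n \<Longrightarrow> idx (plane i) = {i}"
  using plane_subset_plane by (auto simp: idx_def)

lemma idx_UNIV: "idx UNIV = {}"
  using plane_psubset_UNIV by (auto simp: idx_def)

lemma idx_zero: "idx {0} = {..<n}"
  by (auto simp: idx_def)

definition flat :: "nat set \<Rightarrow> (real^3) set" where
  "flat S = {x. \<forall>i\<in>S. a i \<bullet> x = 0}"

lemma flat_idx:
  assumes "X \<in> lat" shows "flat (idx X) = X"
proof -
  consider "X = UNIV" | "X = {0}" | i where "i < n" "X = plane i" | "X \<in> rank2"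
    using assms by (auto simp: intersection_lattice_eq)
  then show ?thesis
  proof cases
    case 1
    show ?thesis unfolding 1 idx_UNIV by (simp add: flat_def)
  next
    case 3
    show ?thesis unfolding 3(2) idx_plane[OF 3(1)] by (simp add: flat_def form_kernel_def)
  next
    case 2
    have "x = 0" if "x \<in> flat {..<n}" for x
      using that by (intro essential) (auto simp: flat_def)
    moreover have "0 \<in> flat {..<n}" by (simp add: flat_def)
    ultimately show ?thesis unfolding 2 idx_zero by blast
  next
    case 4
    then obtain i j where ij: "i < n" "j < n" "X = plane i \<inter> plane j" by (auto simp: rank2_def)
    then have "i \<in> idx X" "j \<in> idx X" by (auto simp: idx_def)
    then have "flat (idx X) \<subseteq> X" unfolding ij(3) by (auto simp: flat_def form_kernel_def)
    moreover have "X \<subseteq> flat (idx X)" by (auto simp: flat_def idx_def form_kernel_def)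
    ultimately show ?thesis by blast
  qed
qed

lemma subset_iff_idx:
  assumes "X \<in> lat" "Y \<in> lat" shows "X \<subseteq> Y \<longleftrightarrow> idx Y \<subseteq> idx X"
proof
  assume "idx Y \<subseteq> idx X"
  then have "flat (idx X) \<subseteq> flat (idx Y)" by (auto simp: flat_def)
  then show "X \<subseteq> Y" using flat_idx assms by simp
qed (auto simp: idx_def)

lemma idx_inj: "X \<in> lat \<Longrightarrow> Y \<in> lat \<Longrightarrow> idx X = idx Y \<Longrightarrow> X = Y"
  using flat_idx by metis

text \<open>The permutations of the planes that act on the lattice.\<close>

definition flat_perm :: "(nat \<Rightarrow> nat) \<Rightarrow> bool" where
  "flat_perm \<pi> \<longleftrightarrow> bij_betw \<pi> {..<n} {..<n} \<and> (\<forall>X\<in>lat. \<pi> ` idx X \<in> idx ` lat)"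

definition induced :: "(nat \<Rightarrow> nat) \<Rightarrow> (real^3) set \<Rightarrow> (real^3) set" where
  "induced \<pi> = (\<lambda>X\<in>lat. flat (\<pi> ` idx X))"

lemma idx_induced:
  assumes "flat_perm \<pi>" "X \<in> lat" shows "induced \<pi> X \<in> lat" "idx (induced \<pi> X) = \<pi> ` idx X"
proof -
  obtain Y where Y: "Y \<in> lat" "\<pi> ` idx X = idx Y" using assms by (auto simp: flat_perm_def)
  then have "induced \<pi> X = Y" using assms(2) flat_idx by (simp add: induced_def)
  then show "induced \<pi> X \<in> lat" "idx (induced \<pi> X) = \<pi> ` idx X" using Y by auto
qed

lemma idx_sub: "idx X \<subseteq> {..<n}" by (auto simp: idx_def)

lemma image_idx_subset_iff:
  assumes "bij_betw \<pi> {..<n} {..<n}" shows "\<pi> ` idx X \<subseteq> \<pi> ` idx Y \<longleftrightarrow> idx X \<subseteq> idx Y"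
  using inj_on_image_subset_iff[OF bij_betw_imp_inj_on[OF assms] idx_sub idx_sub] .

lemma flat_perm_bij: "flat_perm \<pi> \<Longrightarrow> bij_betw \<pi> {..<n} {..<n}"
  by (simp add: flat_perm_def)

lemma induced_subset_iff:
  assumes "flat_perm \<pi>" "X \<in> lat" "Y \<in> lat"
  shows "induced \<pi> X \<subseteq> induced \<pi> Y \<longleftrightarrow> X \<subseteq> Y"
  using idx_induced[OF assms(1)] subset_iff_idx assms image_idx_subset_iff[OF flat_perm_bij[OF assms(1)]]
  by simp

lemma induced_Bij:
  assumes "flat_perm \<pi>" shows "induced \<pi> \<in> Bij lat"
proof -
  have inj: "inj_on (induced \<pi>) lat"
  proof (rule inj_onI)
    fix X Y assume XY: "X \<in> lat" "Y \<in> lat" "induced \<pi> X = induced \<pi> Y"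
    show "X = Y"
    proof
      show "X \<subseteq> Y" using induced_subset_iff[OF assms XY(1,2)] XY(3) by simp
      show "Y \<subseteq> X" using induced_subset_iff[OF assms XY(2,1)] XY(3) by simp
    qed
  qed
  have "induced \<pi> ` lat \<subseteq> lat" using idx_induced(1)[OF assms] by blast
  from endo_inj_surj[OF finite_lat this inj] have "bij_betw (induced \<pi>) lat lat"
    using inj by (simp add: bij_betw_def)
  then show ?thesis by (simp add: Bij_def induced_def)
qed

lemma carrier_aut:
  "f \<in> carrier (poset_automorphism_group lat) \<longleftrightarrow> f \<in> Bij lat \<and> (\<forall>X\<in>lat. \<forall>Y\<in>lat. f X \<subseteq> f Y \<longleftrightarrow> X \<subseteq> Y)"
  by (simp add: poset_automorphism_group_def)

lemma induced_carrier: "flat_perm \<pi> \<Longrightarrow> induced \<pi> \<in> carrier (poset_automorphism_group lat)"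
  unfolding carrier_aut using induced_Bij induced_subset_iff by blast

lemma plane_in_lat: "i < n \<Longrightarrow> plane i \<in> lat"
  by (auto simp: intersection_lattice_eq)

lemma coatom_iff:
  assumes "X \<in> lat"
  shows "X \<in> arr \<longleftrightarrow> X \<noteq> UNIV \<and> (\<forall>Y\<in>lat. X \<subseteq> Y \<longrightarrow> Y = X \<or> Y = UNIV)"
proof
  assume "X \<in> arr"
  then obtain i where i: "i < n" "X = plane i" by auto
  have "Y = X \<or> Y = UNIV" if Y: "Y \<in> lat" "X \<subseteq> Y" for Y
  proof -
    have "idx Y \<subseteq> {i}" using subset_iff_idx[OF assms Y(1)] Y(2) i idx_plane by simp
    then have "idx Y = {} \<or> idx Y = idx X" using i idx_plane by auto
    then show ?thesis using idx_inj[OF Y(1)] assms idx_UNIV intersection_lattice_eq by (metis insertI1)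
  qed
  moreover have "X \<noteq> UNIV" using plane_psubset_UNIV[OF i(1)] i(2) by auto
  ultimately show "X \<noteq> UNIV \<and> (\<forall>Y\<in>lat. X \<subseteq> Y \<longrightarrow> Y = X \<or> Y = UNIV)" by (intro conjI ballI impI)
next
  assume X: "X \<noteq> UNIV \<and> (\<forall>Y\<in>lat. X \<subseteq> Y \<longrightarrow> Y = X \<or> Y = UNIV)"
  have "idx X \<noteq> {}"
  proof
    assume "idx X = {}"
    then have "idx X = idx UNIV" by (simp add: idx_UNIV)
    then have "X = UNIV" using idx_inj[OF assms] intersection_lattice_eq by blast
    then show False using X by simp
  qed
  then obtain i where i: "i \<in> idx X" by blast
  then have "i < n" "X \<subseteq> plane i" by (auto simp: idx_def)
  then have "plane i = X \<or> plane i = UNIV" using X plane_in_lat[of i] by blast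
  then have "plane i = X" using plane_psubset_UNIV[OF \<open>i < n\<close>] by auto
  then show "X \<in> arr" using \<open>i < n\<close> by blast
qed

text \<open>An automorphism permutes the planes, as these are the coatoms of the lattice for inclusion, and a flat is determined by the
  planes that contain it.\<close>

lemma automorphism_induced:
  assumes "f \<in> carrier (poset_automorphism_group lat)"
  shows "\<exists>\<pi>. flat_perm \<pi> \<and> f = induced \<pi>"
proof -
  have f: "f \<in> Bij lat" and mono: "\<And>X Y. X \<in> lat \<Longrightarrow> Y \<in> lat \<Longrightarrow> f X \<subseteq> f Y \<longleftrightarrow> X \<subseteq> Y"
    using assms by (auto simp: carrier_aut)
  have bij: "bij_betw f lat lat" and ext: "f \<in> extensional lat" using f by (auto simp: Bij_def)
  have U: "UNIV \<in> lat" by (simp add: intersection_lattice_eq)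
  have into: "f X \<in> lat" if "X \<in> lat" for X using bij that bij_betwE by blast
  have fU: "f UNIV = UNIV"
  proof -
    have "UNIV \<in> f ` lat" using bij U by (simp add: bij_betw_def)
    then obtain X where X: "X \<in> lat" "f X = UNIV" by (metis imageE)
    have "f X \<subseteq> f UNIV" using mono[OF X(1) U] by simp
    then show ?thesis using X(2) by blast
  qed
  have inj: "f X = f Y \<Longrightarrow> X = Y" if "X \<in> lat" "Y \<in> lat" for X Y
    using bij that by (auto simp: bij_betw_def inj_on_def)
  have "\<exists>j<n. f (plane i) = plane j" if i: "i < n" for i
  proof -
    have p: "plane i \<in> lat" using plane_in_lat[OF i] .
    have "plane i \<noteq> UNIV" using plane_psubset_UNIV[OF i] by blast
    then have "f (plane i) \<noteq> UNIV" using inj[OF p U] fU by argo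
    moreover have "Y = f (plane i) \<or> Y = UNIV" if Y: "Y \<in> lat" "f (plane i) \<subseteq> Y" for Y
    proof -
      have "Y \<in> f ` lat" using bij Y(1) by (simp add: bij_betw_def)
      then obtain Z where Z: "Z \<in> lat" "Y = f Z" by (metis imageE)
      then have "plane i \<subseteq> Z" using mono[OF p Z(1)] Y(2) by simp
      moreover have "plane i \<in> arr" using i by blast
      ultimately have "Z = plane i \<or> Z = UNIV" using coatom_iff[OF p] Z(1) by blast
      then show ?thesis using Z(2) fU by blast
    qed
    ultimately have "f (plane i) \<in> arr" using coatom_iff[OF into[OF p]] by blast
    then show ?thesis by blast
  qed
  then obtain \<pi> where \<pi>: "\<And>i. i < n \<Longrightarrow> \<pi> i < n \<and> f (plane i) = plane (\<pi> i)" by metis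
  have "inj_on \<pi> {..<n}"
  proof (rule inj_onI)
    fix i j assume ij: "i \<in> {..<n}" "j \<in> {..<n}" "\<pi> i = \<pi> j"
    then have "f (plane i) = f (plane j)" using \<pi> by simp
    then show "i = j" using inj plane_in_lat plane_inj ij by auto
  qed
  moreover have "\<pi> ` {..<n} \<subseteq> {..<n}" using \<pi> by auto
  ultimately have b: "bij_betw \<pi> {..<n} {..<n}"
    using endo_inj_surj[of "{..<n}" \<pi>] by (simp add: bij_betw_def)
  have ix: "idx (f X) = \<pi> ` idx X" if X: "X \<in> lat" for X
  proof (intro Set.set_eqI iffI)
    fix j assume j: "j \<in> idx (f X)"
    then have "j < n" by (simp add: idx_def)
    then have "j \<in> \<pi> ` {..<n}" using b by (simp add: bij_betw_def)
    then obtain i where i: "i < n" "j = \<pi> i" by auto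
    have "f X \<subseteq> f (plane i)" using j i \<pi> by (simp add: idx_def)
    then have "X \<subseteq> plane i" using mono[OF X plane_in_lat[OF i(1)]] by simp
    then show "j \<in> \<pi> ` idx X" using i by (simp add: idx_def)
  next
    fix j assume "j \<in> \<pi> ` idx X"
    then obtain i where i: "i < n" "X \<subseteq> plane i" "j = \<pi> i" by (auto simp: idx_def)
    then have "f X \<subseteq> f (plane i)" using mono[OF X plane_in_lat[OF i(1)]] by simp
    then show "j \<in> idx (f X)" using \<pi> i by (simp add: idx_def)
  qed
  have fp: "flat_perm \<pi>" unfolding flat_perm_def
  proof (intro conjI b ballI)
    fix X assume "X \<in> lat"
    then have "\<pi> ` idx X = idx (f X)" "f X \<in> lat" using ix into by auto
    then show "\<pi> ` idx X \<in> idx ` lat" by blast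
  qed
  have "f X = induced \<pi> X" for X
  proof (cases "X \<in> lat")
    case True
    then show ?thesis using flat_idx[OF into[OF True]] ix by (simp add: induced_def)
  next
    case False
    then show ?thesis using ext by (simp add: induced_def extensional_def)
  qed
  then show ?thesis using fp by blast
qed

text \<open>An invariant of pairs of planes: the number of planes through their line of intersection.\<close>

definition colour :: "nat \<Rightarrow> nat \<Rightarrow> nat" where
  "colour i j = card (idx (plane i \<inter> plane j))"

lemma rank2_in_lat: "X \<in> rank2 \<Longrightarrow> X \<in> lat" by (simp add: intersection_lattice_eq)

lemma induced_rank2:
  assumes \<pi>: "flat_perm \<pi>" and X: "X \<in> rank2" shows "induced \<pi> X \<in> rank2"
proof -
  let ?Y = "induced \<pi> X"
  have Y: "?Y \<in> lat" "idx ?Y = \<pi> ` idx X" using idx_induced[OF \<pi> rank2_in_lat[OF X]] by auto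
  have c: "card (idx ?Y) = card (idx X)"
    unfolding Y(2) by (rule card_image[OF inj_on_subset[OF bij_betw_imp_inj_on[OF flat_perm_bij[OF \<pi>]] idx_sub]])
  have "?Y \<noteq> UNIV" using c card_idx_ge_2[OF X] by (auto simp: idx_UNIV)
  moreover have "?Y \<noteq> {0}"
  proof
    assume "?Y = {0}"
    then have "card (idx X) = card {..<n}" using c idx_zero by simp
    then have "idx X = {..<n}" using idx_sub by (intro card_subset_eq) auto
    then have "X = {0}" using idx_inj[OF rank2_in_lat[OF X], of "{0}"] idx_zero by (simp add: intersection_lattice_eq)
    then show False using X zero_not_flat(3) by simp
  qed
  moreover have "?Y \<notin> arr" using c card_idx_ge_2[OF X] idx_plane by auto
  ultimately show ?thesis using Y(1) by (simp add: intersection_lattice_eq)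
qed

lemma flat_perm_colour:
  assumes \<pi>: "flat_perm \<pi>" and ij: "i < n" "j < n" "i \<noteq> j"
  shows "colour (\<pi> i) (\<pi> j) = colour i j"
proof -
  let ?X = "plane i \<inter> plane j"
  have X: "?X \<in> rank2" using ij by (auto simp: rank2_def)
  have Y: "induced \<pi> ?X \<in> rank2" "idx (induced \<pi> ?X) = \<pi> ` idx ?X"
    using induced_rank2[OF \<pi> X] idx_induced[OF \<pi> rank2_in_lat[OF X]] by auto
  have inj: "inj_on \<pi> {..<n}" using flat_perm_bij[OF \<pi>] by (rule bij_betw_imp_inj_on)
  have "i \<in> idx ?X" "j \<in> idx ?X" using ij by (auto simp: idx_def)
  then have "\<pi> i \<in> idx (induced \<pi> ?X)" "\<pi> j \<in> idx (induced \<pi> ?X)" unfolding Y(2) by auto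
  moreover have "\<pi> i \<noteq> \<pi> j" using inj ij by (auto simp: inj_on_def)
  ultimately have "induced \<pi> ?X = plane (\<pi> i) \<inter> plane (\<pi> j)" by (rule rank2_eq_Int[OF Y(1)])
  then have "colour (\<pi> i) (\<pi> j) = card (\<pi> ` idx ?X)" using Y(2) by (simp add: colour_def)
  also have "\<dots> = card (idx ?X)" by (rule card_image[OF inj_on_subset[OF inj idx_sub]])
  finally show ?thesis by (simp add: colour_def)
qed

lemma flat_perm_comp:
  assumes "flat_perm \<pi>" "flat_perm \<rho>" shows "flat_perm (\<pi> \<circ> \<rho>)"
  unfolding flat_perm_def
proof (intro conjI ballI)
  show "bij_betw (\<pi> \<circ> \<rho>) {..<n} {..<n}" using assms flat_perm_bij bij_betw_trans by blast
  fix X assume "X \<in> lat"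
  then have "\<rho> ` idx X \<in> idx ` lat" using assms(2) by (simp add: flat_perm_def)
  then obtain Y where "Y \<in> lat" "\<rho> ` idx X = idx Y" by blast
  moreover have "(\<pi> \<circ> \<rho>) ` idx X = \<pi> ` (\<rho> ` idx X)" by (simp add: image_comp)
  ultimately show "(\<pi> \<circ> \<rho>) ` idx X \<in> idx ` lat" using assms(1) by (simp add: flat_perm_def)
qed

text \<open>An explicit group acting faithfully on the planes by symmetries of the lattice is the full automorphism group as soon
  as every symmetry comes from it.\<close>

lemma aut_group_iso:
  fixes G :: "'g monoid" (structure)
  assumes grp: "group G" and P: "\<And>x. x \<in> carrier G \<Longrightarrow> flat_perm (P x)"
    and hom: "\<And>x y i. x \<in> carrier G \<Longrightarrow> y \<in> carrier G \<Longrightarrow> i < n \<Longrightarrow> P (x \<otimes> y) i = P x (P y i)"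
    and inj: "\<And>x y. x \<in> carrier G \<Longrightarrow> y \<in> carrier G \<Longrightarrow> (\<And>i. i < n \<Longrightarrow> P x i = P y i) \<Longrightarrow> x = y"
    and surj: "\<And>\<pi>. flat_perm \<pi> \<Longrightarrow> \<exists>x\<in>carrier G. \<forall>i<n. \<pi> i = P x i"
  shows "poset_automorphism_group lat \<cong> G"
proof -
  let ?A = "poset_automorphism_group lat"
  define h where "h x = induced (P x)" for x
  have cong: "induced \<pi> = induced \<rho>" if "\<And>i. i < n \<Longrightarrow> \<pi> i = \<rho> i" for \<pi> \<rho>
  proof -
    have "\<pi> ` idx X = \<rho> ` idx X" for X using that idx_sub[of X] by (intro image_cong) auto
    then show ?thesis by (simp add: induced_def)
  qed
  have "h \<in> hom G ?A"
  proof (rule homI)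
    show "h x \<in> carrier ?A" if "x \<in> carrier G" for x using induced_carrier[OF P[OF that]] by (simp add: h_def)
    fix x y assume xy: "x \<in> carrier G" "y \<in> carrier G"
    have "h (x \<otimes> y) X = compose lat (h x) (h y) X" for X
    proof (cases "X \<in> lat")
      case True
      have "P (x \<otimes> y) ` idx X = P x ` P y ` idx X"
        unfolding image_image using hom[OF xy] idx_sub[of X] by (intro image_cong) auto
      moreover have "h x (h y X) = flat (P x ` P y ` idx X)"
        using idx_induced[OF P[OF xy(2)] True] by (simp add: h_def induced_def)
      moreover have "h (x \<otimes> y) X = flat (P (x \<otimes> y) ` idx X)" using True by (simp add: h_def induced_def)
      moreover have "compose lat (h x) (h y) X = h x (h y X)" using True by (simp add: compose_def)
      ultimately show ?thesis by simp
    qed (simp add: h_def induced_def compose_def)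
    then have "h (x \<otimes> y) = compose lat (h x) (h y)" by blast
    moreover have "h x \<in> Bij lat" "h y \<in> Bij lat" using induced_Bij P xy by (auto simp: h_def)
    ultimately show "h (x \<otimes> y) = h x \<otimes>\<^bsub>?A\<^esub> h y"
      by (simp add: poset_automorphism_group_def BijGroup_def)
  qed
  moreover have "bij_betw h (carrier G) (carrier ?A)"
    unfolding bij_betw_def
  proof
    show "inj_on h (carrier G)"
    proof (rule inj_onI)
      fix x y assume xy: "x \<in> carrier G" "y \<in> carrier G" "h x = h y"
      show "x = y"
      proof (rule inj[OF xy(1,2)])
        fix i assume i: "i < n"
        have e: "idx (h z (plane i)) = {P z i}" if "z \<in> carrier G" for z
          unfolding h_def idx_induced(2)[OF P[OF that] plane_in_lat[OF i]] idx_plane[OF i] by simp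
        have "{P x i} = {P y i}" using e[OF xy(1)] e[OF xy(2)] by (simp only: xy(3))
        then show "P x i = P y i" by simp
      qed
    qed
    show "h ` carrier G = carrier ?A"
    proof (intro equalityI subsetI)
      fix f assume "f \<in> carrier ?A"
      then obtain \<pi> where \<pi>: "flat_perm \<pi>" "f = induced \<pi>" using automorphism_induced by blast
      obtain x where "x \<in> carrier G" "\<forall>i<n. \<pi> i = P x i" using surj[OF \<pi>(1)] by blast
      then show "f \<in> h ` carrier G" using cong[of \<pi> "P x"] \<pi>(2) by (auto simp: h_def)
    qed (use induced_carrier P in \<open>auto simp: h_def\<close>)
  qed
  ultimately have "h \<in> iso G ?A" by (simp add: iso_def)
  then have "G \<cong> ?A" by (auto simp: is_iso_def)
  then show ?thesis using group.iso_sym[OF grp] by blast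
qed

end

section \<open>Exact arithmetic with the parameter\<close>

text \<open>Elements of \<open>\<int>[\<omega>]\<close> are represented by their coordinates with respect to \<open>1, \<omega>, \<omega>\<^sup>2, \<omega>\<^sup>3\<close>, in
  increasing order; all data are thus independent of the choice of the root.\<close>

type_synonym z4 = "int \<times> int \<times> int \<times> int"

definition ev :: "real \<Rightarrow> z4 \<Rightarrow> real" where
  "ev w = (\<lambda>(a, b, c, d). of_int a + of_int b * w + of_int c * w^2 + of_int d * w^3)"

definition add4 :: "z4 \<Rightarrow> z4 \<Rightarrow> z4" where
  "add4 = (\<lambda>(a, b, c, d) (a', b', c', d'). (a + a', b + b', c + c', d + d'))"

text \<open>Multiplication by \<open>\<omega>\<close>, reduced with \<open>\<omega>\<^sup>4 = 3 \<omega>\<^sup>3 - 3 \<omega>\<^sup>2 + 3 \<omega> - 1\<close>.\<close>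

definition shift4 :: "z4 \<Rightarrow> z4" where
  "shift4 = (\<lambda>(a, b, c, d). (- d, a + 3 * d, b - 3 * d, c + 3 * d))"

definition scale4 :: "int \<Rightarrow> z4 \<Rightarrow> z4" where
  "scale4 k = (\<lambda>(a, b, c, d). (k * a, k * b, k * c, k * d))"

definition mul4 :: "z4 \<Rightarrow> z4 \<Rightarrow> z4" where
  "mul4 = (\<lambda>(a, b, c, d) y. add4 (scale4 a y) (shift4 (add4 (scale4 b y)
     (shift4 (add4 (scale4 c y) (shift4 (scale4 d y)))))))"

definition dot4 :: "z4 \<times> z4 \<times> z4 \<Rightarrow> z4 \<times> z4 \<times> z4 \<Rightarrow> z4" where
  "dot4 = (\<lambda>(x, y, z) (x', y', z'). add4 (mul4 x x') (add4 (mul4 y y') (mul4 z z')))"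

definition evv :: "real \<Rightarrow> z4 \<times> z4 \<times> z4 \<Rightarrow> real^3" where
  "evv w = (\<lambda>(x, y, z). vector [ev w x, ev w y, ev w z])"

lemma ev_add4: "ev w (add4 x y) = ev w x + ev w y"
  by (cases x; cases y) (simp add: ev_def add4_def algebra_simps)

lemma ev_scale4: "ev w (scale4 k x) = of_int k * ev w x"
  by (cases x) (simp add: ev_def scale4_def algebra_simps)

lemma ev_zero [simp]: "ev w (0, 0, 0, 0) = 0"
  by (simp add: ev_def)

lemma ev_shift4:
  assumes "is_parameter w"
  shows "ev w (shift4 x) = w * ev w x"
proof -
  obtain a b c d where x: "x = (a, b, c, d)" by (cases x)
  have "w^4 = 3*w^3 - 3*w^2 + 3*w - 1" using assms by (simp add: is_parameter_def)
  then have "of_int d * w^4 = of_int d * (3*w^3 - 3*w^2 + 3*w - 1)" by simp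
  then show ?thesis by (simp add: x ev_def shift4_def algebra_simps power_numeral_reduce)
qed

lemma ev_mul4:
  assumes "is_parameter w"
  shows "ev w (mul4 x y) = ev w x * ev w y"
proof -
  obtain a b c d where x: "x = (a, b, c, d)" by (cases x)
  have "ev w (mul4 x y) = of_int a * ev w y + w * (of_int b * ev w y
     + w * (of_int c * ev w y + w * (of_int d * ev w y)))"
    by (simp add: x mul4_def ev_add4 ev_scale4 ev_shift4[OF assms])
  moreover have "ev w x = of_int a + of_int b * w + of_int c * w^2 + of_int d * w^3"
    by (simp add: x ev_def)
  ultimately show ?thesis by (simp add: algebra_simps power_numeral_reduce)
qed

lemma evv_nth: "evv w (x, y, z) $ 1 = ev w x" "evv w (x, y, z) $ 2 = ev w y" "evv w (x, y, z) $ 3 = ev w z"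
  by (simp_all add: evv_def)

lemma inner_evv:
  assumes "is_parameter w"
  shows "evv w u \<bullet> evv w v = ev w (dot4 u v)"
  by (cases u; cases v)
    (simp add: inner_vec_def sum_3 evv_nth dot4_def ev_add4 ev_mul4[OF assms])

text \<open>The polynomial is the norm of \<open>a + b \<omega> + c \<omega>\<^sup>2 + d \<omega>\<^sup>3\<close>. Modulo 2 the minimal polynomial of \<open>\<omega>\<close> is
  \<open>X\<^sup>4 + X\<^sup>3 + X\<^sup>2 + X + 1\<close>, which is irreducible, so the norm is anisotropic modulo 2.\<close>

lemma norm_form_even:
  fixes a b c d :: int
  assumes "even (a^4 + 3 * a^3 * b + 3 * a^3 * c + 9 * a^3 * d + 3 * a^2 * b^2 + 4 * a^2 * b * d - 7 * a^2 * c^2 - 21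
     * a^2 * c * d - 9 * a^2 * d^2 + 3 * a * b^3 + 5 * a * b^2 * c + 6 * a * b^2 * d - 15 * a * b * c * d
     - 21 * a * b * d^2 + 3 * a * c^3 + 6 * a * c^2 * d + 4 * a * c * d^2 + 9 * a * d^3 + b^4 + 3 * b^3 *
     c + 3 * b^3 * d + 3 * b^2 * c^2 - 7 * b^2 * d^2 + 3 * b * c^3 + 5 * b * c^2 * d + 3 * b * d^3 + c^4
     + 3 * c^3 * d + 3 * c^2 * d^2 + 3 * c * d^3 + d^4)"
  shows "even a \<and> even b \<and> even c \<and> even d"
  using assms by (simp; argo)

text \<open>The norm is the determinant of multiplication by the element, so it is a combination of the multiples of the element by
  powers of \<open>\<omega>\<close>; the cofactors are the coefficients below.\<close>

lemma norm_form_eq_0: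
  fixes a b c d :: int
  assumes w: "is_parameter w" and 0: "ev w (a, b, c, d) = 0"
  shows "a^4 + 3 * a^3 * b + 3 * a^3 * c + 9 * a^3 * d + 3 * a^2 * b^2 + 4 * a^2 * b * d - 7 * a^2 * c^2 - 21
     * a^2 * c * d - 9 * a^2 * d^2 + 3 * a * b^3 + 5 * a * b^2 * c + 6 * a * b^2 * d - 15 * a * b * c * d
     - 21 * a * b * d^2 + 3 * a * c^3 + 6 * a * c^2 * d + 4 * a * c * d^2 + 9 * a * d^3 + b^4 + 3 * b^3 *
     c + 3 * b^3 * d + 3 * b^2 * c^2 - 7 * b^2 * d^2 + 3 * b * c^3 + 5 * b * c^2 * d + 3 * b * d^3 + c^4
     + 3 * c^3 * d + 3 * c^2 * d^2 + 3 * c * d^3 + d^4 = 0" (is "?N = 0")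
proof -
  define x where "x = (a, b, c, d)"
  have "ev w x = 0" using 0 by (simp add: x_def)
  then have s: "ev w (shift4 x) = 0" "ev w (shift4 (shift4 x)) = 0" "ev w (shift4 (shift4 (shift4 x))) = 0"
    by (simp_all add: ev_shift4[OF w])
  have "of_int ?N = of_int (a^3 + 3 * a^2 * b + 3 * a^2 * c + 9 * a^2 * d + 3 * a * b^2 + 2 * a * b * d - 8 * a * c^2 - 27 * a *
     c * d - 15 * a * d^2 + 3 * b^3 + 8 * b^2 * c + 9 * b^2 * d + 6 * b * c^2 - 3 * b * c * d - 21 * b *
     d^2 + 6 * c^3 + 15 * c^2 * d + 10 * c * d^2 + 12 * d^3) * ev w x
     + of_int (-(a^2 * b) - 3 * a * b^2 - 3 * a * b * c - 3 * a * b * d + 3 * a * c^2 + 16 * a * c * d + 15 * a *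
     d^2 - 3 * b^3 - 9 * b^2 * c - 10 * b^2 * d - 8 * b * c^2 - 3 * b * c * d + 18 * b * d^2 - 6 * c^3 -
     15 * c^2 * d - 9 * c * d^2 - 10 * d^3) * ev w (shift4 x)
     + of_int (-(a^2 * c) + a * b^2 - 3 * a * b * c - 6 * a * b * d - 6 * a * c^2 - 21 * a * c * d - 10 * a * d^2 +
     3 * b^3 + 9 * b^2 * c + 9 * b^2 * d + 9 * b * c^2 + 2 * b * c * d - 21 * b * d^2 + 8 * c^3 + 21 *
     c^2 * d + 15 * c * d^2 + 15 * d^3) * ev w (shift4 (shift4 x))
     + of_int (-(a^2 * d) + 2 * a * b * c + 3 * a * b * d + 3 * a * c^2 + 9 * a * c * d + 3 * a * d^2 - b^3 - 3 *
     b^2 * c - 3 * b^2 * d - 3 * b * c^2 + 8 * b * d^2 - 3 * c^3 - 8 * c^2 * d - 6 * c * d^2 - 6 * d^3) * ev w (shift4 (shift4 (shift4 x)))"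
    unfolding x_def shift4_def ev_def prod.case of_int_add of_int_diff of_int_mult of_int_power of_int_minus of_int_numeral
    by algebra
  then have "of_int ?N = (0::real)" using s \<open>ev w x = 0\<close> by simp
  then show ?thesis by linarith
qed

text \<open>Infinite descent at the prime 2, in place of irreducibility over the rationals.\<close>

lemma ev_eq_0_aux:
  fixes a b c d :: int
  assumes w: "is_parameter w"
  shows "ev w (a, b, c, d) = 0 \<Longrightarrow> a = 0 \<and> b = 0 \<and> c = 0 \<and> d = 0"
proof (induction "nat (\<bar>a\<bar> + \<bar>b\<bar> + \<bar>c\<bar> + \<bar>d\<bar>)" arbitrary: a b c d rule: less_induct)
  case less
  have "even a \<and> even b \<and> even c \<and> even d"
    by (rule norm_form_even) (use norm_form_eq_0[OF w less.prems] in simp)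
  then obtain a' b' c' d' where h: "a = 2 * a'" "b = 2 * b'" "c = 2 * c'" "d = 2 * d'"
    by (auto elim!: evenE)
  have "ev w (a, b, c, d) = 2 * ev w (a', b', c', d')" by (simp add: h ev_def algebra_simps)
  then have 0: "ev w (a', b', c', d') = 0" using less.prems by simp
  show ?case
  proof (rule ccontr)
    assume "\<not> ?thesis"
    then have "nat (\<bar>a'\<bar> + \<bar>b'\<bar> + \<bar>c'\<bar> + \<bar>d'\<bar>) < nat (\<bar>a\<bar> + \<bar>b\<bar> + \<bar>c\<bar> + \<bar>d\<bar>)"
      unfolding h abs_mult by auto
    from less.hyps[OF this 0] \<open>\<not> ?thesis\<close> show False by (simp add: h)
  qed
qed

lemma ev_eq_iff:
  assumes "is_parameter w"
  shows "ev w x = ev w y \<longleftrightarrow> x = y"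
proof -
  obtain a b c d a' b' c' d' where [simp]: "x = (a, b, c, d)" "y = (a', b', c', d')" by (cases x; cases y)
  have "ev w (a - a', b - b', c - c', d - d') = ev w x - ev w y" by (simp add: ev_def algebra_simps)
  then show ?thesis using ev_eq_0_aux[OF assms, of "a - a'" "b - b'" "c - c'" "d - d'"] by auto
qed

text \<open>Directions are compared through representatives whose first nonzero coordinate is 66, a common multiple of all
  leading coordinates that occur; this keeps the arithmetic integral.\<close>

definition standard :: "z4 \<times> z4 \<times> z4 \<Rightarrow> bool" where
  "standard = (\<lambda>(x, y, z). x = (66, 0, 0, 0) \<or> x = (0, 0, 0, 0) \<and>
     (y = (66, 0, 0, 0) \<or> y = (0, 0, 0, 0) \<and> z = (66, 0, 0, 0)))"

definition lead :: "z4 \<times> z4 \<times> z4 \<Rightarrow> int" where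
  "lead = (\<lambda>(x, y, z). if x \<noteq> (0, 0, 0, 0) then fst x else if y \<noteq> (0, 0, 0, 0) then fst y else fst z)"

definition standardize :: "z4 \<times> z4 \<times> z4 \<Rightarrow> z4 \<times> z4 \<times> z4" where
  "standardize u = (let k = 66 div lead u; (x, y, z) = u in (scale4 k x, scale4 k y, scale4 k z))"

lemma evv_standardize: "evv w (standardize u) = of_int (66 div lead u) *\<^sub>R evv w u"
  by (cases u) (simp add: standardize_def evv_def vec_eq_iff forall_3 ev_scale4 Let_def)

lemma standard_parallel_imp_eq:
  assumes w: "is_parameter w" and "standard u" "standard v" and "evv w u = c *\<^sub>R evv w v"
  shows "u = v"
proof -
  obtain x y z x' y' z' where [simp]: "u = (x, y, z)" "v = (x', y', z')" by (cases u; cases v)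
  have e: "ev w x = c * ev w x'" "ev w y = c * ev w y'" "ev w z = c * ev w z'"
    using assms(4) by (simp_all add: vec_eq_iff forall_3 evv_nth)
  have 66: "ev w (66, 0, 0, 0) = 66" by (simp add: ev_def)
  have "c = 1"
    using e assms(2,3) unfolding standard_def by (auto simp: 66)
  then show ?thesis using e by (simp add: ev_eq_iff[OF w])
qed

text \<open>The vectors in the order of the statement; planes are referred to by their positions in this list.\<close>

definition normal_list :: "(z4 \<times> z4 \<times> z4) list" where
  "normal_list = [((1,0,0,0), (0,0,0,0), (0,0,0,0)),
   ((0,0,0,0), (1,0,0,0), (0,0,0,0)),
   ((0,0,0,0), (0,0,0,0), (1,0,0,0)),
   ((1,0,0,0), (1,0,0,0), (1,0,0,0)),
   ((1,0,0,0), (0,0,0,0), (0,1,0,0)),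
   ((1,0,0,0), (-1,1,-2,1), (0,0,0,0)),
   ((0,0,0,0), (1,0,0,0), (1,-1,0,0)),
   ((1,0,0,0), (1,0,0,0), (1,-1,0,0)),
   ((1,0,0,0), (1,-1,0,0), (1,-1,0,0)),
   ((1,0,0,0), (1,-1,1,0), (0,1,0,0)),
   ((1,0,0,0), (1,-1,0,0), (0,0,0,0)),
   ((1,0,0,0), (1,-1,0,0), (1,-2,1,0)),
   ((1,0,0,0), (2,-3,3,-1), (1,-2,3,-1)),
   ((1,0,0,0), (1,0,0,0), (0,2,-1,0)),
   ((1,0,0,0), (2,-2,2,-1), (1,0,0,0)),
   ((1,0,0,0), (2,-2,2,-1), (1,-1,2,-1)),
   ((1,0,0,0), (1,-1,1,0), (1,-1,2,-1)),
   ((1,0,0,0), (1,-1,1,0), (1,-2,3,-1)),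
   ((3,0,0,0), (3,-2,2,-1), (1,2,-1,0)),
   ((1,0,0,0), (1,-1,2,-1), (0,2,-1,0)),
   ((0,0,0,0), (1,0,0,0), (0,0,-2,1)),
   ((1,0,0,0), (1,-2,3,-1), (-1,3,1,-1)),
   ((1,0,0,0), (0,0,0,0), (-1,2,-1,0)),
   ((1,0,0,0), (2,-2,2,-1), (0,1,0,0)),
   ((1,0,0,0), (1,-1,1,-1), (0,1,0,0)),
   ((1,0,0,0), (2,-2,2,-1), (0,0,0,0)),
   ((1,0,0,0), (1,-1,2,-1), (-1,3,-1,0)),
   ((1,0,0,0), (0,0,0,0), (-1,3,-1,0)),
   ((0,0,0,0), (1,0,0,0), (1,-1,-2,1)),
   ((1,0,0,0), (1,-1,0,0), (1,-2,3,-1)),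
   ((1,0,0,0), (2,-3,2,-1), (1,-2,3,-1)),
   ((1,0,0,0), (1,0,1,0), (0,2,-1,0)),
   ((1,0,0,0), (2,-3,3,-1), (1,-2,5,-2)),
   ((1,0,0,0), (1,-1,2,-1), (-1,3,1,-1)),
   ((1,0,0,0), (1,-1,1,-1), (0,2,-1,0))]"

text \<open>The planes through each of the 171 lines.\<close>

definition block_list :: "nat list list" where
  "block_list = [[11,31], [11,15,33], [10,28], [9,11,14,30], [11,13], [24,32], [0,34], [13,26], [10,21,34], [9,32], [0,20],
   [11,19], [5,20,22], [1,22], [22,25,28], [7,15,22,31], [6,10,22,23,26], [22,30], [3,21,22], [9,13,22],
   [19,22,24], [17,22], [14,22,33], [11,18,22,32], [12,22], [8,16,22,34], [22,29], [21,25], [10,17], [11,16,21],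
   [12,14,26,31], [3,9,10,18,19], [3,11,17,24], [10,12,15], [6,25], [7,10,14], [15,26], [5,33], [11,34], [3,33],
   [3,26,30], [13,28,29], [1,21,33], [0,17,19,21,32], [1,18], [12,13,16,23], [21,24,26,29], [17,18,25,33,34],
   [3,15,20,32], [17,26], [3,12,25], [3,23,31], [9,26,34], [1,3,14], [0,3,8], [9,25,29], [12,19,20], [2,5],
   [2,31], [2,3,7,13], [1,2,6,20,28], [0,2,4,22,27], [2,24,34], [2,14,15,23,25], [2,18], [2,30], [2,21],
   [2,19,26,33], [2,9,16,17], [2,8,10,11,29], [2,12,32], [0,1,5,10,25], [7,16,19,25,30], [7,26,32], [10,16,24],
   [14,20], [10,13,30,32,33], [18,20], [12,34], [19,23], [16,20,31], [8,26], [23,32], [16,33], [20,23,30,34],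
   [29,31], [21,23], [3,28], [20,29,33], [17,23], [7,34], [13,20], [5,18,21,30,31], [20,24], [5,14,29],
   [12,21,28], [1,12,17,29,30], [0,9,15], [4,7,21], [3,4,5,6,16], [4,15,19,29], [4,17,28,31], [4,32], [4,30],
   [4,13], [1,4,9,23,24], [4,14,34], [4,11,20,25,26], [4,8,12,18], [4,33], [4,10], [7,17,20], [1,15,16],
   [8,24,25], [15,28,34], [8,23,33], [1,7,8], [0,6,7,11,12], [19,28], [0,16,29], [8,9,20,21], [1,13,19,31,34],
   [0,13,14,18,24], [14,16,28,32], [7,18,23,29], [13,25], [25,31,32], [16,18,26], [8,28,30], [8,31], [6,34],
   [10,31], [9,28], [5,12,24], [1,11], [5,7,9], [6,8,14,19], [5,8,13,15,17], [7,24,28,33], [6,29,32], [0,23],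
   [5,19], [0,30], [1,32], [16,27], [3,27,29,34], [7,27], [6,13,21,27], [24,27,31], [19,27], [14,17,27],
   [15,18,27], [8,27,32], [27,30], [5,11,23,27,28], [9,12,27,33], [1,26,27], [25,27], [10,20,27], [6,17],
   [0,26,28], [15,21], [5,32,34], [18,28], [0,31,33], [14,21], [6,18], [6,15,24,30], [5,26], [6,9,31], [6,33]]"

text \<open>A direction vector for each line, in the order of \<open>block_list\<close>.\<close>

definition point_list :: "(z4 \<times> z4 \<times> z4) list" where
  "point_list = [((1,0,0,0), (-15,11,-17,7), (25,-21,30,-12)),
   ((1,0,0,0), (-11,8,-12,5), (17,-14,20,-8)),
   ((1,0,0,0), (-2,1,-2,1), (11,-9,13,-5)),
   ((1,0,0,0), (-6,4,-7,3), (8,-7,10,-4)),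
   ((1,0,0,0), (-5,3,-5,2), (6,-5,7,-3)),
   ((1,0,0,0), (-7,5,-7,3), (7,-5,8,-3)),
   ((0,0,0,0), (1,0,0,0), (0,-2,1,-2)),
   ((1,0,0,0), (-1,0,-1,0), (1,-2,2,-2)),
   ((1,0,0,0), (-2,1,-2,1), (1,-2,2,-2)),
   ((1,0,0,0), (-3,2,-4,2), (3,-3,4,-2)),
   ((0,0,0,0), (1,0,0,0), (4,-4,5,-2)),
   ((1,0,0,0), (-3,1,-4,2), (3,-3,5,-2)),
   ((1,0,0,0), (2,-3,3,-1), (4,-3,5,-2)),
   ((1,0,0,0), (0,0,0,0), (4,-3,5,-2)),
   ((1,0,0,0), (0,-2,1,0), (4,-3,5,-2)),
   ((1,0,0,0), (-3,1,-2,1), (4,-3,5,-2)),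
   ((1,0,0,0), (-2,1,-2,1), (4,-3,5,-2)),
   ((3,0,0,0), (-11,6,-11,5), (12,-9,15,-6)),
   ((1,0,0,0), (-5,3,-5,2), (4,-3,5,-2)),
   ((1,0,0,0), (-4,3,-5,2), (4,-3,5,-2)),
   ((1,0,0,0), (-5,4,-5,2), (4,-3,5,-2)),
   ((1,0,0,0), (-4,1,-4,2), (4,-3,5,-2)),
   ((1,0,0,0), (-3,1,-4,2), (4,-3,5,-2)),
   ((1,0,0,0), (-4,2,-4,2), (4,-3,5,-2)),
   ((1,0,0,0), (-3,2,-4,2), (4,-3,5,-2)),
   ((1,0,0,0), (-6,4,-7,3), (4,-3,5,-2)),
   ((1,0,0,0), (-7,5,-7,3), (4,-3,5,-2)),
   ((1,0,0,0), (0,-2,1,0), (-1,0,0,-1)),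
   ((1,0,0,0), (-2,1,-2,1), (1,-1,1,-1)),
   ((1,0,0,0), (-2,0,-2,1), (1,-1,2,-1)),
   ((1,0,0,0), (-1,0,-2,1), (1,-1,2,-1)),
   ((1,0,0,0), (-2,1,-2,1), (1,-1,2,-1)),
   ((1,0,0,0), (-3,1,-2,1), (2,-1,2,-1)),
   ((1,0,0,0), (-2,1,-2,1), (2,-1,2,-1)),
   ((1,0,0,0), (0,-2,1,0), (1,0,2,-1)),
   ((1,0,0,0), (-2,1,-2,1), (2,-2,3,-1)),
   ((3,0,0,0), (-4,0,-1,1), (3,-1,4,-2)),
   ((1,0,0,0), (2,-3,3,-1), (-4,2,-4,0)),
   ((11,0,0,0), (-23,4,-18,10), (6,-2,9,-5)),
   ((3,0,0,0), (-4,0,-1,1), (1,0,1,-1)),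
   ((3,0,0,0), (-3,-1,-1,1), (0,1,1,-1)),
   ((1,0,0,0), (1,-2,2,-1), (-2,1,-2,0)),
   ((1,0,0,0), (0,0,0,0), (-2,1,-2,0)),
   ((0,0,0,0), (1,0,0,0), (-1,0,-1,0)),
   ((1,0,0,0), (0,0,0,0), (-2,1,-1,0)),
   ((1,0,0,0), (0,-1,0,0), (-1,1,-1,0)),
   ((1,0,0,0), (-1,0,0,0), (-1,1,-1,0)),
   ((1,0,0,0), (0,-2,1,0), (-1,1,-1,0)),
   ((1,0,0,0), (0,-1,1,0), (-1,1,-1,0)),
   ((1,0,0,0), (0,-4,4,-1), (-1,2,-1,0)),
   ((1,0,0,0), (0,-2,1,0), (-1,2,-1,0)),
   ((3,0,0,0), (-1,-2,1,0), (-2,2,-1,0)),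
   ((3,0,0,0), (-3,1,-4,2), (-2,2,-1,0)),
   ((1,0,0,0), (0,0,0,0), (-1,0,0,0)),
   ((0,0,0,0), (1,0,0,0), (-1,0,0,0)),
   ((1,0,0,0), (0,-2,1,0), (-1,0,0,0)),
   ((1,0,0,0), (0,0,-2,1), (-1,0,0,0)),
   ((1,0,0,0), (2,-3,3,-1), (0,0,0,0)),
   ((1,0,0,0), (-2,3,-1,0), (0,0,0,0)),
   ((1,0,0,0), (-1,0,0,0), (0,0,0,0)),
   ((1,0,0,0), (0,0,0,0), (0,0,0,0)),
   ((0,0,0,0), (1,0,0,0), (0,0,0,0)),
   ((1,0,0,0), (-2,1,0,0), (0,0,0,0)),
   ((1,0,0,0), (0,-2,1,0), (0,0,0,0)),
   ((1,0,0,0), (-1,-1,1,0), (0,0,0,0)),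
   ((3,0,0,0), (-3,1,-4,2), (0,0,0,0)),
   ((1,0,0,0), (-2,2,-3,1), (0,0,0,0)),
   ((1,0,0,0), (-2,3,-3,1), (0,0,0,0)),
   ((1,0,0,0), (-1,0,-2,1), (0,0,0,0)),
   ((1,0,0,0), (-2,1,-2,1), (0,0,0,0)),
   ((1,0,0,0), (-1,1,-2,1), (0,0,0,0)),
   ((0,0,0,0), (0,0,0,0), (1,0,0,0)),
   ((1,0,0,0), (0,-2,1,0), (-1,1,0,0)),
   ((1,0,0,0), (-1,-1,1,0), (0,1,0,0)),
   ((1,0,0,0), (-2,1,-2,1), (0,1,0,0)),
   ((11,0,0,0), (3,-12,-1,3), (-10,7,-4,1)),
   ((1,0,0,0), (-2,1,-2,1), (1,0,1,0)),
   ((11,0,0,0), (1,-15,7,1), (-18,17,-16,4)),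
   ((11,0,0,0), (3,-12,-1,3), (-18,17,-16,4)),
   ((3,0,0,0), (-1,-1,1,0), (-4,4,-3,1)),
   ((3,0,0,0), (1,-5,2,0), (-4,4,-3,1)),
   ((3,0,0,0), (-2,-1,-3,2), (-4,4,-3,1)),
   ((3,0,0,0), (-1,-2,0,1), (-2,3,-2,1)),
   ((3,0,0,0), (-2,-1,-3,2), (-2,3,-2,1)),
   ((2,0,0,0), (0,-2,1,0), (-3,3,-3,1)),
   ((3,0,0,0), (2,-5,6,-2), (-7,6,-7,2)),
   ((3,0,0,0), (1,-4,3,-1), (-7,6,-7,2)),
   ((3,0,0,0), (2,-5,6,-2), (-5,5,-6,2)),
   ((3,0,0,0), (-1,-1,1,0), (-5,5,-6,2)),
   ((3,0,0,0), (1,-5,2,0), (-5,5,-6,2)),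
   ((11,0,0,0), (-3,-10,12,-3), (-15,16,-17,7)),
   ((11,0,0,0), (-1,-7,4,-1), (-15,16,-17,7)),
   ((1,0,0,0), (2,-3,3,-1), (-4,3,-4,1)),
   ((11,0,0,0), (-3,-10,12,-3), (-23,26,-29,10)),
   ((1,0,0,0), (2,-3,3,-1), (-3,2,-3,1)),
   ((1,0,0,0), (1,-1,0,0), (-3,2,-3,1)),
   ((1,0,0,0), (0,0,0,0), (-2,2,-3,1)),
   ((0,0,0,0), (1,0,0,0), (-2,2,-3,1)),
   ((1,0,0,0), (1,-3,3,-1), (-3,3,-3,1)),
   ((1,0,0,0), (2,-3,3,-1), (-3,3,-3,1)),
   ((1,0,0,0), (1,-2,3,-1), (-3,3,-3,1)),
   ((1,0,0,0), (2,-5,4,-1), (-3,3,-3,1)),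
   ((1,0,0,0), (2,-4,4,-1), (-3,3,-3,1)),
   ((3,0,0,0), (3,-7,7,-2), (-9,9,-9,3)),
   ((1,0,0,0), (1,-1,0,0), (-3,3,-3,1)),
   ((1,0,0,0), (0,0,0,0), (-3,3,-3,1)),
   ((1,0,0,0), (2,-3,1,0), (-3,3,-3,1)),
   ((1,0,0,0), (0,-2,1,0), (-3,3,-3,1)),
   ((1,0,0,0), (1,-2,1,0), (-3,3,-3,1)),
   ((1,0,0,0), (2,-5,2,0), (-3,3,-3,1)),
   ((1,0,0,0), (-2,1,-2,1), (-3,3,-3,1)),
   ((1,0,0,0), (0,-2,3,-1), (-2,3,-3,1)),
   ((1,0,0,0), (0,0,0,0), (-2,3,-3,1)),
   ((1,0,0,0), (0,-2,1,0), (-2,3,-3,1)),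
   ((3,0,0,0), (3,-7,7,-2), (-7,7,-8,3)),
   ((3,0,0,0), (1,-4,2,0), (-7,7,-8,3)),
   ((1,0,0,0), (0,0,0,0), (-2,1,-2,1)),
   ((0,0,0,0), (1,0,0,0), (-2,1,-2,1)),
   ((1,0,0,0), (0,2,-3,1), (-2,1,-2,1)),
   ((0,0,0,0), (1,0,0,0), (-1,1,-2,1)),
   ((1,0,0,0), (0,-1,0,0), (-2,2,-2,1)),
   ((1,0,0,0), (0,0,0,0), (-2,2,-2,1)),
   ((0,0,0,0), (1,0,0,0), (-2,2,-2,1)),
   ((1,0,0,0), (1,-2,1,0), (-2,2,-2,1)),
   ((1,0,0,0), (0,-1,1,0), (-2,2,-2,1)),
   ((1,0,0,0), (0,-2,1,0), (-1,2,-2,1)),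
   ((1,0,0,0), (0,-2,1,0), (-1,2,-1,1)),
   ((1,0,0,0), (-1,0,-1,1), (-1,2,-1,1)),
   ((3,0,0,0), (3,-5,4,-1), (-9,8,-10,4)),
   ((3,0,0,0), (4,-6,4,-1), (-10,9,-10,4)),
   ((11,0,0,0), (23,-26,29,-10), (-39,35,-42,16)),
   ((1,0,0,0), (-2,1,-2,1), (1,1,1,1)),
   ((3,0,0,0), (4,-6,4,-1), (-12,10,-13,5)),
   ((1,0,0,0), (2,-3,3,-1), (-5,5,-6,2)),
   ((1,0,0,0), (0,0,0,0), (-4,3,-5,2)),
   ((1,0,0,0), (2,-3,3,-1), (-5,4,-5,2)),
   ((1,0,0,0), (3,-3,3,-1), (-5,4,-5,2)),
   ((1,0,0,0), (2,-3,3,-1), (-4,4,-5,2)),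
   ((1,0,0,0), (1,-2,3,-1), (-4,4,-5,2)),
   ((1,0,0,0), (2,-2,3,-1), (-4,4,-5,2)),
   ((0,0,0,0), (1,0,0,0), (-4,4,-5,2)),
   ((1,0,0,0), (2,-3,3,-1), (-4,4,-4,2)),
   ((0,0,0,0), (1,0,0,0), (-2,2,-3,2)),
   ((1,0,0,0), (0,0,0,0), (-2,3,-3,2)),
   ((1,0,0,0), (7,-7,8,-3), (-7,6,-8,3)),
   ((1,0,0,0), (6,-6,8,-3), (-7,6,-8,3)),
   ((1,0,0,0), (3,-4,5,-2), (-7,6,-8,3)),
   ((1,0,0,0), (4,-4,5,-2), (-7,6,-8,3)),
   ((1,0,0,0), (3,-3,5,-2), (-7,6,-8,3)),
   ((1,0,0,0), (4,-3,5,-2), (-7,6,-8,3)),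
   ((1,0,0,0), (5,-6,6,-2), (-7,6,-8,3)),
   ((1,0,0,0), (4,-5,6,-2), (-7,6,-8,3)),
   ((1,0,0,0), (5,-5,6,-2), (-7,6,-8,3)),
   ((3,0,0,0), (11,-12,14,-5), (-21,18,-24,9)),
   ((1,0,0,0), (2,-3,3,-1), (-7,6,-8,3)),
   ((1,0,0,0), (3,-3,3,-1), (-7,6,-8,3)),
   ((1,0,0,0), (0,0,0,0), (-7,6,-8,3)),
   ((1,0,0,0), (0,-2,1,0), (-7,6,-8,3)),
   ((1,0,0,0), (-2,1,-2,1), (-7,6,-8,3)),
   ((1,0,0,0), (3,-3,5,-2), (-6,6,-8,3)),
   ((0,0,0,0), (1,0,0,0), (-6,5,-7,3)),
   ((1,0,0,0), (3,-4,5,-2), (-6,6,-7,3)),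
   ((1,0,0,0), (2,-3,3,-1), (-4,5,-5,3)),
   ((1,0,0,0), (1,-2,2,0), (-4,5,-5,3)),
   ((0,0,0,0), (1,0,0,0), (-3,4,-4,3)),
   ((1,0,0,0), (7,-7,8,-3), (-10,8,-11,4)),
   ((1,0,0,0), (5,-5,6,-2), (-9,8,-10,4)),
   ((1,0,0,0), (6,-6,8,-3), (-11,10,-13,5)),
   ((1,0,0,0), (2,-3,3,-1), (-14,12,-16,6)),
   ((1,0,0,0), (11,-10,13,-5), (-20,17,-23,9)),
   ((1,0,0,0), (15,-13,18,-7), (-28,24,-33,13))]"

definition blocks :: "(nat list \<times> z4 \<times> z4 \<times> z4) list" where
  "blocks = zip block_list point_list"

lemma R35_eq: "R35 w = evv w ` set normal_list"
  unfolding R35_def normal_list_def list.set image_insert image_empty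
  by (intro arg_cong2[where f = insert] refl) (simp_all add: evv_def ev_def algebra_simps)

lemma length_normal_list: "length normal_list = 35" by (simp add: normal_list_def)

section \<open>Combinatorial data\<close>

text \<open>Generators of the dihedral group, as permutations of the planes given by their values. The third permutation
  relates the arrangements of the two parameters.\<close>

definition rot_list :: "nat list" where "rot_list = [1, 10, 13, 16, 19, 25, 30, 12, 15, 3, 5, 17, 29, 23, 24, 14, 7, 2, 4, 6, 32, 20, 31, 18, 9, 0, 21, 34, 33, 8, 11, 26, 28, 27, 22]"
definition refl_list :: "nat list" where "refl_list = [0, 25, 4, 8, 2, 10, 11, 12, 3, 15, 5, 6, 7, 18, 24, 9, 29, 19, 13, 17, 20, 32, 27, 23, 14, 1, 28, 22, 26, 16, 30, 33, 21, 31, 34]"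
definition conj_list :: "nat list" where "conj_list = [0, 1, 19, 8, 17, 5, 13, 14, 3, 29, 10, 18, 24, 6, 7, 16, 15, 4, 11, 2, 34, 27, 32, 30, 12, 25, 33, 21, 31, 9, 23, 28, 22, 26, 20]"

text \<open>The entries off the diagonal are the values of \<open>colour\<close> (\<open>colour_eq\<close>); 0 on the diagonal is a value that no pair has.\<close>

definition colour_table :: "nat list list" where
  "colour_table =
  [[0,5,5,3,5,5,5,5,3,3,5,5,5,5,5,3,3,5,5,5,2,5,5,2,5,5,3,5,3,3,2,3,5,3,2],
   [5,0,5,3,5,5,5,3,3,5,5,2,5,5,3,3,3,5,2,5,5,3,2,5,5,5,3,3,5,5,5,5,2,3,5],
   [5,5,0,4,5,2,5,4,5,4,5,5,3,4,5,5,4,4,2,4,5,2,5,5,3,5,4,5,5,5,2,2,3,4,3],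
   [3,3,4,0,5,5,5,4,3,5,5,4,3,4,3,4,5,4,5,5,4,3,3,3,4,3,3,4,2,4,3,3,4,2,4],
   [5,5,5,5,0,5,5,3,4,5,2,5,4,2,3,4,5,4,4,4,5,3,5,5,5,5,5,5,4,4,2,4,2,2,3],
   [5,5,2,5,5,0,5,3,5,3,5,5,3,5,3,5,5,5,5,2,3,5,3,5,3,5,2,5,5,3,5,5,3,2,3],
   [5,5,5,5,5,5,0,5,4,3,5,5,5,4,4,4,5,2,2,4,5,4,5,5,4,2,5,4,5,3,4,3,3,2,2],
   [5,3,4,4,3,3,5,0,3,3,3,5,5,4,3,4,5,3,4,5,3,3,4,4,4,5,3,2,4,4,5,4,3,4,2],
   [3,3,5,3,4,5,4,3,0,4,5,5,4,5,4,5,4,5,4,4,4,4,4,3,3,3,2,3,3,5,3,2,3,3,4],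
   [3,5,4,5,5,3,3,3,4,0,5,4,4,3,4,3,4,4,5,5,4,4,3,5,5,3,3,4,2,3,4,3,2,4,3],
   [5,5,5,5,2,5,5,3,5,5,0,5,3,5,3,3,3,2,5,5,3,3,5,5,3,5,5,3,2,5,5,2,5,5,3],
   [5,2,5,4,5,5,5,5,5,4,5,0,5,2,4,3,3,4,4,2,5,3,4,5,4,5,5,5,5,5,4,2,4,3,2],
   [5,5,3,3,4,3,5,5,4,4,3,5,0,4,4,3,4,5,4,3,3,3,2,4,3,3,4,4,3,5,5,4,3,4,2],
   [5,5,4,4,2,5,4,4,5,3,5,2,4,0,5,5,4,5,5,5,2,4,3,4,5,2,2,4,3,3,5,5,5,5,5],
   [5,3,5,3,3,3,4,3,4,4,3,4,4,5,0,5,4,3,5,4,2,2,3,5,5,5,4,3,4,3,4,4,4,3,3],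
   [3,3,5,4,4,5,4,4,5,3,3,3,3,5,5,0,3,5,3,4,4,2,4,5,4,5,2,3,3,4,4,4,4,3,3],
   [3,3,4,5,5,5,5,5,4,4,3,3,4,4,4,3,0,4,3,5,3,3,4,4,3,5,3,2,4,3,5,3,4,2,4],
   [5,5,4,4,4,5,2,3,5,4,2,4,5,5,3,5,4,0,5,5,3,5,2,2,4,5,2,3,4,5,5,4,5,5,5],
   [5,2,2,5,4,5,2,4,4,5,5,4,4,5,5,3,3,5,0,5,2,5,4,4,5,5,3,3,2,4,5,5,4,5,5],
   [5,5,4,5,4,2,4,5,4,5,5,2,3,5,4,4,5,5,5,0,3,5,3,2,3,5,4,2,2,4,5,5,5,4,5],
   [2,5,5,4,5,3,5,3,4,4,3,5,3,2,2,4,3,3,2,3,0,4,3,4,2,5,5,3,5,3,4,3,4,3,4],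
   [5,3,2,3,3,5,4,3,4,4,3,3,3,4,2,2,3,5,5,5,4,0,3,2,4,2,4,4,3,4,5,5,5,3,3],
   [5,2,5,3,5,3,5,4,4,3,5,4,2,3,3,4,4,2,4,3,3,3,0,5,3,3,5,5,3,2,2,4,4,3,4],
   [2,5,5,3,5,5,5,4,3,5,5,5,4,4,5,5,4,2,4,2,4,2,5,0,5,5,5,5,5,4,4,3,2,3,4],
   [5,5,3,4,5,3,4,4,3,5,3,4,3,5,5,4,3,4,5,3,2,4,3,5,0,3,4,3,4,4,4,3,2,4,3],
   [5,5,5,3,5,5,2,5,3,3,5,5,3,2,5,5,5,5,5,5,5,2,3,5,3,0,5,2,3,3,5,3,3,5,5],
   [3,3,4,3,5,2,5,3,2,3,5,5,4,2,4,2,3,2,3,4,5,4,5,5,4,5,0,3,3,4,3,4,3,4,3],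
   [5,3,5,4,5,5,4,2,3,4,3,5,4,4,3,3,2,3,3,2,3,4,5,5,3,2,3,0,5,4,2,3,3,4,4],
   [3,5,5,2,4,5,5,4,3,2,2,5,3,3,4,3,4,4,2,2,5,3,3,5,4,3,3,5,0,3,3,4,4,4,3],
   [3,5,5,4,4,3,3,4,5,3,5,5,5,3,3,4,3,5,4,4,3,4,2,4,4,3,4,4,3,0,5,2,3,3,4],
   [2,5,2,3,2,5,4,5,3,4,5,4,5,5,4,4,5,5,5,5,4,5,2,4,4,5,3,2,3,5,0,5,5,5,4],
   [3,5,2,3,4,5,3,4,2,3,2,2,4,5,4,4,3,4,5,5,3,5,4,3,3,3,4,3,4,2,5,0,3,3,5],
   [5,2,3,4,2,3,3,3,3,2,5,4,3,5,4,4,4,5,4,5,4,5,4,2,2,3,3,3,4,3,5,3,0,5,3],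
   [3,3,4,2,2,2,2,4,3,4,5,3,4,5,3,3,2,5,5,4,3,3,3,3,4,5,4,4,4,3,5,3,5,0,5],
   [2,5,3,4,3,3,2,2,4,3,3,2,2,5,3,3,4,5,5,5,4,3,4,4,3,5,3,4,3,4,4,5,3,5,0]]"

definition row_of :: "nat \<Rightarrow> nat list" where
  "row_of i = (let Ps = filter (\<lambda>P. i \<in> set P) block_list in
     map (\<lambda>j. if i = j then 0 else case find (\<lambda>P. j \<in> set P) Ps of None \<Rightarrow> 0 | Some P \<Rightarrow> length P) [0..<35])"

text \<open>The numbers of pairs of colours 4 and 5 at each plane, a first invariant of the planes.\<close>

definition profiles :: "(nat \<times> nat) list" where
  "profiles = [(0, 20), (0, 20), (9, 16), (12, 8), (9, 16), (0, 20), (9, 16), (12, 8), (12, 8), (12, 8), (0, 20), (9, 16), (12, 8), (9, 16), (12, 8), (12, 8), (12, 8), (9, 16), (9, 16), (9, 16), (9, 8), (9, 8), (9, 8), (9, 16), (12, 8), (0, 20), (9, 8), (9, 8), (9, 8), (12, 8), (9, 16), (9, 8), (9, 8), (9, 8), (9, 8)]"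

lemma rows_check: "map row_of [0..<35] = colour_table"
  by code_simp

lemma profiles_check: "map (\<lambda>row. (length (filter ((=) 4) row), length (filter ((=) 5) row))) colour_table = profiles"
  by code_simp

lemma mirrors_check: "map fst (filter (\<lambda>(i, t). t = (0, 20)) (zip [0..<35] profiles)) = [0, 1, 5, 10, 25]"
  by code_simp

text \<open>The pair of planes \<open>(0, 27)\<close> serves as a base. The five planes with the profile of plane 0, and then colours and
  profiles, leave only these 20 candidates for its image.\<close>

lemma base_images_check:
  "concat (map (\<lambda>p. map (\<lambda>(q, _, _). (p, q)) (filter (\<lambda>(q, c, t). c = 5 \<and> t = (9, 8) \<and> q \<noteq> p) (zip [0..<35] (zip (colour_table ! p) profiles)))) [0, 1, 5, 10, 25])
   = [(0, 21), (0, 22), (0, 27), (0, 32), (1, 20), (1, 28), (1, 31), (1, 34), (5, 21), (5, 27), (5, 28), (5, 31), (10, 22), (10, 26), (10, 32), (10, 33), (25, 20), (25, 26), (25, 33), (25, 34)]"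
  by code_simp

definition base_signature :: "((nat \<times> nat) \<times> nat \<times> nat) list" where
  "base_signature = [((0, 20), 0, 5), ((0, 20), 5, 3), ((9, 16), 5, 5), ((12, 8), 3, 4), ((9, 16), 5, 5), ((0, 20), 5, 5), ((9, 16), 5, 4), ((12, 8), 5, 2), ((12, 8), 3, 3), ((12, 8), 3, 4), ((0, 20), 5, 3), ((9, 16), 5, 5), ((12, 8), 5, 4), ((9, 16), 5, 4), ((12, 8), 5, 3), ((12, 8), 3, 3), ((12, 8), 3, 2), ((9, 16), 5, 3), ((9, 16), 5, 3), ((9, 16), 5, 2), ((9, 8), 2, 3), ((9, 8), 5, 4), ((9, 8), 5, 5), ((9, 16), 2, 5), ((12, 8), 5, 3), ((0, 20), 5, 2), ((9, 8), 3, 3), ((9, 8), 5, 0), ((9, 8), 3, 5), ((12, 8), 3, 4), ((9, 16), 2, 2), ((9, 8), 3, 3), ((9, 8), 5, 3), ((9, 8), 3, 4), ((9, 8), 2, 4)]"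

lemma base_signature_check: "zip profiles (zip (colour_table ! 0) (colour_table ! 27)) = base_signature"
  by code_simp

text \<open>Profiles and the colours towards the base distinguish the planes 7, 22 and 28 from all others.\<close>

lemma base_fixes_check:
  "map (\<lambda>g. map fst (filter (\<lambda>(x, g'). g = g') (zip [0..<35] base_signature))) (map (nth base_signature) [0, 7, 22, 28]) = [[0], [7], [22], [28]]"
  by code_simp

text \<open>The colours towards 0, 7, 22 and 28 as digits in base 6; they distinguish all planes.\<close>

definition row_keys :: "nat list" where "row_keys = [858, 1175, 1289, 567, 1067, 1211, 1295, 1013, 813, 561, 635, 1259, 755, 785, 995, 819, 1041, 959, 605, 575, 1208, 779, 677, 1286, 1001, 791, 849, 1277, 135, 747, 752, 1035, 1031, 999, 806]"

lemma row_keys_check: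
  "foldr (\<lambda>s ks. map2 (\<lambda>c k. c + 6 * k) (colour_table ! s) ks) [0, 7, 22, 28] (replicate 35 0) = row_keys"
  by code_simp

lemma distinct_row_keys: "distinct row_keys"
  by code_simp

lemma rot_list_blocks: "\<forall>P \<in> set block_list. sort (map (nth rot_list) P) \<in> set block_list"
  by code_simp

lemma refl_list_blocks: "\<forall>P \<in> set block_list. sort (map (nth refl_list) P) \<in> set block_list"
  by code_simp

lemma rot_list_bound: "length rot_list = 35" "\<forall>i \<in> set rot_list. i < 35" "distinct rot_list"
  by code_simp+

lemma refl_list_bound: "length refl_list = 35" "\<forall>i \<in> set refl_list. i < 35" "distinct refl_list"
  by code_simp+

lemma rot_order: "\<forall>i \<in> set [0..<35]. ((nth rot_list) ^^ 10) i = i"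
  by code_simp

lemma refl_order: "\<forall>i \<in> set [0..<35]. refl_list ! (refl_list ! i) = i"
  by code_simp

lemma refl_rot: "\<forall>i \<in> set [0..<35]. refl_list ! (rot_list ! (refl_list ! (rot_list ! i))) = i"
  by code_simp

lemma base_images:
  "\<forall>(p, q) \<in> set [(0, 21), (0, 22), (0, 27), (0, 32), (1, 20), (1, 28), (1, 31), (1, 34), (5, 21), (5, 27), (5, 28), (5, 31), (10, 22), (10, 26), (10, 32), (10, 33), (25, 20), (25, 26), (25, 33), (25, 34)]. \<exists>k \<in> set [0..<10]. \<exists>b \<in> set [False, True].
     ((nth rot_list) ^^ k) (if b then refl_list ! 0 else 0) = p \<and> ((nth rot_list) ^^ k) (if b then refl_list ! 27 else 27) = q"
  by code_simp

lemma base_stabilizer: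
  "\<forall>k \<in> set [0..<10]. \<forall>b \<in> set [False, True].
     ((nth rot_list) ^^ k) (if b then refl_list ! 0 else 0) = 0 \<and> ((nth rot_list) ^^ k) (if b then refl_list ! 27 else 27) = 27 \<longrightarrow> k = 0 \<and> \<not> b"
  by code_simp

lemma incidence_check: "\<forall>(P, q) \<in> set blocks. \<forall>i \<in> set P. dot4 (normal_list ! i) q = (0, 0, 0, 0)"
  by code_simp

lemma standard_check: "\<forall>u \<in> set normal_list \<union> snd ` set blocks. lead u dvd 66 \<and> standard (standardize u)"
  by code_simp

lemma distinct_normal_list: "distinct (map standardize normal_list)"
  by code_simp

text \<open>The lists are sorted by this value, so that distinctness of the 171 lines becomes a check of neighbours instead of
  all pairs.\<close>

definition point_key :: "z4 \<times> z4 \<times> z4 \<Rightarrow> int" where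
  "point_key = (\<lambda>(_, (a, b, c, d), (e, f, g, h)).
     a + 10 * (b + 10 * (c + 10 * (d + 10 * (e + 10 * (f + 10 * (g + 10 * h)))))))"

lemma increasing_keys: "successively (<) (map (\<lambda>b. point_key (standardize (snd b))) blocks)"
  by code_simp

lemma distinct_points: "distinct (map (\<lambda>b. standardize (snd b)) blocks)"
proof -
  have "distinct (map point_key (map (\<lambda>b. standardize (snd b)) blocks))"
    using increasing_keys by (simp add: successively_conv_sorted_wrt strict_sorted_iff comp_def)
  then show ?thesis by (simp only: distinct_map)
qed

lemma blocks_check: "\<forall>P \<in> set block_list. sorted_wrt (<) P \<and> (\<forall>i\<in>set P. i < 35) \<and> 2 \<le> length P"
  by code_simp

lemma count_pairs: "(\<Sum>P\<leftarrow>block_list. length P * (length P - 1)) = 35 * 34"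
  by code_simp

lemma count_incidences: "(\<Sum>P\<leftarrow>block_list. length P) = 510" "(\<Sum>P\<leftarrow>block_list. length P - 1) = 339"
  by code_simp+

lemma length_block_list: "length block_list = 171" "length point_list = 171"
  by code_simp+

text \<open>The inverse \<open>3 - 3 \<omega> + 3 \<omega>\<^sup>2 - \<omega>\<^sup>3\<close> of \<open>\<omega>\<close>.\<close>

definition winv :: z4 where "winv = (3, - 3, 3, - 1)"

text \<open>The Galois conjugation \<open>\<omega> \<mapsto> 1/\<omega>\<close>, by Horner's scheme.\<close>

definition conj4 :: "z4 \<Rightarrow> z4" where
  "conj4 = (\<lambda>(a, b, c, d). add4 (a, 0, 0, 0) (mul4 winv (add4 (b, 0, 0, 0)
     (mul4 winv (add4 (c, 0, 0, 0) (mul4 winv (d, 0, 0, 0)))))))"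

definition twist4 :: "z4 \<times> z4 \<times> z4 \<Rightarrow> z4 \<times> z4 \<times> z4" where
  "twist4 = (\<lambda>(x, y, z). (add4 (mul4 (0, - 1, 0, 0) x) (mul4 (1, - 1, 1, - 1) z), add4 y (mul4 (- 1, 0, - 1, 0) z), mul4 (0, 0, - 1, 0) z))"

definition cross4 :: "z4 \<times> z4 \<times> z4 \<Rightarrow> z4 \<times> z4 \<times> z4 \<Rightarrow> z4 \<times> z4 \<times> z4" where
  "cross4 = (\<lambda>(x, y, z) (x', y', z'). (add4 (mul4 y z') (scale4 (- 1) (mul4 z y')),
     add4 (mul4 z x') (scale4 (- 1) (mul4 x z')), add4 (mul4 x y') (scale4 (- 1) (mul4 y x'))))"

text \<open>The linear map takes each normal to a multiple of a conjugate normal.\<close>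

lemma twist_check:
  "\<forall>(u, i) \<in> set (zip normal_list conj_list). cross4 (twist4 u) (map_prod conj4 (map_prod conj4 conj4) (normal_list ! i)) = ((0,0,0,0),(0,0,0,0),(0,0,0,0))"
  by code_simp

lemma conj_list_bound: "length conj_list = 35" "\<forall>i \<in> set conj_list. i < 35" "distinct conj_list"
  by code_simp+

section \<open>The incidences of the arrangement\<close>

definition normal_of :: "real \<Rightarrow> nat \<Rightarrow> real^3" where
  "normal_of w i = evv w (normal_list ! i)"

definition block :: "nat \<Rightarrow> nat set" where
  "block k = set (block_list ! k)"

definition point_of :: "real \<Rightarrow> nat \<Rightarrow> real^3" where
  "point_of w k = evv w (point_list ! k)"

abbreviation n_blocks :: nat where "n_blocks \<equiv> length block_list"

lemma nth_blocks: "k < n_blocks \<Longrightarrow> blocks ! k = (block_list ! k, point_list ! k)" "length blocks = n_blocks"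
  by (simp_all add: blocks_def length_block_list)

lemma block_in_blocks: "k < n_blocks \<Longrightarrow> (block_list ! k, point_list ! k) \<in> set blocks"
  using nth_blocks by (metis nth_mem)

lemma point_in_blocks: "k < n_blocks \<Longrightarrow> point_list ! k \<in> set normal_list \<union> snd ` set blocks"
  using block_in_blocks[of k] by (force simp: image_iff)

lemma evv_standard_neq_0: "standard u \<Longrightarrow> evv w u \<noteq> 0"
  by (cases u) (auto simp: standard_def evv_def vec_eq_iff forall_3 ev_def)

lemma evv_parallel_imp_standardize_eq:
  assumes w: "is_parameter w" and u: "u \<in> set normal_list \<union> snd ` set blocks" and v: "v \<in> set normal_list \<union> snd ` set blocks"
    and eq: "evv w u = c *\<^sub>R evv w v"
  shows "standardize u = standardize v"
proof -
  define k l where "k = (of_int (66 div lead u) :: real)" and "l = (of_int (66 div lead v) :: real)"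
  have "lead v dvd 66" using standard_check v by blast
  then have "66 div lead v * lead v = 66" by simp
  then have "66 div lead v \<noteq> 0" by auto
  then have l: "l \<noteq> 0" by (simp add: l_def)
  have s: "standard (standardize u)" "standard (standardize v)" using standard_check u v by blast+
  have "evv w (standardize u) = (k * c / l) *\<^sub>R evv w (standardize v)"
    using l by (simp add: evv_standardize eq flip: k_def l_def)
  then show ?thesis using standard_parallel_imp_eq[OF w s] by blast
qed

context
  fixes w :: real
  assumes w: "is_parameter w"
begin

lemma normal_of_neq_0:
  assumes "i < 35" shows "normal_of w i \<noteq> 0"
proof -
  have "standard (standardize (normal_list ! i))"
    using bspec[OF standard_check, of "normal_list ! i"] assms length_normal_list by simp
  moreover have "evv w (standardize (normal_list ! i)) = 0" if "normal_of w i = 0"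
    unfolding evv_standardize that[unfolded normal_of_def] by (rule scaleR_zero_right)
  ultimately show ?thesis using evv_standard_neq_0 by blast
qed

lemma point_of_neq_0:
  assumes "k < n_blocks" shows "point_of w k \<noteq> 0"
proof -
  have "standard (standardize (point_list ! k))"
    using bspec[OF standard_check point_in_blocks[OF assms]] by blast
  moreover have "evv w (standardize (point_list ! k)) = 0" if "point_of w k = 0"
    unfolding evv_standardize that[unfolded point_of_def] by (rule scaleR_zero_right)
  ultimately show ?thesis using evv_standard_neq_0 by blast
qed

lemma normal_of_nonparallel:
  assumes "i < 35" "j < 35" "i \<noteq> j" shows "cross3 (normal_of w i) (normal_of w j) \<noteq> 0"
proof
  assume "cross3 (normal_of w i) (normal_of w j) = 0"
  then obtain c where "normal_of w j = c *\<^sub>R normal_of w i"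
    using cross3_eq_0_imp_multiple normal_of_neq_0 assms(1) by blast
  then have "standardize (normal_list ! j) = standardize (normal_list ! i)"
    using evv_parallel_imp_standardize_eq[OF w] assms length_normal_list unfolding normal_of_def
    by (metis UnI1 nth_mem)
  then show False using distinct_normal_list assms length_normal_list by (auto simp: distinct_conv_nth)
qed

lemma point_of_parallel_imp_eq:
  assumes "k < n_blocks" "l < n_blocks" "point_of w k = c *\<^sub>R point_of w l" shows "k = l"
proof -
  have "standardize (point_list ! k) = standardize (point_list ! l)"
    using evv_parallel_imp_standardize_eq[OF w point_in_blocks point_in_blocks] assms unfolding point_of_def by blast
  then have "map (\<lambda>b. standardize (snd b)) blocks ! k = map (\<lambda>b. standardize (snd b)) blocks ! l"
    using assms(1,2) by (simp add: nth_blocks)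
  then show ?thesis using nth_eq_iff_index_eq[OF distinct_points, of k l] assms(1,2) by (simp add: nth_blocks)
qed

lemma block_less: "k < n_blocks \<Longrightarrow> i \<in> block k \<Longrightarrow> i < 35"
  using blocks_check unfolding block_def by (meson nth_mem)

lemma finite_block [simp]: "finite (block k)" by (simp add: block_def)

lemma card_block: "k < n_blocks \<Longrightarrow> card (block k) = length (block_list ! k)"
proof -
  assume "k < n_blocks"
  then have "sorted_wrt (<) (block_list ! k)" using blocks_check by (meson nth_mem)
  then show ?thesis unfolding block_def by (simp add: distinct_card strict_sorted_iff)
qed

lemma card_block_ge_2: "k < n_blocks \<Longrightarrow> 2 \<le> card (block k)"
  using blocks_check card_block by (metis nth_mem)

lemma incident:
  assumes "k < n_blocks" "i \<in> block k" shows "normal_of w i \<bullet> point_of w k = 0"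
proof -
  have "dot4 (normal_list ! i) (point_list ! k) = (0, 0, 0, 0)"
    using bspec[OF incidence_check block_in_blocks[OF assms(1)]] assms(2) unfolding block_def by simp
  then show ?thesis by (simp add: normal_of_def point_of_def inner_evv[OF w])
qed

text \<open>The direction vectors of the blocks are pairwise independent, and two planes meet in one line only.\<close>

lemma block_unique:
  assumes "k < n_blocks" "l < n_blocks" "{i, j} \<subseteq> block k \<inter> block l" "i \<noteq> j" shows "k = l"
proof -
  have ij: "i < 35" "j < 35" using assms block_less by auto
  define c where "c = cross3 (normal_of w i) (normal_of w j)"
  have "c \<noteq> 0" using normal_of_nonparallel ij assms(4) by (simp add: c_def)
  obtain s t where st: "point_of w k = s *\<^sub>R c" "point_of w l = t *\<^sub>R c"
    using orthogonal_imp_cross3_multiple[OF normal_of_nonparallel[OF ij assms(4)]] incident assms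
    unfolding c_def by (metis Int_iff insert_subset)
  then have "t \<noteq> 0" using point_of_neq_0 assms(2) by auto
  then have "point_of w k = (s / t) *\<^sub>R point_of w l" using st by simp
  then show ?thesis using point_of_parallel_imp_eq assms(1,2) by blast
qed

text \<open>By counting: the ordered pairs inside the blocks are disjoint by \<open>block_unique\<close>, and there are as many of
  them as pairs of planes. So no pair of planes has to be examined individually.\<close>

lemma block_exists:
  assumes "i < 35" "j < 35" "i \<noteq> j" shows "\<exists>k<n_blocks. i \<in> block k \<and> j \<in> block k"
proof -
  let ?D = "\<lambda>k. {(i, j). i \<in> block k \<and> j \<in> block k \<and> i \<noteq> j}"
  have D: "?D k = block k \<times> block k - (\<lambda>i. (i, i)) ` block k" for k by auto
  have cD: "card (?D k) = card (block k) * (card (block k) - 1)" for k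
    unfolding D by (subst card_Diff_subset)
      (auto simp: card_cartesian_product card_image inj_on_def right_diff_distrib')
  have "card (\<Union>k<n_blocks. ?D k) = (\<Sum>k<n_blocks. card (?D k))"
  proof (rule card_UN_disjoint)
    show "\<forall>k\<in>{..<n_blocks}. finite (?D k)" by (auto simp: D)
    show "\<forall>k\<in>{..<n_blocks}. \<forall>l\<in>{..<n_blocks}. k \<noteq> l \<longrightarrow> ?D k \<inter> ?D l = {}"
    proof (intro ballI impI equals0I)
      fix k l p assume kl: "k \<in> {..<n_blocks}" "l \<in> {..<n_blocks}" "k \<noteq> l" and p: "p \<in> ?D k \<inter> ?D l"
      then obtain i j where "{i, j} \<subseteq> block k \<inter> block l" "i \<noteq> j" by auto
      then show False using block_unique[of k l i j] kl by simp
    qed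
  qed simp
  also have "\<dots> = (\<Sum>k<n_blocks. length (block_list ! k) * (length (block_list ! k) - 1))"
    by (rule sum.cong) (auto simp: cD card_block)
  also have "\<dots> = 35 * 34"
    using count_pairs by (simp add: sum_list_sum_nth lessThan_atLeast0)
  finally have c: "card (\<Union>k<n_blocks. ?D k) = 35 * 34" .
  define E where "E = {..<35::nat} \<times> {..<35::nat} - (\<lambda>i. (i, i)) ` {..<35}"
  have "card E = 35 * 34" unfolding E_def
    by (subst card_Diff_subset) (auto simp: card_cartesian_product card_image inj_on_def)
  moreover have "(\<Union>k<n_blocks. ?D k) \<subseteq> E" using block_less by (auto simp: E_def)
  ultimately have "(\<Union>k<n_blocks. ?D k) = E" by (intro card_subset_eq) (auto simp: c E_def)
  moreover have "(i, j) \<in> E" using assms by (auto simp: E_def)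
  ultimately show ?thesis by blast
qed

lemma incident_iff:
  assumes "k < n_blocks" "i < 35" shows "normal_of w i \<bullet> point_of w k = 0 \<longleftrightarrow> i \<in> block k"
proof
  assume 0: "normal_of w i \<bullet> point_of w k = 0"
  show "i \<in> block k"
  proof (rule ccontr)
    assume i: "i \<notin> block k"
    obtain j where j: "j \<in> block k" using card_block_ge_2[OF assms(1)] by fastforce
    then have ij: "j < 35" "i \<noteq> j" using i block_less assms by auto
    obtain l where l: "l < n_blocks" "i \<in> block l" "j \<in> block l" using block_exists[OF assms(2) ij(1,2)] by blast
    define c where "c = cross3 (normal_of w i) (normal_of w j)"
    obtain s t where st: "point_of w k = s *\<^sub>R c" "point_of w l = t *\<^sub>R c"
      using orthogonal_imp_cross3_multiple[OF normal_of_nonparallel[OF assms(2) ij]] incident assms j l 0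
      unfolding c_def by metis
    then have "t \<noteq> 0" using point_of_neq_0 l(1) by auto
    then have "point_of w k = (s / t) *\<^sub>R point_of w l" using st by simp
    then show False using point_of_parallel_imp_eq assms(1) l i by blast
  qed
qed (use incident assms in auto)

lemma normal_arrangement: "plane_arrangement (normal_of w) 35"
proof
  fix x assume 0: "\<And>i. i < 35 \<Longrightarrow> normal_of w i \<bullet> x = 0"
  have "normal_of w 0 = vector [1, 0, 0]" "normal_of w 1 = vector [0, 1, 0]" "normal_of w 2 = vector [0, 0, 1]"
    by (simp_all add: normal_of_def normal_list_def evv_def ev_def)
  then show "x = 0" using 0[of 0] 0[of 1] 0[of 2] by (simp add: inner_vec_def sum_3 vec_eq_iff forall_3)
qed (use normal_of_neq_0 normal_of_nonparallel in auto)

interpretation pa: plane_arrangement "normal_of w" 35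
  by (rule normal_arrangement)

lemma A35_eq: "A35 w = form_kernel ` normal_of w ` {..<35}"
proof -
  have "set normal_list = (\<lambda>i. normal_list ! i) ` {..<35}"
    using length_normal_list by (auto simp: set_conv_nth)
  then show ?thesis unfolding A35_def R35_eq by (simp add: image_image normal_of_def)
qed

lemma A35_arr: "A35 w = pa.arr"
  by (simp add: A35_eq image_image)

definition blk_line :: "nat \<Rightarrow> (real^3) set" where
  "blk_line k = span {point_of w k}"

lemma idx_blk_line: "k < n_blocks \<Longrightarrow> pa.idx (blk_line k) = block k"
proof -
  assume k: "k < n_blocks"
  have "blk_line k \<subseteq> form_kernel (normal_of w i) \<longleftrightarrow> i \<in> block k" if "i < 35" for i
  proof -
    have "blk_line k \<subseteq> form_kernel (normal_of w i) \<longleftrightarrow> normal_of w i \<bullet> point_of w k = 0"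
    proof
      assume "blk_line k \<subseteq> form_kernel (normal_of w i)"
      moreover have "point_of w k \<in> blk_line k" by (simp add: blk_line_def span_base)
      ultimately show "normal_of w i \<bullet> point_of w k = 0" by (auto simp: form_kernel_def)
    next
      assume "normal_of w i \<bullet> point_of w k = 0"
      then show "blk_line k \<subseteq> form_kernel (normal_of w i)"
        unfolding blk_line_def by (intro span_minimal subspace_form_kernel) (auto simp: form_kernel_def)
    qed
    then show ?thesis using incident_iff[OF k that] by simp
  qed
  then show ?thesis using block_less[OF k] by (auto simp: pa.idx_def)
qed

lemma block_line_eq:
  assumes "k < n_blocks" "i \<in> block k" "j \<in> block k" "i \<noteq> j"
  shows "form_kernel (normal_of w i) \<inter> form_kernel (normal_of w j) = blk_line k"
proof -
  have ij: "i < 35" "j < 35" using block_less assms by auto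
  obtain c where c: "point_of w k = c *\<^sub>R cross3 (normal_of w i) (normal_of w j)"
    using orthogonal_imp_cross3_multiple[OF normal_of_nonparallel[OF ij assms(4)]] incident assms by metis
  then have "c \<noteq> 0" using point_of_neq_0 assms(1) by auto
  then show ?thesis
    unfolding blk_line_def c pa.plane_Int_plane[OF ij assms(4)] by (rule span_scale_singleton[symmetric])
qed

lemma rank2_eq: "pa.rank2 = blk_line ` {..<n_blocks}"
proof (intro equalityI subsetI)
  fix X assume "X \<in> pa.rank2"
  then obtain i j where ij: "i < 35" "j < 35" "i \<noteq> j" "X = form_kernel (normal_of w i) \<inter> form_kernel (normal_of w j)"
    by (auto simp: pa.rank2_def)
  then obtain k where "k < n_blocks" "i \<in> block k" "j \<in> block k" using block_exists by metis
  then show "X \<in> blk_line ` {..<n_blocks}" using block_line_eq ij by blast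
next
  fix X assume "X \<in> blk_line ` {..<n_blocks}"
  then obtain k where k: "k < n_blocks" "X = blk_line k" by auto
  obtain i j where "i \<in> block k" "j \<in> block k" "i \<noteq> j"
    using card_block_ge_2[OF k(1)] by (metis card_le_Suc0_iff_eq finite_block not_less_eq_eq numeral_2_eq_2)
  then show "X \<in> pa.rank2" using block_line_eq k block_less[OF k(1)] unfolding pa.rank2_def by blast
qed

lemma inj_blk_line: "inj_on blk_line {..<n_blocks}"
proof (rule inj_onI)
  fix k l assume kl: "k \<in> {..<n_blocks}" "l \<in> {..<n_blocks}" "blk_line k = blk_line l"
  then have "point_of w k \<in> span {point_of w l}" by (metis blk_line_def insertI1 span_base)
  then obtain c where "point_of w k = c *\<^sub>R point_of w l" by (auto simp: span_singleton)
  then show "k = l" using point_of_parallel_imp_eq kl by auto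
qed

lemma sum_over_rank2: "(\<Sum>X\<in>pa.rank2. f (pa.idx X)) = (\<Sum>k<n_blocks. f (block k))"
  unfolding rank2_eq by (simp add: sum.reindex[OF inj_blk_line] idx_blk_line)

lemma earlier_lines_339: "pa.earlier_lines = 339"
proof -
  have "pa.earlier_lines = (\<Sum>X\<in>pa.rank2. card (pa.idx X) - 1)" by (rule pa.sum_card_idx[symmetric])
  also have "\<dots> = (\<Sum>k<n_blocks. card (block k) - 1)" by (rule sum_over_rank2)
  also have "\<dots> = (\<Sum>k<n_blocks. length (block_list ! k) - 1)" by (intro sum.cong) (auto simp: card_block)
  also have "\<dots> = 339" using count_incidences(2) by (simp add: sum_list_sum_nth lessThan_atLeast0)
  finally show ?thesis .
qed

lemma incidences_510: "(\<Sum>X\<in>pa.rank2. card (pa.idx X)) = 510"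
proof -
  have "(\<Sum>X\<in>pa.rank2. card (pa.idx X)) = (\<Sum>k<n_blocks. card (block k))" by (rule sum_over_rank2)
  also have "\<dots> = (\<Sum>k<n_blocks. length (block_list ! k))" by (intro sum.cong) (auto simp: card_block)
  also have "\<dots> = 510" using count_incidences(1) by (simp add: sum_list_sum_nth lessThan_atLeast0)
  finally show ?thesis .
qed

end

section \<open>The two parameters\<close>

text \<open>The polynomial is reciprocal and equals \<open>(X\<^sup>2 - A X + 1) (X\<^sup>2 - B X + 1)\<close> with \<open>A, B = (3 \<plusminus> \<surd>5) / 2\<close>; only the
  first factor has real roots, since \<open>A > 2\<close> and \<open>0 < B < 2\<close>.\<close>

lemma parameter_cases:
  obtains p q :: real where "p \<noteq> q" "p * q = 1" "\<And>w. is_parameter w \<longleftrightarrow> w = p \<or> w = q"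
proof -
  define A B :: real where "A = (3 + sqrt 5) / 2" and "B = (3 - sqrt 5) / 2"
  have AB: "A + B = 3" "A * B = 1" by (simp_all add: A_def B_def field_simps)
  have "2 < sqrt 5" by (rule real_less_rsqrt) simp
  moreover have "sqrt 5 < 3" by (rule real_sqrt_less_iff[THEN iffD2, of 5 9, simplified])
  ultimately have A2: "2 < A" and B: "0 < B" "B < 2" by (simp_all add: A_def B_def)
  have A4: "0 < A^2 - 4" using A2 power_strict_mono[of 2 A 2] by simp
  define D where "D = sqrt (A^2 - 4)"
  have D: "0 < D" "D^2 = A^2 - 4" using A4 by (simp_all add: D_def)
  define p q where "p = (A + D) / 2" and "q = (A - D) / 2"
  have "is_parameter w \<longleftrightarrow> w = p \<or> w = q" for w
  proof -
    have "w^4 - 3*w^3 + 3*w^2 - 3*w + 1 = w^4 - (A + B) * w^3 + (2 + A * B) * w^2 - (A + B) * w + 1"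
      by (simp add: AB)
    also have "\<dots> = (w^2 - A * w + 1) * (w^2 - B * w + 1)"
      by (simp add: algebra_simps power2_eq_square power3_eq_cube power4_eq_xxxx)
    finally have "is_parameter w \<longleftrightarrow> (w^2 - A * w + 1) * (w^2 - B * w + 1) = 0" by (simp add: is_parameter_def)
    moreover have "w^2 - B * w + 1 \<noteq> 0"
    proof -
      have "B^2 < 4" using B power_strict_mono[of B 2 2] by simp
      then have "0 < (w - B / 2)^2 + (4 - B^2) / 4" by (intro add_nonneg_pos) simp_all
      also have "\<dots> = w^2 - B * w + 1" by (simp add: power2_eq_square field_simps)
      finally have "0 < w^2 - B * w + 1" .
      then show ?thesis by simp
    qed
    moreover have "w^2 - A * w + 1 = (w - p) * (w - q)"
    proof -
      have "(w - p) * (w - q) = w^2 - A * w + (A^2 - D^2) / 4"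
        by (simp add: p_def q_def power2_eq_square field_simps)
      then show ?thesis by (simp add: D)
    qed
    ultimately show ?thesis by simp
  qed
  moreover have "p \<noteq> q" using D by (simp add: p_def q_def)
  moreover have "p * q = 1"
  proof -
    have "p * q = (A^2 - D^2) / 4" by (simp add: p_def q_def power2_eq_square field_simps)
    then show ?thesis by (simp add: D)
  qed
  ultimately show ?thesis using that by blast
qed

lemma card_parameters: "card {w. is_parameter w} = 2"
proof -
  obtain p q :: real where pq: "p \<noteq> q" "\<And>w. is_parameter w \<longleftrightarrow> w = p \<or> w = q"
    using parameter_cases by metis
  then have "{w. is_parameter w} = {p, q}" by auto
  then show ?thesis using pq(1) by simp
qed

lemma parameter_product:
  assumes "is_parameter v" "is_parameter w" "v \<noteq> w" shows "v * w = 1"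
proof -
  obtain p q :: real where pq: "p * q = 1" "\<And>w. is_parameter w \<longleftrightarrow> w = p \<or> w = q"
    using parameter_cases by metis
  then show ?thesis using assms by (auto simp: mult.commute)
qed

section \<open>Oriented matroids\<close>

text \<open>A point \<open>x\<close> and its image under the adjoint \<open>U\<close> of \<open>T\<close> have the same signs with respect to the normals \<open>T v\<close> and
  \<open>v\<close>.\<close>

lemma isomorphic_oriented_matroids_transform:
  assumes adj: "\<And>v x. T v \<bullet> x = v \<bullet> U x" and U: "bij U"
    and S: "\<And>v. v \<in> S \<Longrightarrow> v \<noteq> 0" "\<And>v. v \<in> S \<Longrightarrow> T v \<noteq> 0"
  shows "isomorphic_oriented_matroids (form_kernel ` S) (form_kernel ` T ` S)"
proof -
  let ?A = "form_kernel ` S" and ?B = "form_kernel ` T ` S"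
  have ker: "form_kernel (T v) = U -` form_kernel v" for v by (auto simp: form_kernel_def adj)
  define n where "n H = (SOME v. v \<in> S \<and> form_kernel v = H)" for H
  have n: "n H \<in> S" "form_kernel (n H) = H" if "H \<in> ?A" for H
  proof -
    have "\<exists>v. v \<in> S \<and> form_kernel v = H" using that by auto
    from someI_ex[OF this] show "n H \<in> S" "form_kernel (n H) = H" by (auto simp: n_def)
  qed
  define \<phi> where "\<phi> H = U -` H" for H
  define m where "m K = T (n (U ` K))" for K
  have UU: "U ` \<phi> H = H" for H unfolding \<phi>_def using U by (simp add: surj_image_vimage_eq bij_is_surj)
  have m\<phi>: "m (\<phi> H) = T (n H)" for H by (simp add: m_def UU)
  have B_eq: "?B = \<phi> ` ?A" by (simp add: image_image ker \<phi>_def)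
  have "bij_betw \<phi> ?A ?B"
    unfolding bij_betw_def B_eq using UU by (metis inj_onI)
  moreover have "normals ?A n" using n S(1) by (auto simp: normals_def)
  moreover have "normals ?B m"
    unfolding normals_def B_eq
  proof
    fix K assume "K \<in> \<phi> ` ?A"
    then obtain H where H: "H \<in> ?A" "K = \<phi> H" by blast
    show "m K \<noteq> 0 \<and> form_kernel (m K) = K"
      using S(2)[OF n(1)[OF H(1)]] n(2)[OF H(1)] by (simp add: H(2) m\<phi> ker) (simp add: \<phi>_def)
  qed
  moreover have "(\<lambda>X. \<lambda>H\<in>?A. X (\<phi> H)) ` covectors ?B m = covectors ?A n"
  proof -
    have e: "(\<lambda>H\<in>?A. (\<lambda>K\<in>?B. sgn (m K \<bullet> x)) (\<phi> H)) = (\<lambda>H\<in>?A. sgn (n H \<bullet> U x))" for x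
    proof (rule restrict_ext)
      fix H assume "H \<in> ?A"
      then have "\<phi> H \<in> ?B" unfolding B_eq by (rule imageI)
      then show "(\<lambda>K\<in>?B. sgn (m K \<bullet> x)) (\<phi> H) = sgn (n H \<bullet> U x)"
        by (simp only: restrict_apply if_True m\<phi> adj)
    qed
    have "(\<lambda>X. \<lambda>H\<in>?A. X (\<phi> H)) ` covectors ?B m = range (\<lambda>x. \<lambda>H\<in>?A. sgn (n H \<bullet> U x))"
      unfolding covectors_def by (auto simp only: image_iff mem_Collect_eq e[symmetric])
    also have "\<dots> = (\<lambda>y. \<lambda>H\<in>?A. sgn (n H \<bullet> y)) ` range U" by (simp add: image_image)
    also have "\<dots> = covectors ?A n" using bij_is_surj[OF U] by (auto simp: covectors_def)
    finally show ?thesis .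
  qed
  ultimately show ?thesis unfolding isomorphic_oriented_matroids_def by blast
qed

lemma isomorphic_oriented_matroids_refl:
  assumes "\<And>v. v \<in> S \<Longrightarrow> v \<noteq> 0"
  shows "isomorphic_oriented_matroids (form_kernel ` S) (form_kernel ` S)"
  using isomorphic_oriented_matroids_transform[where T = "\<lambda>v. v" and U = "\<lambda>v. v" and S = S] assms
  by (simp add: bij_id[unfolded id_def])

lemma form_kernel_eq_if_parallel:
  fixes u v :: "real^3"
  assumes "cross3 u v = 0" "u \<noteq> 0" "v \<noteq> 0" shows "form_kernel u = form_kernel v"
proof -
  obtain c where c: "v = c *\<^sub>R u" using cross3_eq_0_imp_multiple[OF assms(1,2)] by blast
  then have "c \<noteq> 0" using assms(3) by auto
  then show ?thesis by (simp add: c form_kernel_def)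
qed

lemma evv_cross4:
  assumes "is_parameter w" shows "evv w (cross4 u v) = cross3 (evv w u) (evv w v)"
  by (cases u; cases v)
    (simp add: cross4_def cross3_def evv_nth vec_eq_iff forall_3 ev_add4 ev_scale4 ev_mul4[OF assms])

lemma ev_conj4:
  assumes "is_parameter w" "v * w = 1" shows "ev w (conj4 x) = ev v x"
proof -
  have "w \<noteq> 0" using assms(2) by auto
  have "w * ev w winv = 1"
    using assms(1) by (simp add: ev_def winv_def is_parameter_def algebra_simps power_numeral_reduce)
  then have W: "ev w winv = v" using assms(2) \<open>w \<noteq> 0\<close> by (metis mult.commute mult_left_cancel)
  obtain a b c d where x: "x = (a, b, c, d)" by (cases x)
  have C: "ev w (k, 0, 0, 0) = k" for k by (simp add: ev_def)
  show ?thesis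
    by (simp add: x conj4_def ev_add4 ev_mul4[OF assms(1)] W C) (simp add: ev_def algebra_simps power_numeral_reduce)
qed

text \<open>The map \<open>T\<close> and the permutation \<open>conj_list\<close> realize a combinatorial symmetry that involves the Galois conjugation; the relation of
  normals is checked in \<open>\<int>[\<omega>]\<close> through vanishing cross products.\<close>

lemma twisted_arrangement:
  assumes v: "is_parameter v" and w: "is_parameter w" and vw: "v * w = 1"
  shows "isomorphic_oriented_matroids (A35 w) (A35 v)"
proof -
  have w0: "w \<noteq> 0" using vw by auto
  define T :: "real^3 \<Rightarrow> real^3" where
    "T x = vector [- w * x $ 1 + (1 - w + w^2 - w^3) * x $ 3, x $ 2 - (1 + w^2) * x $ 3, - (w^2) * x $ 3]" for x
  define U :: "real^3 \<Rightarrow> real^3" where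
    "U x = vector [- w * x $ 1, x $ 2, (1 - w + w^2 - w^3) * x $ 1 - (1 + w^2) * x $ 2 - w^2 * x $ 3]" for x
  have adj: "T x \<bullet> y = x \<bullet> U y" for x y
    by (simp add: T_def U_def inner_vec_def sum_3 algebra_simps)
  have "bij U"
  proof (rule bijI)
    show "inj U"
      by (rule injI) (use w0 in \<open>auto simp: U_def vec_eq_iff forall_3\<close>)
    show "surj U"
    proof (rule surjI)
      fix y
      show "U (vector [- y $ 1 / w, y $ 2, ((1 - w + w^2 - w^3) * (- y $ 1 / w) - (1 + w^2) * y $ 2 - y $ 3) / w^2]) = y"
        using w0 by (simp add: U_def vec_eq_iff forall_3)
    qed
  qed
  have T0: "T x = 0 \<Longrightarrow> x = 0" for x
    using w0 by (auto simp: T_def vec_eq_iff forall_3)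
  have T_evv: "T (evv w u) = evv w (twist4 u)" for u
  proof -
    obtain x y z where u: "u = (x, y, z)" by (cases u)
    have c: "ev w (0, - 1, 0, 0) = - w" "ev w (1, - 1, 1, - 1) = 1 - w + w^2 - w^3"
      "ev w (- 1, 0, - 1, 0) = - (1 + w^2)" "ev w (0, 0, - 1, 0) = - (w^2)" by (simp_all add: ev_def)
    show ?thesis
      by (simp add: T_def u twist4_def evv_nth vec_eq_iff forall_3 ev_add4 ev_mul4[OF w] c algebra_simps)
  qed
  have conj: "evv w (map_prod conj4 (map_prod conj4 conj4) u) = evv v u" for u
    by (cases u) (simp add: evv_def ev_conj4[OF w vw])
  have ker: "form_kernel (T (normal_of w i)) = form_kernel (normal_of v (conj_list ! i))" if i: "i < 35" for i
  proof (rule form_kernel_eq_if_parallel)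
    have "(normal_list ! i, conj_list ! i) \<in> set (zip normal_list conj_list)"
      using i length_normal_list conj_list_bound(1) by (auto simp: set_zip)
    then have "cross4 (twist4 (normal_list ! i)) (map_prod conj4 (map_prod conj4 conj4) (normal_list ! (conj_list ! i)))
       = ((0,0,0,0),(0,0,0,0),(0,0,0,0))" using twist_check by blast
    then have "cross3 (evv w (twist4 (normal_list ! i))) (evv w (map_prod conj4 (map_prod conj4 conj4) (normal_list ! (conj_list ! i)))) = 0"
      using evv_cross4[OF w, of "twist4 (normal_list ! i)" "map_prod conj4 (map_prod conj4 conj4) (normal_list ! (conj_list ! i))"]
      by (simp add: evv_def vec_eq_iff forall_3)
    then show "cross3 (T (normal_of w i)) (normal_of v (conj_list ! i)) = 0"
      by (simp add: T_evv conj normal_of_def)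
    show "T (normal_of w i) \<noteq> 0" using T0 normal_of_neq_0[OF w i] by blast
    have "conj_list ! i < 35" using conj_list_bound i by (metis nth_mem)
    then show "normal_of v (conj_list ! i) \<noteq> 0" by (rule normal_of_neq_0[OF v])
  qed
  have "(\<lambda>i. conj_list ! i) ` {..<35} = {..<35}"
  proof -
    have "set conj_list = (\<lambda>i. conj_list ! i) ` {..<35}"
      using conj_list_bound(1) by (auto simp: set_conv_nth)
    moreover have "set conj_list = {..<35}"
      using conj_list_bound by (intro card_subset_eq) (auto simp: distinct_card)
    ultimately show ?thesis by simp
  qed
  then have "A35 v = (\<lambda>i. form_kernel (normal_of v (conj_list ! i))) ` {..<35}"
    unfolding A35_eq[OF v] by (metis image_image)
  also have "\<dots> = form_kernel ` T ` normal_of w ` {..<35}"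
    unfolding image_image by (intro image_cong) (auto simp: ker)
  finally have A: "A35 v = form_kernel ` T ` normal_of w ` {..<35}" .
  show ?thesis unfolding A A35_eq[OF w]
    by (rule isomorphic_oriented_matroids_transform[OF adj \<open>bij U\<close>])
      (auto dest!: T0 simp: normal_of_neq_0[OF w])
qed

section \<open>The automorphism group\<close>

definition rot :: "nat \<Rightarrow> nat" where "rot i = (if i < 35 then rot_list ! i else i)"
definition mirror :: "nat \<Rightarrow> nat" where "mirror i = (if i < 35 then refl_list ! i else i)"

lemma rot_less: "i < 35 \<Longrightarrow> rot i < 35"
  using rot_list_bound nth_mem[of i rot_list] by (simp add: rot_def)

lemma mirror_less: "i < 35 \<Longrightarrow> mirror i < 35"
  using refl_list_bound nth_mem[of i refl_list] by (simp add: mirror_def)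

lemma rot_pow: "i < 35 \<Longrightarrow> (rot ^^ k) i < 35 \<and> ((nth rot_list) ^^ k) i = (rot ^^ k) i"
  by (induction k) (auto simp: rot_less, simp add: rot_def)

lemma rot_10: "rot ^^ 10 = id"
proof
  fix i
  show "(rot ^^ 10) i = id i"
  proof (cases "i < 35")
    case True
    then show ?thesis using rot_order rot_pow[OF True, of 10] by simp
  next
    case False
    have "(rot ^^ k) i = i" for k using False by (induction k) (auto simp: rot_def)
    then show ?thesis by simp
  qed
qed

lemma mirror_mirror: "mirror \<circ> mirror = id"
proof
  fix i
  show "(mirror \<circ> mirror) i = id i"
    using refl_order mirror_less[of i] by (cases "i < 35") (auto simp: mirror_def)
qed

lemma mirror_rot_mirror_rot: "mirror \<circ> rot \<circ> mirror \<circ> rot = id"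
proof
  fix i
  show "(mirror \<circ> rot \<circ> mirror \<circ> rot) i = id i"
  proof (cases "i < 35")
    case True
    then have "rot i < 35" "mirror (rot i) < 35" "rot (mirror (rot i)) < 35" using rot_less mirror_less by auto
    then have "(mirror \<circ> rot \<circ> mirror \<circ> rot) i = refl_list ! (rot_list ! (refl_list ! (rot_list ! i)))"
      using True by (simp add: mirror_def rot_def)
    then show ?thesis using refl_rot True by simp
  qed (simp add: mirror_def rot_def)
qed

lemma rot_pow_mod: "rot ^^ k = rot ^^ (k mod 10)"
proof -
  have "rot ^^ (10 * m) = id" for m
    by (induction m) (simp_all add: funpow_add rot_10)
  then show ?thesis
    by (metis comp_id div_mult_mod_eq funpow_add id_comp mult.commute)
qed

lemma mirror_rot_swap: "mirror \<circ> rot ^^ k = rot ^^ (9 * k) \<circ> mirror"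
proof -
  have one: "mirror \<circ> rot = rot ^^ 9 \<circ> mirror"
  proof -
    have "rot ^^ 10 = rot \<circ> rot ^^ 9" by (simp add: numeral_eq_Suc)
    then have r: "rot \<circ> rot ^^ 9 = id" using rot_10 by simp
    have "mirror \<circ> rot \<circ> mirror = mirror \<circ> rot \<circ> mirror \<circ> (rot \<circ> rot ^^ 9)" by (simp add: r)
    also have "\<dots> = rot ^^ 9" using mirror_rot_mirror_rot by (simp add: comp_assoc[symmetric])
    finally have "mirror \<circ> rot \<circ> (mirror \<circ> mirror) = rot ^^ 9 \<circ> mirror" by (simp add: comp_assoc[symmetric])
    then show ?thesis by (simp add: mirror_mirror)
  qed
  show ?thesis
  proof (induction k)
    case (Suc k)
    have "mirror \<circ> rot ^^ Suc k = (mirror \<circ> rot) \<circ> rot ^^ k" by (simp add: comp_assoc)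
    also have "\<dots> = rot ^^ 9 \<circ> (mirror \<circ> rot ^^ k)" by (simp add: one comp_assoc)
    also have "\<dots> = (rot ^^ 9 \<circ> rot ^^ (9 * k)) \<circ> mirror" by (simp only: Suc comp_assoc)
    also have "rot ^^ 9 \<circ> rot ^^ (9 * k) = rot ^^ (9 * Suc k)" by (simp add: funpow_add[symmetric])
    finally show ?case .
  qed simp
qed

text \<open>The element \<open>(k, b)\<close> acts as the \<open>k\<close>-th power of the rotation after \<open>b\<close> reflections, in accordance with the
  multiplication of \<open>dihedral_group\<close>.\<close>

definition perm_of :: "int \<times> bool \<Rightarrow> nat \<Rightarrow> nat" where
  "perm_of = (\<lambda>(k, b). rot ^^ nat k \<circ> (if b then mirror else id))"

abbreviation (input) D10 :: "(int \<times> bool) monoid" where "D10 \<equiv> dihedral_group 10"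

lemma perm_of_mult:
  assumes "x \<in> carrier D10" "y \<in> carrier D10"
  shows "perm_of (x \<otimes>\<^bsub>D10\<^esub> y) = perm_of x \<circ> perm_of y"
proof -
  obtain k b l c where xy: "x = (k, b)" "y = (l, c)" by (cases x; cases y)
  have kl: "0 \<le> k" "k < 10" "0 \<le> l" "l < 10" using assms by (auto simp: xy dihedral_group_def)
  have red: "rot ^^ nat (m mod 10) = rot ^^ r" if "m mod 10 = int r mod 10" for m r
    using rot_pow_mod[of r] that by (simp add: nat_mod_as_int)
  show ?thesis
  proof (cases b)
    case False
    have "rot ^^ nat ((k + l) mod 10) = rot ^^ (nat k + nat l)" by (rule red) (use kl in simp)
    then show ?thesis using False by (simp add: xy dihedral_group_def perm_of_def funpow_add comp_assoc)
  next
    case True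
    have "rot ^^ nat ((k - l) mod 10) = rot ^^ (nat k + 9 * nat l)"
    proof (rule red)
      have "int (nat k + 9 * nat l) = (k - l) + 10 * l" using kl by simp
      then show "(k - l) mod 10 = int (nat k + 9 * nat l) mod 10" by (simp only: mod_mult_self2)
    qed
    then have e: "rot ^^ nat ((k - l) mod 10) = rot ^^ nat k \<circ> rot ^^ (9 * nat l)" by (simp add: funpow_add)
    have "perm_of x \<circ> perm_of y = rot ^^ nat k \<circ> (mirror \<circ> rot ^^ nat l) \<circ> (if c then mirror else id)"
      using True by (simp add: xy perm_of_def comp_assoc)
    also have "\<dots> = rot ^^ nat k \<circ> rot ^^ (9 * nat l) \<circ> (mirror \<circ> (if c then mirror else id))"
      by (simp add: mirror_rot_swap comp_assoc)
    also have "mirror \<circ> (if c then mirror else id) = (if c then id else mirror)" by (simp add: mirror_mirror)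
    finally have f: "perm_of x \<circ> perm_of y = rot ^^ nat k \<circ> rot ^^ (9 * nat l) \<circ> (if c then id else mirror)" .
    have "perm_of (x \<otimes>\<^bsub>D10\<^esub> y) = rot ^^ nat ((k - l) mod 10) \<circ> (if c then id else mirror)"
      using True by (simp add: xy dihedral_group_def perm_of_def)
    then show ?thesis unfolding f e .
  qed
qed

lemma group_D10: "group D10" by (rule dihedral_group_is_group) simp

lemma perm_of_one: "perm_of \<one>\<^bsub>D10\<^esub> = id" by (simp add: perm_of_def dihedral_group_def)

context
  fixes w :: real
  assumes w: "is_parameter w"
begin

interpretation pa: plane_arrangement "normal_of w" 35
  by (rule normal_arrangement[OF w])

text \<open>The flats other than the lines are permuted by every permutation of the planes, so only the blocks matter.\<close>

lemma flat_permI: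
  assumes "bij_betw \<pi> {..<35} {..<35}" "\<And>k. k < n_blocks \<Longrightarrow> \<exists>l<n_blocks. \<pi> ` block k = block l"
  shows "pa.flat_perm \<pi>"
  unfolding pa.flat_perm_def
proof (intro conjI assms(1) ballI)
  fix X assume "X \<in> pa.lat"
  then consider "X = UNIV" | "X = {0}" | i where "i < 35" "X = form_kernel (normal_of w i)" | "X \<in> pa.rank2"
    unfolding pa.intersection_lattice_eq by blast
  then show "\<pi> ` pa.idx X \<in> pa.idx ` pa.lat"
  proof cases
    case 1
    then have "\<pi> ` pa.idx X = pa.idx UNIV" by (simp add: pa.idx_UNIV)
    moreover have "UNIV \<in> pa.lat" by (simp add: pa.intersection_lattice_eq)
    ultimately show ?thesis by blast
  next
    case 2
    then have "\<pi> ` pa.idx X = pa.idx {0}" using assms(1) by (simp add: pa.idx_zero bij_betw_def)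
    moreover have "{0} \<in> pa.lat" by (simp add: pa.intersection_lattice_eq)
    ultimately show ?thesis by blast
  next
    case 3
    have p: "\<pi> i < 35" using assms(1) 3(1) bij_betwE by blast
    have "\<pi> ` pa.idx X = pa.idx (form_kernel (normal_of w (\<pi> i)))"
      unfolding 3(2) pa.idx_plane[OF 3(1)] pa.idx_plane[OF p] by simp
    then show ?thesis using pa.plane_in_lat[OF p] by blast
  next
    case 4
    then obtain k where k: "k < n_blocks" "X = blk_line w k" using rank2_eq[OF w] by auto
    obtain l where l: "l < n_blocks" "\<pi> ` block k = block l" using assms(2)[OF k(1)] by blast
    have "\<pi> ` pa.idx X = pa.idx (blk_line w l)" using idx_blk_line[OF w] k l by simp
    moreover have "blk_line w l \<in> pa.lat" using l(1) rank2_eq[OF w] pa.rank2_in_lat by blast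
    ultimately show ?thesis by blast
  qed
qed

lemma flat_perm_list:
  assumes "length xs = 35" "\<forall>i\<in>set xs. i < 35" "distinct xs"
    and "\<forall>P\<in>set block_list. sort (map (nth xs) P) \<in> set block_list"
    and \<pi>: "\<And>i. i < 35 \<Longrightarrow> \<pi> i = xs ! i"
  shows "pa.flat_perm \<pi>"
proof (rule flat_permI)
  have "inj_on \<pi> {..<35}" using assms(1,3) \<pi> by (auto simp: inj_on_def nth_eq_iff_index_eq)
  moreover have "\<pi> ` {..<35} \<subseteq> {..<35}" using assms(1,2) \<pi> by auto
  ultimately show "bij_betw \<pi> {..<35} {..<35}" using endo_inj_surj[of "{..<35}" \<pi>] by (simp add: bij_betw_def)
  fix k assume k: "k < n_blocks"
  then have "sort (map (nth xs) (block_list ! k)) \<in> set block_list" using assms(4) by simp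
  then obtain l where l: "l < n_blocks" "block_list ! l = sort (map (nth xs) (block_list ! k))" by (metis in_set_conv_nth)
  have "\<pi> ` block k = (nth xs) ` block k" using \<pi> block_less[OF w k] by (intro image_cong) auto
  also have "\<dots> = block l" by (simp add: block_def l(2))
  finally show "\<exists>l<n_blocks. \<pi> ` block k = block l" using l(1) by blast
qed

lemma flat_perm_id: "pa.flat_perm id"
  by (rule flat_permI) auto

lemma flat_perm_perm_of: "pa.flat_perm (perm_of x)"
proof -
  have r: "pa.flat_perm rot" by (rule flat_perm_list[OF rot_list_bound rot_list_blocks]) (simp add: rot_def)
  have s: "pa.flat_perm mirror" by (rule flat_perm_list[OF refl_list_bound refl_list_blocks]) (simp add: mirror_def)
  have "pa.flat_perm (rot ^^ k)" for k
  proof (induction k)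
    case 0
    show ?case unfolding funpow.simps(1) by (rule flat_perm_id)
  next
    case (Suc k)
    show ?case unfolding funpow.simps(2) by (rule pa.flat_perm_comp[OF r Suc])
  qed
  moreover have "pa.flat_perm (if b then mirror else id)" for b using s flat_perm_id by simp
  ultimately have "pa.flat_perm (rot ^^ nat k \<circ> (if b then mirror else id))" for k b
    by (rule pa.flat_perm_comp)
  then show ?thesis by (cases x) (simp only: perm_of_def prod.case)
qed

lemma nth_colour_table: "i < 35 \<Longrightarrow> colour_table ! i = row_of i"
  using arg_cong[OF rows_check, of "\<lambda>xs. xs ! i"] by simp

lemma colour_eq:
  assumes "i < 35" "j < 35" "i \<noteq> j" shows "pa.colour i j = colour_table ! i ! j"
proof -
  obtain k where k: "k < n_blocks" "i \<in> block k" "j \<in> block k" using block_exists[OF w assms] by blast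
  let ?f = "find (\<lambda>P. j \<in> set P) (filter (\<lambda>P. i \<in> set P) block_list)"
  have "?f \<noteq> None" using k by (auto simp: find_None_iff block_def)
  then obtain P where P: "?f = Some P" by blast
  then have "P \<in> set block_list" "i \<in> set P" "j \<in> set P" by (auto simp: find_Some_iff) (metis filter_is_subset in_set_conv_nth mem_Collect_eq nth_mem set_filter subsetD)+
  then obtain l where l: "l < n_blocks" "P = block_list ! l" "i \<in> block l" "j \<in> block l" by (metis block_def in_set_conv_nth)
  have "row_of i ! j = length P" using assms P by (simp add: row_of_def)
  also have "\<dots> = card (block l)" using card_block[OF w l(1)] l(2) by simp
  also have "\<dots> = pa.colour i j"
    unfolding pa.colour_def block_line_eq[OF w l(1,3,4) assms(3)] idx_blk_line[OF w l(1)] ..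
  finally show ?thesis using nth_colour_table[OF assms(1)] by simp
qed

lemma colour_table_diag: "i < 35 \<Longrightarrow> colour_table ! i ! i = 0"
  by (simp add: nth_colour_table row_of_def)

lemma length_rows: "i < 35 \<Longrightarrow> length (colour_table ! i) = 35" "length colour_table = 35"
  using arg_cong[OF rows_check, of length] by (simp_all add: nth_colour_table row_of_def)

definition coloured :: "nat \<Rightarrow> nat \<Rightarrow> nat set" where
  "coloured i c = {j. j < 35 \<and> j \<noteq> i \<and> pa.colour i j = c}"

lemma profile_eq: "i < 35 \<Longrightarrow> profiles ! i = (card (coloured i 4), card (coloured i 5))"
proof -
  assume i: "i < 35"
  have "length (filter ((=) c) (colour_table ! i)) = card (coloured i c)" if "c \<noteq> 0" for c
    unfolding length_filter_conv_card coloured_def length_rows(1)[OF i]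
    using colour_eq[OF i] colour_table_diag[OF i] that by (intro arg_cong[where f = card]) fastforce
  then show ?thesis
    using arg_cong[OF profiles_check, of "\<lambda>xs. xs ! i"] i length_rows(2) by simp
qed

lemma perm_less: "pa.flat_perm \<pi> \<Longrightarrow> i < 35 \<Longrightarrow> \<pi> i < 35"
  using pa.flat_perm_bij bij_betwE by blast

lemma perm_inj: "pa.flat_perm \<pi> \<Longrightarrow> i < 35 \<Longrightarrow> j < 35 \<Longrightarrow> \<pi> i = \<pi> j \<Longrightarrow> i = j"
  using bij_betw_imp_inj_on[OF pa.flat_perm_bij] by (auto simp: inj_on_def)

lemma profile_perm:
  assumes \<pi>: "pa.flat_perm \<pi>" and i: "i < 35" shows "profiles ! \<pi> i = profiles ! i"
proof -
  have "coloured (\<pi> i) c = \<pi> ` coloured i c" for c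
  proof (intro Set.set_eqI iffI)
    fix j assume j: "j \<in> coloured (\<pi> i) c"
    then have "j \<in> \<pi> ` {..<35}" using pa.flat_perm_bij[OF \<pi>] by (simp add: bij_betw_def coloured_def)
    then obtain k where k: "k < 35" "j = \<pi> k" by auto
    then have "k \<noteq> i" using j by (auto simp: coloured_def)
    then show "j \<in> \<pi> ` coloured i c" using k j pa.flat_perm_colour[OF \<pi> i k(1)] by (auto simp: coloured_def)
  next
    fix j assume "j \<in> \<pi> ` coloured i c"
    then obtain k where k: "k < 35" "k \<noteq> i" "pa.colour i k = c" "j = \<pi> k" by (auto simp: coloured_def)
    then show "j \<in> coloured (\<pi> i) c"
      using perm_less[OF \<pi> k(1)] perm_inj[OF \<pi> k(1) i] pa.flat_perm_colour[OF \<pi> i k(1)] by (auto simp: coloured_def)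
  qed
  moreover have "card (\<pi> ` coloured i c) = card (coloured i c)" for c
    by (intro card_image inj_on_subset[OF bij_betw_imp_inj_on[OF pa.flat_perm_bij[OF \<pi>]]]) (auto simp: coloured_def)
  ultimately show ?thesis using profile_eq[OF i] profile_eq[OF perm_less[OF \<pi> i]] by simp
qed

lemma table_perm:
  assumes "pa.flat_perm \<pi>" "i < 35" "j < 35" "i \<noteq> j"
  shows "colour_table ! \<pi> i ! \<pi> j = colour_table ! i ! j"
  using pa.flat_perm_colour[OF assms] colour_eq assms perm_less[OF assms(1)] perm_inj[OF assms(1)] by metis

lemma signature_nth: "x < 35 \<Longrightarrow> base_signature ! x = (profiles ! x, colour_table ! 0 ! x, colour_table ! 27 ! x)"
proof -
  assume x: "x < 35"
  have "length profiles = 35" by (simp add: profiles_def)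
  then show ?thesis using x unfolding base_signature_check[symmetric] by (simp add: length_rows)
qed

lemma mem_select:
  assumes "i < length ys" "P i (ys ! i)"
  shows "i \<in> set (map fst (filter (\<lambda>(x, y). P x y) (zip [0..<length ys] ys)))"
proof -
  have "(i, ys ! i) \<in> set (zip [0..<length ys] ys)"
    using nth_mem[of i "zip [0..<length ys] ys"] assms(1) by simp
  then have "(i, ys ! i) \<in> set (filter (\<lambda>(x, y). P x y) (zip [0..<length ys] ys))"
    using assms(2) by simp
  then show ?thesis unfolding set_map by (rule image_eqI[rotated]) simp
qed

text \<open>Fixing the base forces the planes 7, 22, 28 to be fixed, by their profiles and colours, and the colours towards these and
  plane 0 distinguish all planes.\<close>

lemma perm_rigid:
  assumes \<pi>: "pa.flat_perm \<pi>" and 0: "\<pi> 0 = 0" and 27: "\<pi> 27 = 27" and i: "i < 35"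
  shows "\<pi> i = i"
proof -
  have len: "length base_signature = 35" by (simp add: base_signature_def)
  have fix_S: "\<pi> s = s" if s: "s \<in> {7, 22, 28}" for s
  proof -
    have s35: "s < 35" "s \<noteq> 0" "s \<noteq> 27" using s by auto
    have x: "\<pi> s < 35" using perm_less[OF \<pi>] s35 by blast
    have "base_signature ! \<pi> s = base_signature ! s"
      unfolding signature_nth[OF x] signature_nth[OF s35(1)]
      using profile_perm[OF \<pi> s35(1)] table_perm[OF \<pi>, of 0 s] table_perm[OF \<pi>, of 27 s] s35 0 27 by simp
    then have "\<pi> s \<in> set (map fst (filter (\<lambda>(x, g'). base_signature ! s = g') (zip [0..<35] base_signature)))"
      using mem_select[of "\<pi> s" base_signature "\<lambda>_ g'. base_signature ! s = g'"] x len by simp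
    moreover have "map fst (filter (\<lambda>(x, g'). base_signature ! s = g') (zip [0..<35] base_signature)) = [s]"
      using base_fixes_check s by (auto simp del: filter.simps)
    ultimately show ?thesis by simp
  qed
  have S: "\<pi> s = s" if "s \<in> {0, 7, 22, 28}" for s using that fix_S 0 by auto
  show ?thesis
  proof (cases "i \<in> {0, 7, 22, 28}")
    case True
    then show ?thesis by (rule S)
  next
    case False
    have key: "row_keys ! x = colour_table ! 0 ! x + 6 * (colour_table ! 7 ! x + 6 * (colour_table ! 22 ! x
       + 6 * (colour_table ! 28 ! x)))" if "x < 35" for x
      using that unfolding row_keys_check[symmetric] by (simp add: length_rows)
    have x: "\<pi> i < 35" using perm_less[OF \<pi> i] .
    have t: "colour_table ! s ! \<pi> i = colour_table ! s ! i" if "s \<in> {0, 7, 22, 28}" for s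
      using table_perm[OF \<pi>, of s i] S[OF that] that i False by auto
    have "row_keys ! \<pi> i = row_keys ! i" unfolding key[OF x] key[OF i] by (simp add: t)
    moreover have "length row_keys = 35" by (simp add: row_keys_def)
    ultimately show ?thesis using nth_eq_iff_index_eq[OF distinct_row_keys] x i by simp
  qed
qed

lemma perm_of_base: "perm_of (int k, b) 0 = ((nth rot_list) ^^ k) (if b then refl_list ! 0 else 0)"
  "perm_of (int k, b) 27 = ((nth rot_list) ^^ k) (if b then refl_list ! 27 else 27)"
proof -
  have "mirror 0 = refl_list ! 0" "mirror 27 = refl_list ! 27" by (simp_all add: mirror_def)
  moreover have "mirror 0 < 35" "mirror 27 < 35" by (auto intro: mirror_less)
  ultimately show "perm_of (int k, b) 0 = ((nth rot_list) ^^ k) (if b then refl_list ! 0 else 0)"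
    "perm_of (int k, b) 27 = ((nth rot_list) ^^ k) (if b then refl_list ! 27 else 27)"
    using rot_pow[of 0 k] rot_pow[of 27 k] rot_pow[of "mirror 0" k] rot_pow[of "mirror 27" k] by (auto simp: perm_of_def)
qed

text \<open>The image of the base under a symmetry is one of the 20 candidates, hence also its image under some element of the
  dihedral group; the quotient of the two fixes the base.\<close>

lemma perm_of_surj:
  assumes \<pi>: "pa.flat_perm \<pi>"
  shows "\<exists>x\<in>carrier D10. \<forall>i<35. \<pi> i = perm_of x i"
proof -
  define p q where "p = \<pi> 0" and "q = \<pi> 27"
  have pq: "p < 35" "q < 35" "q \<noteq> p"
    using perm_less[OF \<pi>] perm_inj[OF \<pi>, of 0 27] by (auto simp: p_def q_def)
  have len: "length profiles = 35" by (simp add: profiles_def)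
  have "profiles ! p = (0, 20)" using profile_perm[OF \<pi>, of 0] by (simp add: p_def profiles_def)
  then have "p \<in> set (map fst (filter (\<lambda>(i, t). t = (0, 20)) (zip [0..<35] profiles)))"
    using mem_select[of p profiles "\<lambda>_ t. t = (0, 20)"] pq(1) len by simp
  then have p5: "p \<in> set [0, 1, 5, 10, 25]" unfolding mirrors_check .
  have "profiles ! q = (9, 8)" using profile_perm[OF \<pi>, of 27] by (simp add: q_def profiles_def)
  moreover have "colour_table ! p ! q = 5"
  proof -
    have "colour_table ! 0 ! 27 = 5" by (simp add: colour_table_def)
    then show ?thesis using table_perm[OF \<pi>, of 0 27] by (simp add: p_def q_def)
  qed
  ultimately have "(q, 5, (9, 8)) \<in> set (zip [0..<35] (zip (colour_table ! p) profiles))"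
    using nth_mem[of q "zip [0..<35] (zip (colour_table ! p) profiles)"] pq len length_rows(1)[OF pq(1)] by simp
  then have "(q, 5, (9, 8)) \<in> set (filter (\<lambda>(q, c, t). c = 5 \<and> t = (9, 8) \<and> q \<noteq> p)
      (zip [0..<35] (zip (colour_table ! p) profiles)))" using pq(3) by simp
  then have "(p, q) \<in> set (map (\<lambda>(q, _, _). (p, q)) (filter (\<lambda>(q, c, t). c = 5 \<and> t = (9, 8) \<and> q \<noteq> p)
      (zip [0..<35] (zip (colour_table ! p) profiles))))"
    unfolding set_map by (rule image_eqI[rotated]) simp
  then have "(p, q) \<in> set (concat (map (\<lambda>p. map (\<lambda>(q, _, _). (p, q)) (filter (\<lambda>(q, c, t). c = 5 \<and> t = (9, 8) \<and> q \<noteq> p)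
      (zip [0..<35] (zip (colour_table ! p) profiles)))) [0, 1, 5, 10, 25]))"
    unfolding set_concat set_map[of _ "[0, 1, 5, 10, 25]"] using p5 by blast
  note this[unfolded base_images_check]
  from bspec[OF base_images this] obtain k b where kb: "k \<in> set [0..<10]" "((nth rot_list) ^^ k) (if b then refl_list ! 0 else 0) = p"
    "((nth rot_list) ^^ k) (if b then refl_list ! 27 else 27) = q"
    unfolding prod.case by blast
  define x where "x = (int k, b)"
  have x: "x \<in> carrier D10" using kb(1) by (simp add: x_def dihedral_group_def)
  have xb: "perm_of x 0 = \<pi> 0" "perm_of x 27 = \<pi> 27" using kb perm_of_base[of k b] by (simp_all add: x_def p_def q_def)
  define y where "y = inv\<^bsub>D10\<^esub> x"
  have y: "y \<in> carrier D10" "y \<otimes>\<^bsub>D10\<^esub> x = \<one>\<^bsub>D10\<^esub>" "x \<otimes>\<^bsub>D10\<^esub> y = \<one>\<^bsub>D10\<^esub>"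
    using group.inv_closed[OF group_D10 x] group.l_inv[OF group_D10 x] group.r_inv[OF group_D10 x] by (simp_all add: y_def)
  have yx: "perm_of y (perm_of x i) = i" and xy: "perm_of x (perm_of y i) = i" for i
    using perm_of_mult[OF y(1) x] perm_of_mult[OF x y(1)] y(2,3) perm_of_one by (simp_all add: fun_eq_iff)
  have f: "pa.flat_perm (perm_of y \<circ> \<pi>)" by (rule pa.flat_perm_comp[OF flat_perm_perm_of \<pi>])
  have "\<pi> i = perm_of x i" if i: "i < 35" for i
  proof -
    have "(perm_of y \<circ> \<pi>) i = i"
      by (rule perm_rigid[OF f _ _ i]) (simp_all add: xb[symmetric] yx)
    then have "perm_of x (perm_of y (\<pi> i)) = perm_of x i" by simp
    then show ?thesis by (simp add: xy)
  qed
  then show ?thesis using x by blast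
qed

text \<open>Only the unit of the dihedral group fixes the base.\<close>

lemma perm_of_inj:
  assumes x: "x \<in> carrier D10" and y: "y \<in> carrier D10" and eq: "\<And>i. i < 35 \<Longrightarrow> perm_of x i = perm_of y i"
  shows "x = y"
proof -
  interpret D: group D10 by (rule group_D10)
  define z where "z = inv\<^bsub>D10\<^esub> y \<otimes>\<^bsub>D10\<^esub> x"
  have z: "z \<in> carrier D10" using x y by (simp add: z_def)
  have "perm_of z i = i" if "i < 35" for i
  proof -
    have "perm_of z i = perm_of (inv\<^bsub>D10\<^esub> y) (perm_of y i)"
      using perm_of_mult[of "inv\<^bsub>D10\<^esub> y" x] x y eq[OF that] by (simp add: z_def)
    also have "\<dots> = i" using perm_of_mult[of "inv\<^bsub>D10\<^esub> y" y] y perm_of_one by (simp add: fun_eq_iff)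
    finally show ?thesis .
  qed
  then have z0: "perm_of z 0 = 0" "perm_of z 27 = 27" by auto
  obtain k b where kb: "z = (k, b)" by (cases z)
  have "0 \<le> k" "k < 10" using z by (auto simp: kb dihedral_group_def)
  then obtain m where m: "k = int m" "m \<in> set [0..<10]" using zero_le_imp_eq_int by fastforce
  have "b \<in> set [False, True]" by simp
  then have "m = 0 \<and> \<not> b" using base_stabilizer m(2) z0 perm_of_base[of m b] by (simp only: kb m(1)) blast
  then have "z = \<one>\<^bsub>D10\<^esub>" by (simp add: kb m(1) dihedral_group_def)
  then show ?thesis using x y unfolding z_def by (metis D.inv_closed D.inv_equality D.inv_inv)
qed

lemma automorphism_group: "poset_automorphism_group pa.lat \<cong> D10"
proof (rule pa.aut_group_iso[OF group_D10])
  show "pa.flat_perm (perm_of x)" for x by (rule flat_perm_perm_of)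
  show "perm_of (x \<otimes>\<^bsub>D10\<^esub> y) i = perm_of x (perm_of y i)" if "x \<in> carrier D10" "y \<in> carrier D10" for x y i
    using perm_of_mult[OF that] by simp
  show "x = y" if "x \<in> carrier D10" "y \<in> carrier D10" "\<And>i. i < 35 \<Longrightarrow> perm_of x i = perm_of y i" for x y
    using perm_of_inj that by blast
  show "\<exists>x\<in>carrier D10. \<forall>i<35. \<pi> i = perm_of x i" if "pa.flat_perm \<pi>" for \<pi>
    using perm_of_surj[OF that] .
qed

lemma arrangement_properties:
  "card (R35 w) = 35" "hyperplane_arrangement (A35 w)" "card (A35 w) = 35"
  "simplicial_arrangement (A35 w)"
  "poset_automorphism_group (intersection_lattice (A35 w)) \<cong> D10"
  "characteristic_polynomial (A35 w) = [:-1, 1:] * [:305, -34, 1:]"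
  "\<not> free_arrangement (A35 w)"
proof -
  note A = A35_arr[OF w]
  show c: "card (A35 w) = 35" unfolding A by (simp add: card_image pa.inj_on_plane)
  have "card (A35 w) \<le> card (R35 w)" unfolding A35_def by (rule card_image_le) (simp add: R35_eq)
  moreover have "card (R35 w) \<le> 35"
  proof -
    have "card (R35 w) \<le> card (set normal_list)" unfolding R35_eq by (rule card_image_le) simp
    also have "\<dots> \<le> 35" using card_length[of normal_list] length_normal_list by simp
    finally show ?thesis .
  qed
  ultimately show "card (R35 w) = 35" using c by simp
  show "hyperplane_arrangement (A35 w)" unfolding A by (rule pa.hyperplane_arrangement_arr)
  show "simplicial_arrangement (A35 w)" unfolding A
    by (rule pa.simplicial_if_count) (simp_all add: pa.sum_card_lines incidences_510[OF w] earlier_lines_339[OF w])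
  show "poset_automorphism_group (intersection_lattice (A35 w)) \<cong> D10" unfolding A by (rule automorphism_group)
  show "characteristic_polynomial (A35 w) = [:-1, 1:] * [:305, -34, 1:]"
    unfolding A pa.characteristic_polynomial_arr earlier_lines_339[OF w] by simp
  show "\<not> free_arrangement (A35 w)"
  proof
    assume "free_arrangement (A35 w)"
    then have "4 * (int pa.earlier_lines - int 35 + 1) \<le> (int 35 - 1)\<^sup>2"
      unfolding A by (rule pa.free_imp_discriminant)
    then show False by (simp add: earlier_lines_339[OF w])
  qed
qed

end

theorem mainTheorem1:
  shows "card {\<omega>. is_parameter \<omega>} = 2 \<and>
    (\<forall>\<omega>. is_parameter \<omega> \<longrightarrow>
       card (R35 \<omega>) = 35 \<and>
       hyperplane_arrangement (A35 \<omega>) \<and>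
       card (A35 \<omega>) = 35 \<and>
       simplicial_arrangement (A35 \<omega>) \<and>
       poset_automorphism_group (intersection_lattice (A35 \<omega>)) \<cong> dihedral_group 10 \<and>
       characteristic_polynomial (A35 \<omega>) = [:-1, 1:] * [:305, -34, 1:] \<and>
       \<not> free_arrangement (A35 \<omega>)) \<and>
    (\<forall>\<omega> \<omega>'. is_parameter \<omega> \<and> is_parameter \<omega>' \<longrightarrow>
       isomorphic_oriented_matroids (A35 \<omega>) (A35 \<omega>'))"
proof -
  have iso: "isomorphic_oriented_matroids (A35 \<omega>) (A35 \<omega>')"
    if p: "is_parameter \<omega>" "is_parameter \<omega>'" for \<omega> \<omega>'
  proof (cases "\<omega> = \<omega>'")
    case True
    have "v \<noteq> 0" if "v \<in> normal_of \<omega> ` {..<35}" for v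
      using that normal_of_neq_0[OF p(1)] by auto
    then have "isomorphic_oriented_matroids (A35 \<omega>) (A35 \<omega>)"
      unfolding A35_eq[OF p(1)] by (rule isomorphic_oriented_matroids_refl)
    then show ?thesis by (simp only: True)
  next
    case False
    have "\<omega>' * \<omega> = 1" by (rule parameter_product[OF p(2,1)]) (use False in simp)
    then show ?thesis by (rule twisted_arrangement[OF p(2,1)])
  qed
  show ?thesis
    by (intro conjI allI impI; (rule card_parameters | (rule arrangement_properties, assumption)
      | (erule conjE, rule iso, assumption, assumption)))
qed

end
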